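(* Let $\mathbf H$ be a smooth periodic Hankel operator with list of non-flat band functions $\mathcal E^\#$, and let $k_0\in(\omega/2)\mathbb Z$. (i) Let $E\in\mathcal E^\#$ be such that no other entry of $\mathcal E^\#$ takes the value $E(k_0)$ at $k_0$. Then $E(k)=E(2k_0-k)$ for all $k$, and $k_0$ is a non-degenerate extremum of $E$: $E'(k_0)=0$ and $E''(k_0)\neq0$. (ii) Suppose two distinct entries $E_1,E_2$ of $\mathcal E^\#$ satisfy $E_1(k_0)=E_2(k_0)$. Then $E_2(k)=E_1(2k_0-k)$ for all $k$, and $E_1'(k_0)=-E_2'(k_0)\neq0$.
   Context: Fix $T>0$, $\omega=2\pi/T$. $p$ is a real-valued $T$-periodic function with Fourier coefficients $\widetilde p_\ell=\frac1T\int_0^Te^{-i\ell\omega x}p(x)dx$ satisfying $\sum_\ell|\widetilde p_\ell|(1+\ell^2)^{1/4}<\infty$; $\mathbf H$ is the Hankel operator on $L^2(\mathbb R_+)$ with kernel $h(t)=p(\log t)/t$ (a smooth periodic Hankel operator). For $k\in\mathbb R$, $H(k)$ is the trace class self-adjoint operator on $\ell^2(\mathbb Z)$ with matrix $[H(k)]_{n,m}=B(\frac12-i\omega n-ik,\frac12+i\omega m+ik)\widetilde p_{n-m}$, $B(z_1,z_2)=\Gamma(z_1)\Gamma(z_2)/\Gamma(z_1+z_2)$. Band functions: there is a (unique up to ordering) finite or countable list $\mathcal E$, repetitions allowed, of non-vanishing real analytic real-valued functions on $\mathbb R$ such that for every $k$ the non-zero eigenvalues of $H(k)$, counted with multiplicity,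 are exactly the values $E(k)$, $E\in\mathcal E$, counted with repetition. A band function is flat if constant and non-flat otherwise; $\mathcal E^\#$ is the sublist of non-flat ones. *)

theory Defs
  imports "HOL-Analysis.Analysis"
begin

definition fourier_coeff :: "real \<Rightarrow> (real \<Rightarrow> real) \<Rightarrow> int \<Rightarrow> complex" where
  "fourier_coeff T p l =
     integral {0..T} (\<lambda>x. exp (- \<i> * of_int l * of_real (2*pi/T) * of_real x) * of_real (p x))
       / of_real T"

definition smooth_periodic_symbol :: "real \<Rightarrow> (real \<Rightarrow> real) \<Rightarrow> bool" where
  "smooth_periodic_symbol T p \<longleftrightarrow>
     T > 0 \<and> (\<forall>x. p (x + T) = p x) \<and> p absolutely_integrable_on {0..T} \<and>
     (\<lambda>l::int. norm (fourier_coeff T p l) * (1 + (real_of_int l)\<^sup>2) powr (1/4)) summable_on UNIV"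

text \<open>The matrix of the fibre operator H(k) on l^2(Z).\<close>
definition Hk :: "real \<Rightarrow> (real \<Rightarrow> real) \<Rightarrow> real \<Rightarrow> int \<Rightarrow> int \<Rightarrow> complex" where
  "Hk T p k n m =
     Beta (1/2 - \<i> * of_real (2*pi/T) * of_int n - \<i> * of_real k)
          (1/2 + \<i> * of_real (2*pi/T) * of_int m + \<i> * of_real k) * fourier_coeff T p (n - m)"

definition is_eigvec :: "(int \<Rightarrow> int \<Rightarrow> complex) \<Rightarrow> complex \<Rightarrow> (int \<Rightarrow> complex) \<Rightarrow> bool" where
  "is_eigvec M lam x \<longleftrightarrow>
     (\<lambda>n. (norm (x n))\<^sup>2) summable_on UNIV \<and>
     (\<forall>n. ((\<lambda>m. M n m * x m) has_sum (lam * x n)) UNIV)"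

definition indep_eigvecs :: "(int \<Rightarrow> int \<Rightarrow> complex) \<Rightarrow> complex \<Rightarrow> nat \<Rightarrow> bool" where
  "indep_eigvecs M lam n \<longleftrightarrow>
     (\<exists>v :: nat \<Rightarrow> int \<Rightarrow> complex.
        (\<forall>i<n. is_eigvec M lam (v i)) \<and>
        (\<forall>c :: nat \<Rightarrow> complex. (\<forall>m. (\<Sum>i<n. c i * v i m) = 0) \<longrightarrow> (\<forall>i<n. c i = 0)))"

text \<open>lam is an eigenvalue of M of (finite) multiplicity d (d = 0: not an eigenvalue).\<close>
definition eig_mult :: "(int \<Rightarrow> int \<Rightarrow> complex) \<Rightarrow> complex \<Rightarrow> nat \<Rightarrow> bool" where
  "eig_mult M lam d \<longleftrightarrow> (\<forall>n. indep_eigvecs M lam n \<longleftrightarrow> n \<le> d)"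

definition real_analytic :: "(real \<Rightarrow> real) \<Rightarrow> bool" where
  "real_analytic f \<longleftrightarrow>
     (\<forall>x0. \<exists>r>0. \<exists>a :: nat \<Rightarrow> real.
        \<forall>x. \<bar>x - x0\<bar> < r \<longrightarrow> (\<lambda>n. a n * (x - x0) ^ n) sums f x)"

text \<open>E (indexed by I, repetitions allowed) is a list of band functions of H:
  non-vanishing real analytic functions such that for every k the non-zero eigenvalues
  of H(k), counted with multiplicity, are exactly the values E i k, i in I.\<close>
definition band_functions :: "real \<Rightarrow> (real \<Rightarrow> real) \<Rightarrow> nat set \<Rightarrow> (nat \<Rightarrow> real \<Rightarrow> real) \<Rightarrow> bool" where
  "band_functions T p I E \<longleftrightarrow>
     (\<forall>i\<in>I. real_analytic (E i) \<and> (\<forall>k. E i k \<noteq> 0)) \<and>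
     (\<forall>k. \<forall>lam::complex. lam \<noteq> 0 \<longrightarrow>
        finite {i\<in>I. complex_of_real (E i k) = lam} \<and>
        eig_mult (Hk T p k) lam (card {i\<in>I. complex_of_real (E i k) = lam}))"

definition flat :: "(real \<Rightarrow> real) \<Rightarrow> bool" where
  "flat f \<longleftrightarrow> (\<exists>c. \<forall>k. f k = c)"

end

(*
  The matrix H(k) factors as \<Gamma>(1/2 - i x_n) Q_{n-m} \<Gamma>(1/2 + i x_m) with x_n = \<omega> n + k, so a principal minor
  over a finite set S is det Q_S times the product of \<pi> / cosh (\<pi> x_n) over n in S. By partial fractions, the sum
  of such a product over all translates of S does not depend on k if |S| is even, and is a multiple of
  F(k) = \<Sum>_n 1 / cosh (\<pi> x_n) if |S| is odd. Hence the Fredholm determinant of 1 - z H(k), the sum of its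
  principal minors, has the form A(z) + B(z) F(k) with entire A and B.

  H(k) is entrywise absolutely summable and Hermitian, so for real \<lambda> \<noteq> 0 this determinant vanishes at z = 1/\<lambda>
  exactly to the order of the multiplicity of the eigenvalue \<lambda>. Dividing by the factor of the flat bands shows
  that the product of E_i(k) - \<lambda>, over the non-flat bands with E_i(k0) = \<lambda>, is bounded below by a multiple of
  |F(k) - F(k0)|. For a constant symbol the determinant is an explicit product, which gives
  |F(k) - F(k0)| \<ge> c (k - k0)^2 for k0 in (\<omega>/2)Z: the bands through (k0, \<lambda>) meet that level with total order
  at most two. The reflection k \<mapsto> 2 k0 - k preserves the spectrum of H(k), hence permutes the band functions, and
  both claims follow.
*)

theory Submission
  imports Defs "HOL-Complex_Analysis.Complex_Analysis" "Jordan_Normal_Form.Determinant"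
begin

section \<open>Determinants over finite index sets\<close>

text \<open>The determinant is read at the fixed point z = 1/\<lambda>. A flat band with value
  \<lambda> would make it vanish there for every k, so the flat factor is divided out first. What is
  left is nonzero at 1/\<lambda> for some k, because non-flat bands take the value \<lambda> for
  only countably many k; hence the coefficient of F is nonzero there. The factors of the non-flat
  bands are then divided out as well, and the quotient is bounded by the maximum principle on a
  circle of fixed radius, uniformly for k near k0. This turns the behaviour of F into a bound on the
  bands. The order of the zero has to be the number of independent eigenvectors; Hermitian symmetry
  supplies this by excluding generalised eigenvectors. The sum of principal minors is unordered and
  dominated by products of row sums, so it converges by entrywise summability. The weight (1 +
  l^2)^(1/4) fits exactly: the entries of H(k) on the l-th diagonal have absolute sum of order sqrt
  |l| times the l-th Fourier coefficient.\<close>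

definition sdet :: "'a set \<Rightarrow> ('a \<Rightarrow> 'a \<Rightarrow> complex) \<Rightarrow> complex" where
  "sdet S M = (\<Sum>p | p permutes S. of_int (sign p) * (\<Prod>i\<in>S. M i (p i)))"

lemma sdet_cong:
  assumes "\<And>i j. i \<in> S \<Longrightarrow> j \<in> S \<Longrightarrow> M i j = M' i j"
  shows "sdet S M = sdet S M'"
  unfolding sdet_def
  by (intro sum.cong arg_cong2[where f = "(*)"] prod.cong) (auto simp: assms permutes_in_image)

lemma sdet_empty [simp]: "sdet {} M = 1"
  by (simp add: sdet_def)

lemma sdet_reindex:
  assumes f: "inj_on f S" and S: "finite S"
  shows "sdet (f ` S) M = sdet S (\<lambda>i j. M (f i) (f j))"
proof -
  have bij: "bij_betw f S (f ` S)" using f by (simp add: inj_on_imp_bij_betw)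
  have bij': "bij_betw (inv_into S f) (f ` S) S" using bij by (rule bij_betw_inv_into)
  have 1: "map_permutation (f ` S) (inv_into S f) (map_permutation S f p) = p" if "p permutes S" for p
    using f that bij by (intro map_permutation_compose_inv[where B = "f ` S"]) auto
  have 2: "map_permutation S f (map_permutation (f ` S) (inv_into S f) q) = q" if "q permutes f ` S" for q
    using f that bij' by (intro map_permutation_compose_inv[where B = S])
      (auto simp: f_inv_into_f)
  show ?thesis
    unfolding sdet_def
  proof (rule sum.reindex_bij_witness[of _ "map_permutation S f" "map_permutation (f ` S) (inv_into S f)"])
    fix q assume q: "q \<in> {p. p permutes f ` S}"
    let ?p = "map_permutation (f ` S) (inv_into S f) q"
    show "map_permutation S f ?p = q" using 2 q by simp
    have p: "?p permutes S" using q bij' by (auto intro: map_permutation_permutes)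
    then show "?p \<in> {p. p permutes S}" by simp
    have qp: "q (f i) = f (?p i)" if "i \<in> S" for i
      using map_permutation_apply[OF f that, of ?p] 2 q by simp
    have "sign (map_permutation S f ?p) = sign ?p"
      using f p S by (rule sign_map_permutation)
    then have "sign ?p = sign q" using 2 q by simp
    moreover have "(\<Prod>i\<in>f ` S. M i (q i)) = (\<Prod>i\<in>S. M (f i) (f (?p i)))"
      using f by (simp add: prod.reindex qp)
    ultimately show "of_int (sign ?p) * (\<Prod>i\<in>S. M (f i) (f (?p i)))
        = of_int (sign q) * (\<Prod>i\<in>f ` S. M i (q i))" by simp
  next
    fix p assume "p \<in> {p. p permutes S}"
    then show "map_permutation (f ` S) (inv_into S f) (map_permutation S f p) = p"
      and "map_permutation S f p \<in> {p. p permutes f ` S}"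
      using 1 bij by (auto intro: map_permutation_permutes)
  qed
qed

lemma sdet_scale:
  assumes "finite S"
  shows "sdet S (\<lambda>i j. u i * v j * M i j) = (\<Prod>i\<in>S. u i * v i) * sdet S M"
proof -
  have "(\<Prod>i\<in>S. u i * v (p i) * M i (p i)) = (\<Prod>i\<in>S. u i * v i) * (\<Prod>i\<in>S. M i (p i))"
    if "p permutes S" for p
    using prod.permute[OF that, of v] by (simp add: prod.distrib o_def)
  then show ?thesis
    unfolding sdet_def sum_distrib_left by (intro sum.cong) auto
qed

text \<open>Permutations are among all maps from S to S, and the sum over all maps factors into row
  sums. Unlike a factorial bound, this remains summable over all finite index sets.\<close>

lemma norm_sdet_le:
  assumes S: "finite S"
  shows "norm (sdet S M) \<le> (\<Prod>i\<in>S. \<Sum>j\<in>S. norm (M i j))"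
proof -
  have "norm (sdet S M) \<le> (\<Sum>p | p permutes S. norm (of_int (sign p) * (\<Prod>i\<in>S. M i (p i))))"
    unfolding sdet_def by (rule norm_sum)
  also have "\<dots> = (\<Sum>p | p permutes S. \<Prod>i\<in>S. norm (M i (p i)))"
    by (intro sum.cong) (auto simp: norm_mult prod_norm sign_def)
  also have "\<dots> = (\<Sum>f\<in>(\<lambda>p. restrict p S) ` {p. p permutes S}. \<Prod>i\<in>S. norm (M i (f i)))"
  proof (subst sum.reindex)
    show "inj_on (\<lambda>p. restrict p S) {p. p permutes S}"
    proof (rule inj_onI)
      fix p q assume *: "p \<in> {p. p permutes S}" "q \<in> {p. p permutes S}" "restrict p S = restrict q S"
      show "p = q"
      proof
        fix x show "p x = q x"
          using * by (cases "x \<in> S") (metis restrict_apply', simp add: permutes_not_in)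
      qed
    qed
  qed simp
  also have "\<dots> \<le> (\<Sum>f\<in>S \<rightarrow>\<^sub>E S. \<Prod>i\<in>S. norm (M i (f i)))"
    using S by (intro sum_mono2 finite_PiE prod_nonneg) (auto simp: permutes_in_image)
  also have "\<dots> = (\<Prod>i\<in>S. \<Sum>j\<in>S. norm (M i j))"
    using S by (intro prod_sum_PiE[symmetric]) auto
  finally show ?thesis .
qed

definition id_plus :: "('a \<Rightarrow> 'a \<Rightarrow> complex) \<Rightarrow> 'a \<Rightarrow> 'a \<Rightarrow> complex" where
  "id_plus K i j = of_bool (i = j) + K i j"

text \<open>Expanding each factor 1 + K selects the set U of indices where K is taken. A permutation
  that moves a point outside U contributes zero, and the others permute U.\<close>

lemma sdet_id_plus:
  assumes S: "finite S"
  shows "sdet S (id_plus K) = (\<Sum>U\<in>Pow S. sdet U K)"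
proof -
  have "sdet S (id_plus K) =
      (\<Sum>p | p permutes S. \<Sum>U\<in>Pow S. of_int (sign p) * ((\<Prod>i\<in>U. K i (p i)) * (\<Prod>i\<in>S-U. of_bool (i = p i))))"
    unfolding sdet_def
  proof (intro sum.cong refl)
    fix p assume "p \<in> {p. p permutes S}"
    have "(\<Prod>i\<in>S. id_plus K i (p i)) = (\<Prod>i\<in>S. K i (p i) + of_bool (i = p i))"
      by (simp add: id_plus_def add.commute)
    also have "\<dots> = (\<Sum>U\<in>Pow S. (\<Prod>i\<in>U. K i (p i)) * (\<Prod>i\<in>S-U. of_bool (i = p i)))"
      using S by (rule prod_add)
    finally show "of_int (sign p) * (\<Prod>i\<in>S. id_plus K i (p i)) =
       (\<Sum>U\<in>Pow S. of_int (sign p) * ((\<Prod>i\<in>U. K i (p i)) * (\<Prod>i\<in>S-U. of_bool (i = p i))))"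
      by (simp add: sum_distrib_left)
  qed
  also have "\<dots> = (\<Sum>U\<in>Pow S. \<Sum>p | p permutes S. of_int (sign p) * ((\<Prod>i\<in>U. K i (p i)) * (\<Prod>i\<in>S-U. of_bool (i = p i))))"
    by (rule sum.swap)
  also have "\<dots> = (\<Sum>U\<in>Pow S. sdet U K)"
  proof (intro sum.cong refl)
    fix U assume U: "U \<in> Pow S"
    have "(\<Sum>p | p permutes U. of_int (sign p) * (\<Prod>i\<in>U. K i (p i)))
      = (\<Sum>p | p permutes S. of_int (sign p) * ((\<Prod>i\<in>U. K i (p i)) * (\<Prod>i\<in>S-U. of_bool (i = p i))))"
    proof (rule sum.mono_neutral_cong_left)
      show "finite {p. p permutes S}" using S by (simp add: finite_permutations)
      show "{p. p permutes U} \<subseteq> {p. p permutes S}" using U by (auto intro: permutes_subset)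
      show "\<forall>p\<in>{p. p permutes S} - {p. p permutes U}.
          of_int (sign p) * ((\<Prod>i\<in>U. K i (p i)) * (\<Prod>i\<in>S-U. of_bool (i = p i))) = 0"
      proof
        fix p assume p: "p \<in> {p. p permutes S} - {p. p permutes U}"
        then have "\<exists>i\<in>S-U. p i \<noteq> i"
          using permutes_superset[of p S U] by blast
        then show "of_int (sign p) * ((\<Prod>i\<in>U. K i (p i)) * (\<Prod>i\<in>S-U. of_bool (i = p i))) = 0"
          using S by (auto simp: prod_zero_iff)
      qed
      fix p assume "p \<in> {p. p permutes U}"
      then have "(\<Prod>i\<in>S-U. of_bool (i = p i)) = (1::complex)"
        by (intro prod.neutral) (auto simp: permutes_not_in)
      then show "of_int (sign p) * (\<Prod>i\<in>U. K i (p i)) = of_int (sign p) * ((\<Prod>i\<in>U. K i (p i)) * (\<Prod>i\<in>S-U. of_bool (i = p i)))"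
        by simp
    qed
    then show "(\<Sum>p | p permutes S. of_int (sign p) * ((\<Prod>i\<in>U. K i (p i)) * (\<Prod>i\<in>S-U. of_bool (i = p i)))) = sdet U K"
      by (simp add: sdet_def)
  qed
  finally show ?thesis .
qed

text \<open>In a nonzero product every row index lies outside R and every column index inside R, yet
  a permutation makes each column index a row index again. Such a Y describes column operations of
  determinant 1 in \<open>fdet_eigenvalue_order\<close>.\<close>

lemma sdet_offdiagonal_block:
  assumes "finite U" "U \<noteq> {}" and Y: "\<And>i j. Y i j \<noteq> 0 \<Longrightarrow> i \<notin> R \<and> j \<in> R"
  shows "sdet U Y = 0"
proof -
  have "(\<Prod>i\<in>U. Y i (p i)) = 0" if p: "p permutes U" for p
  proof (rule ccontr)
    assume "(\<Prod>i\<in>U. Y i (p i)) \<noteq> 0"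
    then have nz: "Y i (p i) \<noteq> 0" if "i \<in> U" for i using that \<open>finite U\<close> by (auto simp: prod_zero_iff)
    obtain i where i: "i \<in> U" using \<open>U \<noteq> {}\<close> by blast
    have "p i \<in> R" using Y[OF nz[OF i]] by blast
    moreover have "p i \<notin> R" using Y[OF nz[of "p i"]] i p by (simp add: permutes_in_image)
    ultimately show False by blast
  qed
  then show ?thesis by (simp add: sdet_def)
qed

lemma sdet_id_plus_offdiagonal:
  assumes "finite S" and Y: "\<And>i j. Y i j \<noteq> 0 \<Longrightarrow> i \<notin> R \<and> j \<in> R"
  shows "sdet S (id_plus Y) = 1"
proof -
  have "(\<Sum>U\<in>Pow S. sdet U Y) = (\<Sum>U\<in>Pow S. if U = {} then 1 else 0)"
  proof (intro sum.cong refl)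
    fix U assume "U \<in> Pow S"
    then have "finite U" using assms(1) finite_subset by blast
    then show "sdet U Y = (if U = {} then 1 else 0)" using sdet_offdiagonal_block[OF _ _ Y, of U] by simp
  qed
  then show ?thesis using assms(1) by (simp add: sdet_id_plus)
qed

text \<open>A row of 1 + L has absolute sum at most 1 + r, where r is the row sum of L, and 1 + r is
  at most exp r.\<close>

lemma norm_sdet_id_plus_le:
  assumes S: "finite S" and b: "(\<Sum>i\<in>S. \<Sum>j\<in>S. norm (L i j)) \<le> b"
  shows "norm (sdet S (id_plus L)) \<le> exp b"
proof -
  have "norm (sdet S (id_plus L)) \<le> (\<Prod>i\<in>S. \<Sum>j\<in>S. norm (id_plus L i j))"
    using S by (rule norm_sdet_le)
  also have "\<dots> \<le> (\<Prod>i\<in>S. exp (\<Sum>j\<in>S. norm (L i j)))"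
  proof (intro prod_mono conjI sum_nonneg)
    fix i assume i: "i \<in> S"
    have "(\<Sum>j\<in>S. norm (id_plus L i j)) \<le> (\<Sum>j\<in>S. of_bool (i = j) + norm (L i j))"
      by (intro sum_mono) (auto simp: id_plus_def intro: norm_triangle_le)
    also have "\<dots> = 1 + (\<Sum>j\<in>S. norm (L i j))"
      using S i by (simp add: sum.distrib of_bool_def)
    also have "\<dots> \<le> exp (\<Sum>j\<in>S. norm (L i j))" by (rule exp_ge_add_one_self)
    finally show "(\<Sum>j\<in>S. norm (id_plus L i j)) \<le> exp (\<Sum>j\<in>S. norm (L i j))" .
  qed auto
  also have "\<dots> = exp (\<Sum>i\<in>S. \<Sum>j\<in>S. norm (L i j))" using S by (simp add: exp_sum)
  also have "\<dots> \<le> exp b" using b by simp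
  finally show ?thesis .
qed

section \<open>Multiplicativity, kernel vectors and inverses through enumerated matrices\<close>

lemma sdet_eq_det:
  assumes e: "bij_betw e {0..<n} S"
  shows "sdet S M = Determinant.det (mat n n (\<lambda>(i, j). M (e i) (e j)))"
proof -
  have "sdet (e ` {0..<n}) M = sdet {0..<n} (\<lambda>i j. M (e i) (e j))"
    using e by (intro sdet_reindex) (auto simp: bij_betw_def)
  also have "\<dots> = Determinant.det (mat n n (\<lambda>(i, j). M (e i) (e j)))"
    unfolding sdet_def Determinant.det_def
    using permutes_in_image[of _ "{0..<n}"]
    by (auto intro!: sum.cong prod.cong arg_cong2[where f = "(*)"])
  finally show ?thesis using e by (simp add: bij_betw_def)
qed

lemma sdet_mult:
  assumes S: "finite S"
  shows "sdet S (\<lambda>i j. \<Sum>k\<in>S. A i k * B k j) = sdet S A * sdet S B"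
proof -
  obtain e where e: "bij_betw e {0..<card S} S" using ex_bij_betw_nat_finite[OF S] by blast
  have "mat (card S) (card S) (\<lambda>(i, j). \<Sum>k\<in>S. A (e i) k * B k (e j)) =
     mat (card S) (card S) (\<lambda>(i, j). A (e i) (e j)) * mat (card S) (card S) (\<lambda>(i, j). B (e i) (e j))"
    by (rule eq_matI) (auto simp: scalar_prod_def sum.reindex_bij_betw[OF e, symmetric])
  then show ?thesis
    unfolding sdet_eq_det[OF e] by (simp add: det_mult[where n = "card S"])
qed

lemma sdet_zero_imp_kernel:
  assumes S: "finite S" and "sdet S A = 0"
  shows "\<exists>v. (\<exists>i\<in>S. v i \<noteq> 0) \<and> (\<forall>i\<in>S. (\<Sum>j\<in>S. A i j * v j) = 0)"
proof -
  obtain e where e: "bij_betw e {0..<card S} S" using ex_bij_betw_nat_finite[OF S] by blast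
  let ?n = "card S"
  let ?A = "mat ?n ?n (\<lambda>(i, j). A (e i) (e j))"
  have "Determinant.det ?A = 0" using assms sdet_eq_det[OF e] by metis
  then obtain v where v: "v \<in> carrier_vec ?n" "v \<noteq> 0\<^sub>v ?n" "?A *\<^sub>v v = 0\<^sub>v ?n"
    using det_0_iff_vec_prod_zero[of ?A ?n] by auto
  define e' where "e' = the_inv_into {0..<?n} e"
  have inj: "inj_on e {0..<?n}" and img: "e ` {0..<?n} = S" using e by (auto simp: bij_betw_def)
  have e'[simp]: "e' (e i) = i" if "i < ?n" for i
    unfolding e'_def using inj that by (intro the_inv_into_f_f) auto
  obtain i0 where i0: "i0 < ?n" "v $ i0 \<noteq> 0"
    using v(1,2) by (metis carrier_vecD eq_vecI index_zero_vec)
  have "(\<Sum>j\<in>S. A i j * v $ (e' j)) = 0" if "i \<in> S" for i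
  proof -
    obtain i' where i': "i = e i'" "i' < ?n" using \<open>i \<in> S\<close> img by (metis imageE atLeastLessThan_iff)
    have "(\<Sum>j\<in>S. A i j * v $ (e' j)) = (\<Sum>j<?n. A (e i') (e j) * v $ j)"
      unfolding sum.reindex_bij_betw[OF e, symmetric] i'(1) by (simp add: lessThan_atLeast0)
    also have "\<dots> = (?A *\<^sub>v v) $ i'"
      using i'(2) v(1) by (auto simp: scalar_prod_def lessThan_atLeast0 intro!: sum.cong)
    also have "\<dots> = 0" using v(3) i'(2) by simp
    finally show ?thesis .
  qed
  moreover have "e i0 \<in> S" using i0 img by (metis atLeastLessThan_iff image_eqI zero_le)
  moreover have "v $ e' (e i0) \<noteq> 0" using i0 by simp
  ultimately show ?thesis by (intro exI[of _ "\<lambda>j. v $ e' j"] conjI bexI[of _ "e i0"] ballI) auto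
qed

lemma sdet_nonzero_imp_right_inverse:
  assumes S: "finite S" and "sdet S A \<noteq> 0"
  shows "\<exists>W. \<forall>i\<in>S. \<forall>j\<in>S. (\<Sum>k\<in>S. A i k * W k j) = of_bool (i = j)"
proof -
  obtain e where e: "bij_betw e {0..<card S} S" using ex_bij_betw_nat_finite[OF S] by blast
  let ?n = "card S"
  let ?A = "mat ?n ?n (\<lambda>(i, j). A (e i) (e j))"
  have "Determinant.det ?A \<noteq> 0" using assms sdet_eq_det[OF e] by metis
  then have "?A \<in> Units (ring_mat TYPE(complex) ?n undefined)"
    by (intro det_non_zero_imp_unit) auto
  then obtain W where W: "W \<in> carrier_mat ?n ?n" "?A * W = 1\<^sub>m ?n"
    by (auto simp: Units_def ring_mat_def)
  define e' where "e' = the_inv_into {0..<?n} e"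
  have inj: "inj_on e {0..<?n}" and img: "e ` {0..<?n} = S" using e by (auto simp: bij_betw_def)
  have e'[simp]: "e' (e i) = i" if "i < ?n" for i
    unfolding e'_def using inj that by (intro the_inv_into_f_f) auto
  have "(\<Sum>k\<in>S. A i k * W $$ (e' k, e' j)) = of_bool (i = j)" if "i \<in> S" "j \<in> S" for i j
  proof -
    obtain i' where i': "i = e i'" "i' < ?n" using \<open>i \<in> S\<close> img by (metis imageE atLeastLessThan_iff)
    obtain j' where j': "j = e j'" "j' < ?n" using \<open>j \<in> S\<close> img by (metis imageE atLeastLessThan_iff)
    have "(\<Sum>k\<in>S. A i k * W $$ (e' k, e' j)) = (\<Sum>k<?n. A (e i') (e k) * W $$ (k, j'))"
      unfolding sum.reindex_bij_betw[OF e, symmetric] i'(1) j'(1) using j' by (simp add: lessThan_atLeast0)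
    also have "\<dots> = (?A * W) $$ (i', j')"
      using i'(2) j'(2) W(1) by (auto simp: scalar_prod_def lessThan_atLeast0 intro!: sum.cong)
    also have "\<dots> = of_bool (i' = j')" using W(2) i'(2) j'(2) by simp
    also have "\<dots> = of_bool (i = j)" unfolding i'(1) j'(1) using i'(2) j'(2) inj by (simp add: inj_on_eq_iff)
    finally show ?thesis .
  qed
  then show ?thesis by (intro exI[of _ "\<lambda>k j. W $$ (e' k, e' j)"]) auto
qed

section \<open>Fredholm determinants of absolutely summable matrices\<close>

definition summable_mat :: "('a \<Rightarrow> 'a \<Rightarrow> complex) \<Rightarrow> bool" where
  "summable_mat K \<longleftrightarrow> (\<lambda>(i, j). norm (K i j)) summable_on UNIV"

definition row_sum :: "('a \<Rightarrow> 'a \<Rightarrow> complex) \<Rightarrow> 'a \<Rightarrow> real" where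
  "row_sum K i = (\<Sum>\<^sub>\<infinity>j. norm (K i j))"

text \<open>The Fredholm determinant of \<open>1 + K\<close> (not of \<open>K\<close>), as the sum of the principal minors of \<open>K\<close>.\<close>

definition fdet :: "('a \<Rightarrow> 'a \<Rightarrow> complex) \<Rightarrow> complex" where
  "fdet K = (\<Sum>\<^sub>\<infinity>S\<in>{S. finite S}. sdet S K)"

section \<open>Closure properties of absolutely summable matrices\<close>

lemma summable_mat_row: "summable_mat K \<Longrightarrow> (\<lambda>j. norm (K i j)) summable_on UNIV"
  unfolding summable_mat_def
  using summable_on_SigmaD1[of "\<lambda>i j. norm (K i j)" UNIV "\<lambda>_. UNIV" i] by auto

lemma summable_row_sum: "summable_mat K \<Longrightarrow> row_sum K summable_on UNIV"
  unfolding summable_mat_def row_sum_def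
  using summable_on_Sigma_banach[of "\<lambda>i j. norm (K i j)" UNIV "\<lambda>_. UNIV"] by auto

lemma row_sum_nonneg: "row_sum K i \<ge> 0"
  unfolding row_sum_def by (rule infsum_nonneg) auto

lemma sum_le_row_sum: "summable_mat K \<Longrightarrow> finite S \<Longrightarrow> (\<Sum>j\<in>S. norm (K i j)) \<le> row_sum K i"
  unfolding row_sum_def by (intro finite_sum_le_infsum summable_mat_row) auto

lemma summable_mat_cmult: "summable_mat K \<Longrightarrow> summable_mat (\<lambda>i j. c * K i j)"
  unfolding summable_mat_def using summable_on_cmult_right[of "\<lambda>(i, j). norm (K i j)" UNIV "norm c"]
  by (simp add: norm_mult case_prod_unfold)

lemma summable_mat_comparison:
  assumes "summable_mat K" "\<And>i j. norm (L i j) \<le> norm (K i j)"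
  shows "summable_mat L"
  using assms unfolding summable_mat_def
  by (intro summable_on_comparison_test[OF assms(1)[unfolded summable_mat_def]]) auto

lemma summable_mat_add:
  assumes "summable_mat K" "summable_mat L"
  shows "summable_mat (\<lambda>i j. K i j + L i j)"
  using summable_on_add[OF assms[unfolded summable_mat_def]] unfolding summable_mat_def
  by (rule summable_on_comparison_test) (auto intro: norm_triangle_ineq)

lemma summable_matI_rows:
  assumes "\<And>i. (\<lambda>j. norm (K i j)) summable_on UNIV" "(\<lambda>i. \<Sum>\<^sub>\<infinity>j. norm (K i j)) summable_on UNIV"
  shows "summable_mat K"
proof -
  have "(\<lambda>(i, j). norm (K i j)) summable_on (SIGMA i:UNIV. UNIV)"
    using assms by (intro summable_on_SigmaI[where g = "\<lambda>i. \<Sum>\<^sub>\<infinity>j. norm (K i j)"]) auto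
  then show ?thesis by (simp add: summable_mat_def)
qed

lemma has_sum_sum:
  fixes f :: "'b \<Rightarrow> 'a \<Rightarrow> 'c :: topological_comm_monoid_add"
  assumes "finite B" "\<And>b. b \<in> B \<Longrightarrow> (f b has_sum c b) A"
  shows "((\<lambda>x. \<Sum>b\<in>B. f b x) has_sum (\<Sum>b\<in>B. c b)) A"
  using assms by (induction B rule: finite_induct) (auto intro: has_sum_add)

lemma summable_mat_columns:
  assumes R: "finite R" and "\<And>j. j \<in> R \<Longrightarrow> (\<lambda>i. norm (K i j)) summable_on UNIV"
    and 0: "\<And>i j. j \<notin> R \<Longrightarrow> K i j = 0"
  shows "summable_mat K"
proof (rule summable_matI_rows)
  have *: "((\<lambda>j. norm (K i j)) has_sum (\<Sum>j\<in>R. norm (K i j))) UNIV" for i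
    using R 0 by (intro has_sum_finite_neutralI) auto
  show "(\<lambda>j. norm (K i j)) summable_on UNIV" for i using *[of i] by (rule has_sum_imp_summable)
  have "(\<lambda>i. \<Sum>\<^sub>\<infinity>j. norm (K i j)) = (\<lambda>i. \<Sum>j\<in>R. norm (K i j))"
    using * by (auto simp: infsumI)
  moreover have "(\<lambda>i. \<Sum>j\<in>R. norm (K i j)) summable_on UNIV"
    by (rule has_sum_imp_summable[OF has_sum_sum[OF R has_sum_infsum[OF assms(2)]]])
  ultimately show "(\<lambda>i. \<Sum>\<^sub>\<infinity>j. norm (K i j)) summable_on UNIV" by simp
qed

section \<open>Sums indexed by all finite sets\<close>

lemma sum_Pow_prod: "finite S \<Longrightarrow> (\<Sum>U\<in>Pow S. \<Prod>i\<in>U. r i) = (\<Prod>i\<in>S. 1 + r i)"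
  for r :: "'a \<Rightarrow> 'b :: comm_ring_1"
  using prod_add[of S r "\<lambda>_. 1"] by (simp add: add.commute)

text \<open>A finite family of finite sets lies in the power set of its union, where the products
  add up to the product of 1 + r i, at most the exponential of the sum of r.\<close>

lemma summable_prod_finite_sets:
  fixes r :: "'a \<Rightarrow> real"
  assumes r: "r summable_on UNIV" and nonneg: "\<And>i. r i \<ge> 0"
  shows "(\<lambda>S. \<Prod>i\<in>S. r i) summable_on {S. finite S}"
proof (rule nonneg_bdd_above_summable_on)
  show "bdd_above (sum (\<lambda>S. \<Prod>i\<in>S. r i) ` {F. F \<subseteq> {S. finite S} \<and> finite F})"
  proof (rule bdd_aboveI2)
    fix F :: "'a set set" assume F: "F \<in> {F. F \<subseteq> {S. finite S} \<and> finite F}"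
    let ?U = "\<Union>F"
    have U: "finite ?U" using F by auto
    have "(\<Sum>S\<in>F. \<Prod>i\<in>S. r i) \<le> (\<Sum>S\<in>Pow ?U. \<Prod>i\<in>S. r i)"
      using U by (intro sum_mono2 prod_nonneg nonneg) auto
    also have "\<dots> = (\<Prod>i\<in>?U. 1 + r i)" using U by (rule sum_Pow_prod)
    also have "\<dots> \<le> (\<Prod>i\<in>?U. exp (r i))"
      using nonneg by (intro prod_mono) (auto simp: add_nonneg_nonneg)
    also have "\<dots> = exp (\<Sum>i\<in>?U. r i)" using U by (simp add: exp_sum)
    also have "\<dots> \<le> exp (infsum r UNIV)"
      using r U nonneg by (auto intro!: finite_sum_le_infsum)
    finally show "(\<Sum>S\<in>F. \<Prod>i\<in>S. r i) \<le> exp (infsum r UNIV)" .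
  qed
qed (auto intro: prod_nonneg nonneg)

text \<open>Power sets of growing finite sets are cofinal among finite families of finite sets, so a
  convergent sum over all finite sets can be computed along finite sections. The family X is
  absorbed as soon as S contains its union.\<close>

lemma filterlim_Pow_finite_subsets:
  "filterlim Pow (finite_subsets_at_top {S. finite S}) (finite_subsets_at_top (UNIV :: 'a set))"
  unfolding filterlim_iff eventually_finite_subsets_at_top
proof (intro allI impI)
  fix P :: "'a set set \<Rightarrow> bool"
  assume "\<exists>X. finite X \<and> X \<subseteq> {S. finite S} \<and> (\<forall>Y. finite Y \<and> X \<subseteq> Y \<and> Y \<subseteq> {S. finite S} \<longrightarrow> P Y)"
  then obtain X where "finite X \<and> X \<subseteq> {S. finite S} \<and> (\<forall>Y. finite Y \<and> X \<subseteq> Y \<and> Y \<subseteq> {S. finite S} \<longrightarrow> P Y)"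
    by (elim exE)
  then have X: "finite X" "X \<subseteq> {S. finite S}"
    "\<And>Y. finite Y \<Longrightarrow> X \<subseteq> Y \<Longrightarrow> Y \<subseteq> {S. finite S} \<Longrightarrow> P Y" by simp_all
  show "\<exists>X. finite X \<and> X \<subseteq> UNIV \<and> (\<forall>Y. finite Y \<and> X \<subseteq> Y \<and> Y \<subseteq> UNIV \<longrightarrow> P (Pow Y))"
  proof (intro exI[of _ "\<Union>X"] conjI allI impI)
    show "finite (\<Union>X)" using X(1,2) by blast
    fix Y assume Y: "finite Y \<and> \<Union>X \<subseteq> Y \<and> Y \<subseteq> (UNIV :: 'a set)"
    show "P (Pow Y)"
    proof (rule X(3))
      show "Pow Y \<subseteq> {S. finite S}" using Y finite_subset[of _ Y] by (simp add: subset_iff)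
    qed (use Y in auto)
  qed simp
qed

lemma has_sum_prod_tendsto:
  fixes r :: "'a \<Rightarrow> 'b :: {comm_ring_1, topological_comm_monoid_add}"
  assumes "((\<lambda>S. \<Prod>i\<in>S. r i) has_sum c) {S. finite S}"
  shows "((\<lambda>S. \<Prod>i\<in>S. 1 + r i) \<longlongrightarrow> c) (finite_subsets_at_top UNIV)"
proof -
  have "((\<lambda>S. \<Sum>U\<in>Pow S. \<Prod>i\<in>U. r i) \<longlongrightarrow> c) (finite_subsets_at_top UNIV)"
    using assms filterlim_Pow_finite_subsets unfolding has_sum_def by (rule filterlim_compose)
  then show ?thesis
    by (rule Lim_transform_eventually)
      (auto intro!: eventually_finite_subsets_at_top_weakI sum_Pow_prod)
qed

text \<open>Dominated convergence for unordered sums: the Weierstrass test makes the partial sums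
  converge uniformly in the parameter, so the two limits can be exchanged.\<close>

lemma tendsto_infsum_dominated:
  fixes f :: "'b \<Rightarrow> 'a \<Rightarrow> 'c :: banach"
  assumes le: "\<And>x a. a \<in> A \<Longrightarrow> norm (f x a) \<le> M a" and M: "M summable_on A"
    and lim: "\<And>a. a \<in> A \<Longrightarrow> ((\<lambda>x. f x a) \<longlongrightarrow> g a) F"
  shows "((\<lambda>x. infsum (f x) A) \<longlongrightarrow> infsum g A) F"
proof (cases "F = bot")
  case False
  have "norm (g a) \<le> M a" if "a \<in> A" for a
    using tendsto_norm[OF lim[OF that]] le[OF that] False by (intro tendsto_upperbound[where F = F]) auto
  then have "(\<lambda>a. norm (g a)) summable_on A"
    using M Infinite_Sum.abs_summable_on_comparison_test' by blast
  then have g: "((\<lambda>X. sum g X) \<longlongrightarrow> infsum g A) (finite_subsets_at_top A)"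
    using abs_summable_summable infsum_tendsto by blast
  have u: "uniform_limit UNIV (\<lambda>X x. \<Sum>a\<in>X. f x a) (\<lambda>x. infsum (f x) A) (finite_subsets_at_top A)"
    by (rule Weierstrass_m_test_general[OF le M])
  show ?thesis
  proof (rule swap_uniform_limit'[OF _ g u])
    show "\<forall>\<^sub>F X in finite_subsets_at_top A. ((\<lambda>x. \<Sum>a\<in>X. f x a) \<longlongrightarrow> sum g X) F"
      by (rule eventually_finite_subsets_at_top_weakI) (auto intro!: tendsto_sum lim)
  qed auto
qed auto

section \<open>Principal minors and finite sections\<close>

lemma norm_sdet_le_row_sum:
  assumes "summable_mat Kb" "finite S" "\<And>i j. norm (L i j) \<le> norm (Kb i j)"
  shows "norm (sdet S L) \<le> (\<Prod>i\<in>S. row_sum Kb i)"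
proof -
  have "norm (sdet S L) \<le> (\<Prod>i\<in>S. \<Sum>j\<in>S. norm (L i j))" using assms by (intro norm_sdet_le)
  also have "\<dots> \<le> (\<Prod>i\<in>S. row_sum Kb i)"
  proof (intro prod_mono conjI sum_nonneg)
    fix i
    have "(\<Sum>j\<in>S. norm (L i j)) \<le> (\<Sum>j\<in>S. norm (Kb i j))" using assms by (intro sum_mono) auto
    also have "\<dots> \<le> row_sum Kb i" using assms by (intro sum_le_row_sum)
    finally show "(\<Sum>j\<in>S. norm (L i j)) \<le> row_sum Kb i" .
  qed auto
  finally show ?thesis .
qed

lemma summable_sdet:
  assumes "summable_mat K"
  shows "(\<lambda>S. sdet S K) summable_on {S. finite S}"
proof -
  have "(\<lambda>S. norm (sdet S K)) summable_on {S. finite S}"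
    by (rule Infinite_Sum.abs_summable_on_comparison_test'[OF summable_prod_finite_sets[OF summable_row_sum[OF assms] row_sum_nonneg]])
      (auto intro: norm_sdet_le_row_sum assms)
  then show ?thesis by (rule abs_summable_summable)
qed

text \<open>The matrix may vary together with the finite section. This is used in
  \<open>fdet_eigenvalue_order\<close>, where the transformed matrix contains a truncation error
  that depends on the section.\<close>

lemma sdet_id_plus_tendsto_fdet:
  assumes Kb: "summable_mat Kb" and le: "\<And>x i j. norm (L x i j) \<le> norm (Kb i j)"
    and lim: "\<And>i j. ((\<lambda>x. L x i j) \<longlongrightarrow> K i j) F"
    and S: "\<And>x. finite (S x)" "\<And>i. \<forall>\<^sub>F x in F. i \<in> S x"
  shows "((\<lambda>x. sdet (S x) (id_plus (L x))) \<longlongrightarrow> fdet K) F"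
proof -
  \<comment> \<open>Minors not contained in the section count as 0, so that all sums have the same
    index domain and dominated convergence applies.\<close>
  let ?f = "\<lambda>x U. if U \<subseteq> S x then sdet U (L x) else 0"
  have "((\<lambda>x. infsum (?f x) {U. finite U}) \<longlongrightarrow> fdet K) F"
    unfolding fdet_def
  proof (rule tendsto_infsum_dominated)
    show "(\<lambda>U. \<Prod>i\<in>U. row_sum Kb i) summable_on {U. finite U}"
      by (intro summable_prod_finite_sets summable_row_sum Kb row_sum_nonneg)
    show "norm (?f x U) \<le> (\<Prod>i\<in>U. row_sum Kb i)" if "U \<in> {U. finite U}" for x U
      using that by (auto intro: norm_sdet_le_row_sum[OF Kb _ le] prod_nonneg row_sum_nonneg)
    fix U :: "'a set" assume "U \<in> {U. finite U}"
    then have U: "finite U" by simp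
    have "\<forall>\<^sub>F x in F. \<forall>i\<in>U. i \<in> S x"
      using U S(2) by (auto simp: eventually_ball_finite_distrib)
    then have ev: "\<forall>\<^sub>F x in F. sdet U (L x) = ?f x U"
      by eventually_elim auto
    have "((\<lambda>x. sdet U (L x)) \<longlongrightarrow> sdet U K) F"
      unfolding sdet_def by (intro tendsto_intros lim)
    then show "((\<lambda>x. ?f x U) \<longlongrightarrow> sdet U K) F"
      using ev by (rule Lim_transform_eventually)
  qed
  moreover have "infsum (?f x) {U. finite U} = sdet (S x) (id_plus (L x))" for x
  proof -
    have "infsum (?f x) {U. finite U} = infsum (\<lambda>U. sdet U (L x)) (Pow (S x))"
      using S(1)[of x] by (intro infsum_cong_neutral) (auto intro: finite_subset)
    then show ?thesis using S(1)[of x] by (simp add: sdet_id_plus)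
  qed
  ultimately show ?thesis by simp
qed

lemma fdet_limit_finite_subsets:
  assumes "summable_mat K"
  shows "((\<lambda>S. sdet S (id_plus K)) \<longlongrightarrow> fdet K) (finite_subsets_at_top UNIV)"
proof -
  have "((\<lambda>S. \<Sum>U\<in>Pow S. sdet U K) \<longlongrightarrow> fdet K) (finite_subsets_at_top UNIV)"
    unfolding fdet_def
    by (rule filterlim_compose[OF infsum_tendsto[OF summable_sdet[OF assms]] filterlim_Pow_finite_subsets])
  then show ?thesis
    by (rule Lim_transform_eventually)
      (auto intro!: eventually_finite_subsets_at_top_weakI sdet_id_plus[symmetric])
qed

text \<open>On a disc of radius R the minors are dominated by products of row sums of |K| + R |L|,
  so their sum converges uniformly. The affine form covers both - z M and the matrix in
  \<open>fdet_eigenvalue_order\<close>, some of whose columns do not depend on z.\<close>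

lemma fdet_affine_holomorphic:
  assumes K: "summable_mat K" and L: "summable_mat L"
  shows "(\<lambda>z. fdet (\<lambda>i j. K i j + z * L i j)) holomorphic_on UNIV"
proof -
  have "(\<lambda>z. fdet (\<lambda>i j. K i j + z * L i j)) holomorphic_on ball 0 R" if "R > 0" for R
  proof -
    let ?Kb = "\<lambda>i j. complex_of_real (norm (K i j) + norm (of_real R * L i j))"
    have Kb: "summable_mat ?Kb"
    proof -
      have 1: "summable_mat (\<lambda>i j. complex_of_real (norm (K i j)))"
        using K by (simp add: summable_mat_def)
      have 2: "summable_mat (\<lambda>i j. complex_of_real (norm (complex_of_real R * L i j)))"
        using summable_mat_cmult[OF L, of "complex_of_real R"] by (simp add: summable_mat_def)
      show ?thesis unfolding of_real_add by (rule summable_mat_add[OF 1 2])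
    qed
    have le: "norm (sdet S (\<lambda>i j. K i j + z * L i j)) \<le> (\<Prod>i\<in>S. row_sum ?Kb i)"
      if "S \<in> {S. finite S}" "z \<in> cball 0 R" for S z
    proof (rule norm_sdet_le_row_sum[OF Kb])
      fix i j
      have "norm (K i j + z * L i j) \<le> norm (K i j) + norm z * norm (L i j)"
        by (metis norm_mult norm_triangle_ineq)
      also have "\<dots> \<le> norm (K i j) + R * norm (L i j)"
        using that by (intro add_left_mono mult_right_mono) auto
      also have "\<dots> = norm (?Kb i j)" using \<open>R > 0\<close> by (simp only: norm_of_real norm_mult) simp
      finally show "norm (K i j + z * L i j) \<le> norm (?Kb i j)" .
    qed (use that in auto)
    have u: "uniform_limit (cball 0 R) (\<lambda>X z. \<Sum>S\<in>X. sdet S (\<lambda>i j. K i j + z * L i j))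
        (\<lambda>z. fdet (\<lambda>i j. K i j + z * L i j)) (finite_subsets_at_top {S. finite S})"
      unfolding fdet_def
      by (rule Weierstrass_m_test_general[OF le])
        (assumption | intro summable_prod_finite_sets summable_row_sum Kb row_sum_nonneg)+
    have h: "(\<lambda>z. sdet S (\<lambda>i j. K i j + z * L i j)) holomorphic_on A" for S A
      unfolding sdet_def by (intro holomorphic_intros)
    show ?thesis
    proof (rule holomorphic_uniform_limit[OF _ u])
      show "\<forall>\<^sub>F X in finite_subsets_at_top {S. finite S}.
          continuous_on (cball 0 R) (\<lambda>z. \<Sum>S\<in>X. sdet S (\<lambda>i j. K i j + z * L i j)) \<and>
          (\<lambda>z. \<Sum>S\<in>X. sdet S (\<lambda>i j. K i j + z * L i j)) holomorphic_on ball 0 R"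
        by (intro always_eventually allI conjI holomorphic_on_imp_continuous_on holomorphic_on_sum h)
    qed auto
  qed
  then have "(\<lambda>z. fdet (\<lambda>i j. K i j + z * L i j)) holomorphic_on (\<Union>R\<in>{0<..}. ball 0 R)"
    by (subst holomorphic_on_UN_open) auto
  moreover have "(\<Union>R\<in>{0<..}. ball 0 R) = (UNIV :: complex set)"
  proof -
    have "x \<in> ball 0 (norm x + 1)" "norm x + 1 \<in> {0<..}" for x :: complex
      by (auto simp: add_nonneg_pos)
    then show ?thesis by blast
  qed
  ultimately show ?thesis by simp
qed

section \<open>From a vanishing determinant to a kernel vector\<close>

lemma bounded_sequence_pointwise_subseq:
  fixes y :: "nat \<Rightarrow> 'a :: countable \<Rightarrow> complex"
  assumes "\<And>j i. norm (y j i) \<le> B"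
  shows "\<exists>l r. strict_mono (r :: nat \<Rightarrow> nat) \<and> (\<forall>i. (\<lambda>j. y (r j) i) \<longlonglongrightarrow> l i)"
proof -
  have "compactin (product_topology (\<lambda>_. euclidean) UNIV) (PiE (UNIV :: 'a set) (\<lambda>_. cball (0::complex) B))"
    by (simp add: compactin_PiE)
  then have "compact (PiE (UNIV :: 'a set) (\<lambda>_. cball (0::complex) B))"
    by (simp add: euclidean_product_topology)
  \<comment> \<open>The countable index type makes the product first countable, which turns the
    compactness from Tychonoff's theorem into sequential compactness.\<close>
  then have "seq_compact (PiE (UNIV :: 'a set) (\<lambda>_. cball (0::complex) B))"
    by (rule compact_imp_seq_compact)
  moreover have "\<forall>j. y j \<in> PiE UNIV (\<lambda>_. cball 0 B)" using assms by auto
  ultimately obtain l r where r: "strict_mono (r :: nat \<Rightarrow> nat)" and l: "(y \<circ> r) \<longlonglongrightarrow> l"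
    unfolding seq_compact_def by blast
  have "(\<lambda>j. y (r j) i) \<longlonglongrightarrow> l i" for i
  proof -
    have "isCont (\<lambda>x :: 'a \<Rightarrow> complex. x i) l"
      using continuous_on_product_coordinates[of i] continuous_on_eq_continuous_at[OF open_UNIV] by blast
    from isCont_tendsto_compose[OF this l] show ?thesis by simp
  qed
  with r show ?thesis by blast
qed

text \<open>If every row of the inverse W of 1 + K had absolute sum at most t, then W = 1 - K W
  would give |det W| <= exp (t C), so det (1 + K) could not be this small. Hence some row of W is
  large, and W applied to suitable phases is a large vector whose image under 1 + K has entries of
  modulus at most 1. Dividing by its largest entry gives y.\<close>

lemma almost_kernel_of_small_sdet:
  fixes K :: "'a \<Rightarrow> 'a \<Rightarrow> complex"
  assumes S: "finite S" and C: "(\<Sum>i\<in>S. \<Sum>k\<in>S. norm (K i k)) \<le> C" and t: "t > 0"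
    and small: "norm (sdet S (id_plus K)) < exp (- (t * C))"
  shows "\<exists>y. (\<forall>i. norm (y i) \<le> 1) \<and> (\<forall>i. i \<notin> S \<longrightarrow> y i = 0) \<and> (\<exists>i\<in>S. norm (y i) = 1)
     \<and> (\<forall>i\<in>S. norm (y i + (\<Sum>m\<in>S. K i m * y m)) \<le> 1 / t)"
proof -
  have apply_eq: "(\<Sum>m\<in>S. id_plus K i m * u m) = u i + (\<Sum>m\<in>S. K i m * u m)" if "i \<in> S" for i u
    using S that by (simp add: id_plus_def distrib_right sum.distrib of_bool_def if_distrib[of "\<lambda>x. x * _"] cong: if_cong)
  have "\<exists>u. \<exists>k\<in>S. 0 < norm (u k) \<and> (\<forall>i\<in>S. norm (\<Sum>m\<in>S. id_plus K i m * u m) \<le> norm (u k) / t)"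
  proof (cases "sdet S (id_plus K) = 0")
    case True
    then obtain v k where "k \<in> S" "v k \<noteq> 0" "\<forall>i\<in>S. (\<Sum>m\<in>S. id_plus K i m * v m) = 0"
      using sdet_zero_imp_kernel[OF S] by blast
    then show ?thesis using t by (intro exI[of _ v] bexI[of _ k]) auto
  next
    case False
    then obtain W where W: "\<forall>i\<in>S. \<forall>j\<in>S. (\<Sum>k\<in>S. id_plus K i k * W k j) = of_bool (i = j)"
      using sdet_nonzero_imp_right_inverse[OF S] by blast
    have "sdet S (id_plus K) * sdet S W = sdet S (\<lambda>i j. \<Sum>k\<in>S. id_plus K i k * W k j)"
      using S by (simp add: sdet_mult)
    also have "\<dots> = sdet S (id_plus (\<lambda>i j. 0))"
      using W by (intro sdet_cong) (auto simp: id_plus_def)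
    also have "\<dots> = 1" using S by (rule sdet_id_plus_offdiagonal) simp
    finally have det1: "norm (sdet S (id_plus K)) * norm (sdet S W) = 1"
      by (metis norm_mult norm_one)
    have "\<exists>k\<in>S. t < (\<Sum>j\<in>S. norm (W k j))"
    proof (rule ccontr)
      assume "\<not> ?thesis"
      then have le: "(\<Sum>j\<in>S. norm (W k j)) \<le> t" if "k \<in> S" for k using that by force
      \<comment> \<open>(1 + K) W = 1 reads W = 1 - K W, so W itself has the form identity plus
        ?L.\<close>
      let ?L = "\<lambda>i j. - (\<Sum>k\<in>S. K i k * W k j)"
      have "sdet S W = sdet S (id_plus ?L)"
      proof (rule sdet_cong)
        fix i j assume "i \<in> S" "j \<in> S"
        with W apply_eq[of i "\<lambda>k. W k j"]
        show "W i j = id_plus ?L i j" by (auto simp: id_plus_def algebra_simps)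
      qed
      also have "norm \<dots> \<le> exp (t * C)"
      proof (rule norm_sdet_id_plus_le[OF S])
        have "(\<Sum>i\<in>S. \<Sum>j\<in>S. norm (?L i j)) \<le> (\<Sum>i\<in>S. \<Sum>j\<in>S. \<Sum>k\<in>S. norm (K i k) * norm (W k j))"
          by (intro sum_mono) (auto simp: norm_mult intro!: order.trans[OF norm_sum])
        also have "\<dots> = (\<Sum>i\<in>S. \<Sum>k\<in>S. norm (K i k) * (\<Sum>j\<in>S. norm (W k j)))"
          by (subst sum.swap) (simp add: sum_distrib_left)
        also have "\<dots> \<le> (\<Sum>i\<in>S. \<Sum>k\<in>S. norm (K i k) * t)"
          by (intro sum_mono mult_left_mono le) auto
        also have "\<dots> = t * (\<Sum>i\<in>S. \<Sum>k\<in>S. norm (K i k))"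
          by (simp add: sum_distrib_left mult.commute)
        also have "\<dots> \<le> t * C" using t C by simp
        finally show "(\<Sum>i\<in>S. \<Sum>j\<in>S. norm (?L i j)) \<le> t * C" .
      qed
      finally have "norm (sdet S W) \<le> exp (t * C)" .
      then have "norm (sdet S (id_plus K)) * norm (sdet S W) \<le> norm (sdet S (id_plus K)) * exp (t * C)"
        by (intro mult_left_mono) auto
      also have "\<dots> < exp (- (t * C)) * exp (t * C)" using small by (intro mult_strict_right_mono) auto
      also have "\<dots> = 1" by (simp flip: exp_add)
      finally show False using det1 by simp
    qed
    then obtain k where k: "k \<in> S" "t < (\<Sum>j\<in>S. norm (W k j))" by blast
    \<comment> \<open>The phases cancel those in row k of W, so that entry k of W v is the full
      absolute sum of that row.\<close>
    define v where "v j = cnj (sgn (W k j))" for j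
    define u where "u i = (\<Sum>j\<in>S. W i j * v j)" for i
    have Wv: "W k j * v j = of_real (norm (W k j))" for j
    proof -
      have "W k j * cnj (W k j) = of_real (norm (W k j)) * of_real (norm (W k j))"
        by (simp add: complex_norm_square[symmetric] power2_eq_square)
      then show ?thesis
        by (cases "W k j = 0") (auto simp: v_def sgn_div_norm scaleR_conv_of_real field_simps)
    qed
    have uk: "u k = of_real (\<Sum>j\<in>S. norm (W k j))" by (simp add: u_def Wv)
    have "norm (u k) = (\<Sum>j\<in>S. norm (W k j))"
      unfolding uk norm_of_real by (simp add: sum_nonneg)
    then have nuk: "norm (u k) > t" using k(2) by simp
    have "norm (\<Sum>m\<in>S. id_plus K i m * u m) \<le> norm (u k) / t" if i: "i \<in> S" for i
    proof -
      have "(\<Sum>m\<in>S. id_plus K i m * u m) = (\<Sum>m\<in>S. \<Sum>j\<in>S. id_plus K i m * W m j * v j)"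
        by (simp add: u_def sum_distrib_left mult.assoc)
      also have "\<dots> = (\<Sum>j\<in>S. (\<Sum>m\<in>S. id_plus K i m * W m j) * v j)"
        by (subst sum.swap) (simp add: sum_distrib_right)
      also have "\<dots> = (\<Sum>j\<in>S. of_bool (i = j) * v j)" using W i by (intro sum.cong) auto
      also have "\<dots> = v i" using S i by (simp add: of_bool_def if_distrib[of "\<lambda>x. x * _"] cong: if_cong)
      finally have "norm (\<Sum>m\<in>S. id_plus K i m * u m) = norm (v i)" by simp
      also have "\<dots> \<le> 1" by (simp add: v_def norm_sgn)
      also have "1 \<le> norm (u k) / t" using nuk t by simp
      finally show ?thesis .
    qed
    then show ?thesis using k(1) nuk t by (intro exI[of _ u] bexI[of _ k]) auto
  qed
  then obtain u k where k: "k \<in> S" "0 < norm (u k)"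
    and uk: "\<And>i. i \<in> S \<Longrightarrow> norm (\<Sum>m\<in>S. id_plus K i m * u m) \<le> norm (u k) / t" by blast
  define \<mu> where "\<mu> = Max ((\<lambda>i. norm (u i)) ` S)"
  have fin: "finite ((\<lambda>i. norm (u i)) ` S)" "(\<lambda>i. norm (u i)) ` S \<noteq> {}" using S k by auto
  have mu_ge: "norm (u i) \<le> \<mu>" if "i \<in> S" for i unfolding \<mu>_def using fin that by (intro Max_ge) auto
  have mu_pos: "\<mu> > 0" using mu_ge[OF k(1)] k(2) by linarith
  obtain i0 where i0: "i0 \<in> S" "norm (u i0) = \<mu>" using Max_in[OF fin] unfolding \<mu>_def by fastforce
  define y where "y i = (if i \<in> S then u i / of_real \<mu> else 0)" for i
  have "norm (y i + (\<Sum>m\<in>S. K i m * y m)) \<le> 1 / t" if i: "i \<in> S" for i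
  proof -
    have "y i + (\<Sum>m\<in>S. K i m * y m) = (\<Sum>m\<in>S. id_plus K i m * y m)" using apply_eq[OF i] by simp
    also have "\<dots> = (\<Sum>m\<in>S. id_plus K i m * u m) / of_real \<mu>"
      by (simp add: y_def sum_divide_distrib)
    also have "norm \<dots> \<le> (norm (u k) / t) / \<mu>"
      using divide_right_mono[OF uk[OF i], of \<mu>] mu_pos by (simp add: norm_divide)
    also have "\<dots> = (norm (u k) / \<mu>) * (1 / t)" by simp
    also have "\<dots> \<le> 1 * (1 / t)" using mu_ge[OF k(1)] mu_pos t by (intro mult_right_mono) auto
    finally show ?thesis by simp
  qed
  moreover have "norm (y i) \<le> 1" for i using mu_ge mu_pos by (auto simp: y_def norm_divide)
  moreover have "norm (y i0) = 1" using i0 mu_pos by (auto simp: y_def norm_divide)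
  ultimately show ?thesis using i0(1) by (intro exI[of _ y]) (auto simp: y_def)
qed

text \<open>The finite sections have determinants tending to 0, hence almost kernel vectors of sup
  norm 1; a pointwise limit of these solves the equation by dominated convergence. The limit is
  nonzero because an entry of modulus 1 can only sit in one of the finitely many rows with large row
  sum.\<close>

lemma fdet_zero_imp_kernel:
  fixes K :: "'a :: countable \<Rightarrow> 'a \<Rightarrow> complex"
  assumes K: "summable_mat K" and 0: "fdet K = 0"
  shows "\<exists>y. (\<forall>i. norm (y i) \<le> 1) \<and> (\<exists>i. y i \<noteq> 0) \<and> (\<forall>i. ((\<lambda>m. K i m * y m) has_sum (- y i)) UNIV)"
proof -
  define S :: "nat \<Rightarrow> 'a set" where "S N = {x. to_nat x < N}" for N
  have finS: "finite (S N)" for N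
  proof -
    have "S N = to_nat -` {..<N}" by (auto simp: S_def)
    then show ?thesis by (simp add: finite_vimageI)
  qed
  have evS: "\<forall>\<^sub>F N in sequentially. i \<in> S N" for i
    unfolding S_def using eventually_gt_at_top[of "to_nat i"] by simp
  have lim0: "(\<lambda>N. sdet (S N) (id_plus K)) \<longlonglongrightarrow> 0"
    using sdet_id_plus_tendsto_fdet[OF K, of "\<lambda>_. K" K sequentially S] finS evS 0 by simp
  define C where "C = (\<Sum>\<^sub>\<infinity>i. row_sum K i)"
  have C: "(\<Sum>i\<in>X. \<Sum>k\<in>X. norm (K i k)) \<le> C" if "finite X" for X
  proof -
    have "(\<Sum>i\<in>X. \<Sum>k\<in>X. norm (K i k)) \<le> (\<Sum>i\<in>X. row_sum K i)"
      using K that by (intro sum_mono sum_le_row_sum)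
    also have "\<dots> \<le> C" unfolding C_def
      using K that by (intro finite_sum_le_infsum summable_row_sum) (auto simp: row_sum_nonneg)
    finally show ?thesis .
  qed
  \<comment> \<open>At stage j the section has index at least j and the residual is at most 1 / (j +
    1), so both the truncation and the error disappear in the limit.\<close>
  define P where "P j N y \<longleftrightarrow> N \<ge> j \<and> (\<forall>i. norm (y i) \<le> 1) \<and> (\<forall>i. i \<notin> S N \<longrightarrow> y i = 0)
     \<and> (\<exists>i\<in>S N. norm (y i) = 1) \<and> (\<forall>i\<in>S N. norm (y i + (\<Sum>m\<in>S N. K i m * y m)) \<le> 1 / real (Suc j))"
    for j N y
  have "\<exists>N y. P j N y" for j
  proof -
    have "\<forall>\<^sub>F N in sequentially. norm (sdet (S N) (id_plus K)) < exp (- (real (Suc j) * C))"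
      using lim0 by (intro order_tendstoD(2)[of _ 0]) (auto intro: tendsto_norm_zero)
    then have "\<forall>\<^sub>F N in sequentially. N \<ge> j \<and> norm (sdet (S N) (id_plus K)) < exp (- (real (Suc j) * C))"
      using eventually_ge_at_top[of j] by eventually_elim auto
    then obtain N where "N \<ge> j" "norm (sdet (S N) (id_plus K)) < exp (- (real (Suc j) * C))"
      using eventually_happens' sequentially_bot by blast
    moreover have "0 < real (Suc j)" by simp
    ultimately show ?thesis
      using almost_kernel_of_small_sdet[OF finS C[OF finS], of "real (Suc j)" N] unfolding P_def by blast
  qed
  then obtain N y where "\<And>j. P j (N j) (y j)" by metis
  then have N: "\<And>j. N j \<ge> j" and y: "\<And>j i. norm (y j i) \<le> 1"
    "\<And>j i. i \<notin> S (N j) \<Longrightarrow> y j i = 0" "\<And>j. \<exists>i\<in>S (N j). norm (y j i) = 1"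
    "\<And>j i. i \<in> S (N j) \<Longrightarrow> norm (y j i + (\<Sum>m\<in>S (N j). K i m * y j m)) \<le> 1 / real (Suc j)"
    unfolding P_def by blast+
  obtain l r where r: "strict_mono (r :: nat \<Rightarrow> nat)" and l: "\<And>i. (\<lambda>j. y (r j) i) \<longlonglongrightarrow> l i"
    using bounded_sequence_pointwise_subseq[of y 1] y(1) by blast
  have lle: "norm (l i) \<le> 1" for i
    using tendsto_norm[OF l[of i]] y(1) by (intro tendsto_upperbound[where F = sequentially]) auto
  have sumK: "(\<lambda>m. K i m * f m) summable_on UNIV" if "\<And>m. norm (f m) \<le> 1" for i f
    by (rule abs_summable_summable, rule Infinite_Sum.abs_summable_on_comparison_test'[OF summable_mat_row[OF K, of i]])
      (auto simp: norm_mult that mult_left_le)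
  have "l i + (\<Sum>\<^sub>\<infinity>m. K i m * l m) = 0" for i
  proof -
    have "(\<lambda>j. \<Sum>\<^sub>\<infinity>m. K i m * y (r j) m) \<longlonglongrightarrow> (\<Sum>\<^sub>\<infinity>m. K i m * l m)"
    proof (rule tendsto_infsum_dominated[OF _ summable_mat_row[OF K, of i]])
      show "norm (K i m * y (r j) m) \<le> norm (K i m)" for j m
        by (simp add: norm_mult y(1) mult_left_le)
      show "(\<lambda>j. K i m * y (r j) m) \<longlonglongrightarrow> K i m * l m" for m
        by (intro tendsto_intros l)
    qed
    then have 1: "(\<lambda>j. y (r j) i + (\<Sum>\<^sub>\<infinity>m. K i m * y (r j) m)) \<longlonglongrightarrow> l i + (\<Sum>\<^sub>\<infinity>m. K i m * l m)"
      by (intro tendsto_add l)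
    have "(\<lambda>j. y (r j) i + (\<Sum>\<^sub>\<infinity>m. K i m * y (r j) m)) \<longlonglongrightarrow> 0"
    proof (rule Lim_null_comparison)
      have "\<forall>\<^sub>F j in sequentially. i \<in> S (N (r j))"
      proof -
        have "filterlim (\<lambda>j. N (r j)) at_top sequentially"
          using N filterlim_subseq[OF r] filterlim_at_top_mono[of r sequentially "\<lambda>j. N (r j)"] by auto
        then show ?thesis using evS[of i] by (auto simp: filterlim_iff)
      qed
      then show "\<forall>\<^sub>F j in sequentially. norm (y (r j) i + (\<Sum>\<^sub>\<infinity>m. K i m * y (r j) m)) \<le> 1 / real (Suc j)"
      proof eventually_elim
        case (elim j)
        have "(\<Sum>\<^sub>\<infinity>m. K i m * y (r j) m) = (\<Sum>\<^sub>\<infinity>m\<in>S (N (r j)). K i m * y (r j) m)"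
          using y(2) by (intro infsum_cong_neutral) auto
        also have "\<dots> = (\<Sum>m\<in>S (N (r j)). K i m * y (r j) m)" using finS by simp
        finally have "norm (y (r j) i + (\<Sum>\<^sub>\<infinity>m. K i m * y (r j) m)) \<le> 1 / real (Suc (r j))"
          using y(4)[OF elim] by simp
        also have "\<dots> \<le> 1 / real (Suc j)"
          using seq_suble[OF r, of j] by (intro divide_left_mono) auto
        finally show ?case .
      qed
      show "(\<lambda>j. 1 / real (Suc j)) \<longlonglongrightarrow> 0"
        using LIMSEQ_inverse_real_of_nat by (simp add: inverse_eq_divide)
    qed
    with 1 show ?thesis by (rule LIMSEQ_unique)
  qed
  then have eq: "(\<Sum>\<^sub>\<infinity>m. K i m * l m) = - l i" for i by (simp add: add_eq_0_iff)
  have has: "((\<lambda>m. K i m * l m) has_sum (- l i)) UNIV" for i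
    using has_sum_infsum[OF sumK[of l i]] lle eq by simp
  \<comment> \<open>From j = 1 on the residual is at most 1/2, so an entry of modulus 1 forces a row
    sum of at least 1/2. Summability of the row sums leaves finitely many such rows, and the mass on
    them cannot escape to infinity.\<close>
  define Fi where "Fi = {i. row_sum K i \<ge> 1/2}"
  have finFi: "finite Fi"
  proof (rule ccontr)
    assume inf: "infinite Fi"
    obtain n :: nat where n: "real n > 2 * C" using reals_Archimedean2 by blast
    obtain X where X: "X \<subseteq> Fi" "finite X" "card X = n" using inf infinite_arbitrarily_large by metis
    have "real n / 2 = (\<Sum>i\<in>X. 1/2)" using X by simp
    also have "\<dots> \<le> (\<Sum>i\<in>X. row_sum K i)" using X by (intro sum_mono) (auto simp: Fi_def)
    also have "\<dots> \<le> C" unfolding C_def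
      using K X by (intro finite_sum_le_infsum summable_row_sum) (auto simp: row_sum_nonneg)
    finally show False using n by simp
  qed
  have big: "1 \<le> (\<Sum>i\<in>Fi. norm (y j i))" if "j \<ge> 1" for j
  proof -
    obtain i where i: "i \<in> S (N j)" "norm (y j i) = 1" using y(3) by blast
    have "1 \<le> norm (y j i + (\<Sum>m\<in>S (N j). K i m * y j m)) + norm (\<Sum>m\<in>S (N j). K i m * y j m)"
      using i(2) norm_triangle_ineq4[of "y j i + (\<Sum>m\<in>S (N j). K i m * y j m)" "\<Sum>m\<in>S (N j). K i m * y j m"] by simp
    also have "\<dots> \<le> 1/2 + row_sum K i"
    proof (rule add_mono)
      show "norm (y j i + (\<Sum>m\<in>S (N j). K i m * y j m)) \<le> 1/2"
        by (rule order.trans[OF y(4)[OF i(1)]]) (use that in \<open>auto simp: field_simps\<close>)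
      have "norm (\<Sum>m\<in>S (N j). K i m * y j m) \<le> (\<Sum>m\<in>S (N j). norm (K i m))"
        by (intro sum_norm_le) (simp add: norm_mult y(1) mult_left_le)
      also have "\<dots> \<le> row_sum K i" by (intro sum_le_row_sum K finS)
      finally show "norm (\<Sum>m\<in>S (N j). K i m * y j m) \<le> row_sum K i" .
    qed
    finally have "i \<in> Fi" by (simp add: Fi_def)
    then show ?thesis using member_le_sum[of i Fi "\<lambda>i. norm (y j i)"] finFi i(2) by simp
  qed
  have "\<forall>\<^sub>F j in sequentially. 1 \<le> (\<Sum>i\<in>Fi. norm (y (r j) i))"
    using eventually_ge_at_top[of "1::nat"]
  proof eventually_elim
    case (elim j)
    then show ?case using seq_suble[OF r, of j] by (intro big) simp
  qed
  moreover have "(\<lambda>j. \<Sum>i\<in>Fi. norm (y (r j) i)) \<longlonglongrightarrow> (\<Sum>i\<in>Fi. norm (l i))"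
    by (intro tendsto_sum tendsto_norm l)
  ultimately have "1 \<le> (\<Sum>i\<in>Fi. norm (l i))"
    by (intro tendsto_lowerbound[where F = sequentially]) auto
  then have "\<exists>i. l i \<noteq> 0" by (metis norm_zero not_one_le_zero sum.neutral)
  with lle has show ?thesis by blast
qed

section \<open>Eigenvalue multiplicities and zeros of the determinant\<close>

text \<open>Independence yields n points at which suitable combinations of the functions take the
  values of the identity matrix; this is Gaussian elimination on functions.\<close>

lemma independent_functions_dual_basis:
  fixes v :: "nat \<Rightarrow> 'b \<Rightarrow> complex"
  assumes "\<And>c. (\<forall>x. (\<Sum>i<n. c i * v i x) = 0) \<Longrightarrow> (\<forall>i<n. c i = 0)"
  shows "\<exists>c r. \<forall>i<n. \<forall>j<n. (\<Sum>l<n. c i l * v l (r j)) = (of_bool (i = j) :: complex)"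
  using assms
proof (induction n)
  case (Suc n)
  have "\<forall>i<n. c i = 0" if "\<forall>x. (\<Sum>i<n. c i * v i x) = 0" for c
  proof -
    have "\<forall>x. (\<Sum>i<Suc n. (c(n := 0)) i * v i x) = 0"
      using that by simp
    then have "\<forall>i<Suc n. (c(n := 0)) i = 0" by (rule Suc.prems)
    then show ?thesis by (metis fun_upd_other less_Suc_eq order_less_irrefl)
  qed
  from Suc.IH[OF this] obtain c r where
    cr: "\<And>i j. i < n \<Longrightarrow> j < n \<Longrightarrow> (\<Sum>l<n. c i l * v l (r j)) = of_bool (i = j)" by blast
  \<comment> \<open>These are the coefficients of v n minus its interpolant at the old points. The
    combination vanishes at all old points but not identically, since v n has coefficient 1.\<close>
  define b where "b l = (if l < n then - (\<Sum>i<n. v n (r i) * c i l) else 1)" for l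
  have b: "(\<Sum>l<Suc n. b l * v l x) = v n x - (\<Sum>i<n. v n (r i) * (\<Sum>l<n. c i l * v l x))" for x
  proof -
    have "(\<Sum>l<n. b l * v l x) = - (\<Sum>l<n. \<Sum>i<n. v n (r i) * c i l * v l x)"
      by (simp add: b_def sum_distrib_right sum_negf)
    also have "\<dots> = - (\<Sum>i<n. v n (r i) * (\<Sum>l<n. c i l * v l x))"
      by (subst sum.swap) (simp add: sum_distrib_left mult.assoc)
    finally show ?thesis by (simp add: b_def)
  qed
  have "\<exists>x. (\<Sum>l<Suc n. b l * v l x) \<noteq> 0"
  proof (rule ccontr)
    assume "\<not> ?thesis"
    then have "\<forall>l<Suc n. b l = 0" by (intro Suc.prems) auto
    then have "b n = 0" by blast
    then show False by (simp add: b_def)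
  qed
  then obtain x where x: "(\<Sum>l<Suc n. b l * v l x) \<noteq> 0" by blast
  define s where "s = (\<Sum>l<Suc n. b l * v l x)"
  define r' where "r' = r(n := x)"
  define a where "a i = (\<Sum>l<n. c i l * v l x)" for i
  \<comment> \<open>The normalised new combination is subtracted from the old ones so that they
    vanish at x; their values at the old points do not change.\<close>
  define c' where "c' i l = (if i < n then (if l < n then c i l else 0) - a i * (b l / s) else b l / s)" for i l
  have bs: "(\<Sum>l<Suc n. b l / s * v l (r' j)) = of_bool (j = n)" if "j < Suc n" for j
  proof -
    have *: "(\<Sum>l<Suc n. b l / s * v l y) = (\<Sum>l<Suc n. b l * v l y) / s" for y
      by (simp add: sum_divide_distrib add_divide_distrib)
    show ?thesis
    proof (cases "j = n")
      case True
      then show ?thesis unfolding * using x by (simp add: r'_def s_def)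
    next
      case False
      then have j: "j < n" using that by simp
      have "(\<Sum>i<n. v n (r i) * (\<Sum>l<n. c i l * v l (r j))) = (\<Sum>i<n. v n (r i) * of_bool (i = j))"
        using j cr by (intro sum.cong) auto
      also have "\<dots> = v n (r j)" using j by (simp add: of_bool_def if_distrib[of "\<lambda>x. _ * x"] cong: if_cong)
      finally show ?thesis unfolding * b using j False by (simp add: r'_def)
    qed
  qed
  have "(\<Sum>l<Suc n. c' i l * v l (r' j)) = of_bool (i = j)" if i: "i < Suc n" and j: "j < Suc n" for i j
  proof (cases "i = n")
    case True
    then have "(\<Sum>l<Suc n. c' i l * v l (r' j)) = (\<Sum>l<Suc n. b l / s * v l (r' j))"
      by (simp add: c'_def)
    then show ?thesis using bs[OF j] True by auto
  next
    case False
    then have i: "i < n" using i by simp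
    have "(\<Sum>l<Suc n. c' i l * v l (r' j)) = (\<Sum>l<n. c i l * v l (r' j)) - a i * (\<Sum>l<Suc n. b l / s * v l (r' j))"
      using i by (simp add: c'_def algebra_simps sum_subtractf sum_distrib_left)
    also have "\<dots> = (\<Sum>l<n. c i l * v l (r' j)) - a i * of_bool (j = n)" using bs[OF j] by simp
    also have "\<dots> = of_bool (i = j)"
      using i j cr[OF i, of j] by (cases "j = n") (auto simp: r'_def a_def)
    finally show ?thesis .
  qed
  then show ?case by blast
qed simp

section \<open>Eigenvectors of an absolutely summable matrix\<close>

lemma is_eigvec_zero: "is_eigvec M lam (\<lambda>_. 0)"
  by (simp add: is_eigvec_def)

lemma is_eigvec_lincomb:
  assumes x: "is_eigvec M lam x" and y: "is_eigvec M lam y"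
  shows "is_eigvec M lam (\<lambda>n. a * x n + b * y n)"
  unfolding is_eigvec_def
proof (intro conjI allI)
  have "(\<lambda>n. 2 * (norm a)\<^sup>2 * (norm (x n))\<^sup>2 + 2 * (norm b)\<^sup>2 * (norm (y n))\<^sup>2) summable_on UNIV"
    using x y unfolding is_eigvec_def by (intro summable_on_add summable_on_cmult_right) auto
  then show "(\<lambda>n. (norm (a * x n + b * y n))\<^sup>2) summable_on UNIV"
  proof (rule summable_on_comparison_test)
    fix n
    have "(norm (a * x n + b * y n))\<^sup>2 \<le> (norm (a * x n) + norm (b * y n))\<^sup>2"
      by (intro power_mono norm_triangle_ineq) auto
    also have "\<dots> \<le> 2 * (norm (a * x n))\<^sup>2 + 2 * (norm (b * y n))\<^sup>2"
      using sum_squares_bound[of "norm (a * x n)" "norm (b * y n)"] by (simp add: power2_sum)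
    finally show "(norm (a * x n + b * y n))\<^sup>2 \<le> 2 * (norm a)\<^sup>2 * (norm (x n))\<^sup>2 + 2 * (norm b)\<^sup>2 * (norm (y n))\<^sup>2"
      by (simp add: norm_mult power_mult_distrib)
  qed auto
  fix n
  have "((\<lambda>m. a * (M n m * x m) + b * (M n m * y m)) has_sum (a * (lam * x n) + b * (lam * y n))) UNIV"
    using x y unfolding is_eigvec_def by (intro has_sum_add has_sum_cmult_right) auto
  then show "((\<lambda>m. M n m * (a * x m + b * y m)) has_sum (lam * (a * x n + b * y n))) UNIV"
    by (simp add: algebra_simps)
qed

lemma is_eigvec_sum:
  assumes "finite B" "\<And>b. b \<in> B \<Longrightarrow> is_eigvec M lam (v b)"
  shows "is_eigvec M lam (\<lambda>n. \<Sum>b\<in>B. c b * v b n)"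
  using assms
proof (induction B rule: finite_induct)
  case (insert b B)
  then have "is_eigvec M lam (\<lambda>n. c b * v b n + 1 * (\<Sum>b\<in>B. c b * v b n))"
    by (intro is_eigvec_lincomb) auto
  then show ?case using insert by simp
qed (simp add: is_eigvec_zero)

text \<open>The eigenvalue equation bounds |x n| by the n-th row sum times B / |lam|. Sup-bounded,
  square summable and absolutely summable eigenvectors for lam thus coincide.\<close>

lemma bounded_eigenvector_abs_summable:
  assumes M: "summable_mat M" and lam: "lam \<noteq> 0" and B: "\<And>n. norm (x n) \<le> B"
    and ev: "\<And>n. ((\<lambda>m. M n m * x m) has_sum (lam * x n)) UNIV"
  shows "(\<lambda>n. norm (x n)) summable_on UNIV"
proof -
  have "(\<lambda>n. row_sum M n * (B / norm lam)) summable_on UNIV"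
    by (intro summable_on_cmult_left summable_row_sum M)
  then show ?thesis
  proof (rule summable_on_comparison_test)
    fix n
    have s: "(\<lambda>m. norm (M n m) * B) summable_on UNIV"
      by (intro summable_on_cmult_left summable_mat_row M)
    have "norm (lam * x n) \<le> (\<Sum>\<^sub>\<infinity>m. norm (M n m) * B)"
      by (rule norm_infsum_le[OF ev has_sum_infsum[OF s]]) (simp add: norm_mult B mult_left_mono)
    also have "\<dots> = row_sum M n * B" unfolding row_sum_def
      by (intro infsum_cmult_left summable_mat_row M)
    finally show "norm (x n) \<le> row_sum M n * (B / norm lam)"
      using lam by (simp add: norm_mult field_simps)
  qed auto
qed

lemma is_eigvec_abs_summable:
  assumes M: "summable_mat M" and lam: "lam \<noteq> 0" and x: "is_eigvec M lam x"
  shows "(\<lambda>n. norm (x n)) summable_on UNIV"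
proof (rule bounded_eigenvector_abs_summable[OF M lam])
  let ?B = "1 + (\<Sum>\<^sub>\<infinity>n. (norm (x n))\<^sup>2)"
  show "norm (x n) \<le> ?B" for n
  proof -
    have "(\<Sum>i\<in>{n}. (norm (x i))\<^sup>2) \<le> (\<Sum>\<^sub>\<infinity>n. (norm (x n))\<^sup>2)"
      using x unfolding is_eigvec_def by (intro finite_sum_le_infsum) auto
    moreover have "norm (x n) \<le> 1 + (norm (x n))\<^sup>2"
      using sum_squares_bound[of "norm (x n)" 1] by (simp add: algebra_simps) (smt (verit) norm_ge_zero)
    ultimately show ?thesis by simp
  qed
  show "((\<lambda>m. M n m * x m) has_sum (lam * x n)) UNIV" for n using x by (simp add: is_eigvec_def)
qed

lemma abs_summable_imp_square_summable:
  fixes x :: "'a \<Rightarrow> complex"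
  assumes x: "(\<lambda>n. norm (x n)) summable_on UNIV" and B: "\<And>n. norm (x n) \<le> B"
  shows "(\<lambda>n. (norm (x n))\<^sup>2) summable_on UNIV"
  using summable_on_cmult_right[OF x, of B]
  by (rule summable_on_comparison_test) (auto simp: power2_eq_square B mult_right_mono)

text \<open>If u = (M - lam) y is itself annihilated by M - lam, then <u, u> = <(M - lam) u, y> = 0
  because lam is real. This excludes Jordan blocks. The vector y is merely bounded, and the exchange
  of sums rests on the absolute summability of M.\<close>

lemma hermitian_range_orthogonal:
  assumes M: "summable_mat M" and herm: "\<And>n m. M m n = cnj (M n m)"
    and lam: "lam \<noteq> 0" "cnj lam = lam" and u: "is_eigvec M lam u"
    and y: "\<And>n. norm (y n) \<le> B"
    and eq: "\<And>n. u n = (\<Sum>\<^sub>\<infinity>m. M n m * y m) - lam * y n"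
  shows "u n = 0"
proof -
  have hc: "cnj (M m n) = M n m" for m n using herm[of n m] by simp
  have u1: "(\<lambda>n. norm (u n)) summable_on UNIV" using M lam(1) u by (rule is_eigvec_abs_summable)
  obtain C where C: "\<And>n. norm (u n) \<le> C"
  proof
    show "norm (u n) \<le> (\<Sum>\<^sub>\<infinity>n. norm (u n))" for n
      using finite_sum_le_infsum[OF u1, of "{n}"] by simp
  qed
  have B0: "0 \<le> B" using order.trans[OF norm_ge_zero y] by blast
  have C0: "0 \<le> C" using order.trans[OF norm_ge_zero C] by blast
  have s2: "(\<lambda>(n, m). cnj (u n) * (M n m * y m)) summable_on UNIV \<times> UNIV"
  proof -
    have "(\<lambda>p. B * C * (case p of (n, m) \<Rightarrow> norm (M n m))) summable_on UNIV"
      using M unfolding summable_mat_def by (rule summable_on_cmult_right)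
    then have "(\<lambda>p. norm (case p of (n, m) \<Rightarrow> cnj (u n) * (M n m * y m))) summable_on UNIV"
    proof (rule summable_on_comparison_test)
      fix p :: "int \<times> int"
      obtain n m where p: "p = (n, m)" by fastforce
      have "norm (u n) * norm (y m) \<le> C * B" using C y C0 by (intro mult_mono) auto
      then have "norm (M n m) * (norm (u n) * norm (y m)) \<le> norm (M n m) * (C * B)"
        by (rule mult_left_mono) auto
      then show "norm (case p of (n, m) \<Rightarrow> cnj (u n) * (M n m * y m)) \<le> B * C * (case p of (n, m) \<Rightarrow> norm (M n m))"
        by (simp add: p norm_mult mult_ac)
    qed auto
    then show ?thesis using abs_summable_summable by force
  qed
  have uy: "(\<lambda>n. cnj (u n) * y n) summable_on UNIV"
  proof (rule abs_summable_summable)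
    show "(\<lambda>n. norm (cnj (u n) * y n)) summable_on UNIV"
      using summable_on_cmult_left[OF u1, of B]
      by (rule summable_on_comparison_test) (auto simp: norm_mult y mult_left_mono)
  qed
  have My: "(\<lambda>m. M n m * y m) summable_on UNIV" for n
    by (rule abs_summable_summable, rule summable_on_comparison_test[OF summable_on_cmult_left[OF summable_mat_row[OF M, of n], of B]])
      (auto simp: norm_mult y mult_left_mono)
  have uMy: "(\<Sum>\<^sub>\<infinity>m. cnj (u n) * (M n m * y m)) = cnj (u n) * (\<Sum>\<^sub>\<infinity>m. M n m * y m)" for n
    by (rule infsum_cmult_right) (use My in auto)
  have "(\<Sum>\<^sub>\<infinity>n. cnj (u n) * (\<Sum>\<^sub>\<infinity>m. M n m * y m)) = (\<Sum>\<^sub>\<infinity>n. \<Sum>\<^sub>\<infinity>m. cnj (u n) * (M n m * y m))"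
    by (simp add: uMy)
  also have "\<dots> = (\<Sum>\<^sub>\<infinity>m. \<Sum>\<^sub>\<infinity>n. cnj (u n) * (M n m * y m))"
    using s2 by (rule infsum_swap_banach)
  also have "\<dots> = (\<Sum>\<^sub>\<infinity>m. lam * (cnj (u m) * y m))"
  proof (rule infsum_cong)
    fix m
    have "((\<lambda>n. M m n * u n) has_sum (lam * u m)) UNIV" using u by (simp add: is_eigvec_def)
    then have "((\<lambda>n. cnj (M m n * u n)) has_sum (cnj (lam * u m))) UNIV" by (simp only: has_sum_cnj_iff)
    then have "((\<lambda>n. cnj (u n) * M n m) has_sum (lam * cnj (u m))) UNIV"
      using lam(2) by (simp add: hc mult.commute)
    then have "((\<lambda>n. cnj (u n) * M n m * y m) has_sum (lam * cnj (u m) * y m)) UNIV"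
      by (rule has_sum_cmult_left)
    then show "(\<Sum>\<^sub>\<infinity>n. cnj (u n) * (M n m * y m)) = lam * (cnj (u m) * y m)"
      by (simp add: infsumI mult.assoc)
  qed
  finally have key: "(\<Sum>\<^sub>\<infinity>n. cnj (u n) * (\<Sum>\<^sub>\<infinity>m. M n m * y m)) = (\<Sum>\<^sub>\<infinity>m. lam * (cnj (u m) * y m))" .
  have s3: "(\<lambda>n. cnj (u n) * (\<Sum>\<^sub>\<infinity>m. M n m * y m)) summable_on UNIV"
    using summable_on_Sigma_banach[OF s2] by (simp add: uMy)
  have "(\<Sum>\<^sub>\<infinity>n. cnj (u n) * u n) = (\<Sum>\<^sub>\<infinity>n. cnj (u n) * (\<Sum>\<^sub>\<infinity>m. M n m * y m) - lam * (cnj (u n) * y n))"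
    by (rule infsum_cong) (subst (2) eq, simp add: algebra_simps)
  also have "\<dots> = (\<Sum>\<^sub>\<infinity>n. cnj (u n) * (\<Sum>\<^sub>\<infinity>m. M n m * y m)) - (\<Sum>\<^sub>\<infinity>m. lam * (cnj (u m) * y m))"
    using has_sum_add[OF has_sum_infsum[OF s3]
        has_sum_uminusI[OF has_sum_infsum[OF summable_on_cmult_right[OF uy, of lam]]]]
    by (simp add: infsumI)
  also have "\<dots> = 0" using key by simp
  finally have z: "(\<Sum>\<^sub>\<infinity>n. cnj (u n) * u n) = 0" .
  have "cnj (u n) * u n = of_real ((norm (u n))\<^sup>2)" for n
    by (metis complex_norm_square mult.commute)
  then have z': "(\<Sum>\<^sub>\<infinity>n. complex_of_real ((norm (u n))\<^sup>2)) = 0" using z by simp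
  have "(\<lambda>n. (norm (u n))\<^sup>2) summable_on UNIV" using u by (simp add: is_eigvec_def)
  from infsumI[OF has_sum_of_real[OF has_sum_infsum[OF this]]]
  have "complex_of_real (\<Sum>\<^sub>\<infinity>n. (norm (u n))\<^sup>2) = 0" using z' by metis
  then have "(\<Sum>\<^sub>\<infinity>n. (norm (u n))\<^sup>2) \<le> 0" by (simp only: of_real_eq_0_iff)
  then have "(norm (u n))\<^sup>2 = 0"
    by (rule nonneg_infsum_le_0D) (use u in \<open>auto simp: is_eigvec_def\<close>)
  then show ?thesis by simp
qed

text \<open>Column operations of determinant 1 put d independent eigenvectors x j into columns of 1
  - z M. Since (1 - z M) x j = (1 - z lam) x j, each of these columns yields one factor. A zero of
  the remaining determinant at 1 / lam would produce a further eigenvector or a generalised one; the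
  multiplicity excludes the former and Hermitian symmetry the latter.\<close>

lemma fdet_eigenvalue_order:
  fixes M :: "int \<Rightarrow> int \<Rightarrow> complex"
  assumes M: "summable_mat M" and herm: "\<And>n m. M m n = cnj (M n m)"
    and lam: "lam \<noteq> 0" "cnj lam = lam" and em: "eig_mult M lam d"
  shows "\<exists>g. g holomorphic_on UNIV \<and> g (1 / lam) \<noteq> 0 \<and>
      (\<forall>z. fdet (\<lambda>i j. - z * M i j) = (1 - z * lam) ^ d * g z)"
proof -
  have "indep_eigvecs M lam d" using em by (auto simp: eig_mult_def)
  then obtain v where v: "\<And>i. i < d \<Longrightarrow> is_eigvec M lam (v i)"
    and vi: "\<And>c. (\<forall>m. (\<Sum>i<d. c i * v i m) = 0) \<Longrightarrow> (\<forall>i<d. c i = 0)"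
    unfolding indep_eigvecs_def by blast
  obtain c r where cr: "\<And>i j. i < d \<Longrightarrow> j < d \<Longrightarrow> (\<Sum>l<d. c i l * v l (r j)) = of_bool (i = j)"
    using independent_functions_dual_basis[where n = d and v = v, OF vi] by blast
  define w where "w i n = (\<Sum>l<d. c i l * v l n)" for i n
  have w_ev: "is_eigvec M lam (w i)" for i
    unfolding w_def by (intro is_eigvec_sum) (auto intro: v)
  have wr: "w i (r j) = of_bool (i = j)" if "i < d" "j < d" for i j using cr that by (simp add: w_def)
  have inj: "inj_on r {..<d}"
  proof (rule inj_onI)
    fix i j assume "i \<in> {..<d}" "j \<in> {..<d}" "r i = r j"
    then have "(of_bool (i = j) :: complex) = of_bool (i = i)" using wr[of i j] wr[of i i] by simp
    then show "i = j" by (auto split: if_splits)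
  qed
  define R where "R = r ` {..<d}"
  have R: "finite R" "card R = d" using inj by (auto simp: R_def card_image)
  \<comment> \<open>The eigenvectors are renamed by their dual points, so that x j restricted to R
    is the unit vector at j.\<close>
  define x where "x j = w (the_inv_into {..<d} r j)" for j
  have xr: "x (r i) = w i" if "i < d" for i
    using inj that by (simp add: x_def the_inv_into_f_f)
  have x_ev: "is_eigvec M lam (x j)" for j by (simp add: x_def w_ev)
  have xR: "x j i = of_bool (i = j)" if "i \<in> R" "j \<in> R" for i j
    using that inj by (auto simp: R_def xr wr inj_on_eq_iff)
  have x1: "(\<lambda>i. norm (x j i)) summable_on UNIV" for j
    using M lam(1) x_ev by (rule is_eigvec_abs_summable)
  define C where "C j = (\<Sum>\<^sub>\<infinity>i. norm (x j i))" for j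
  have C: "norm (x j i) \<le> C j" for i j
    using finite_sum_le_infsum[OF x1[of j], of "{i}"] by (simp add: C_def)
  \<comment> \<open>\<open>id_plus (K z)\<close> has the columns x j for j in R and those of 1 - z M
    elsewhere: this is what remains once the d factors are extracted.\<close>
  define K where "K z i j = (if j \<in> R then x j i - of_bool (i = j) else - z * M i j)" for z i j
  define K0 where "K0 i j = (if j \<in> R then x j i - of_bool (i = j) else 0)" for i j
  define K1 where "K1 i j = (if j \<in> R then 0 else - M i j)" for i j
  have K_eq: "K z = (\<lambda>i j. K0 i j + z * K1 i j)" for z
    by (auto simp: fun_eq_iff K_def K0_def K1_def)
  have bool_sum: "(\<lambda>i. norm (of_bool (i = j) :: complex)) summable_on UNIV" for j :: int
    by (rule has_sum_imp_summable[OF has_sum_finite_neutralI[of "{j}"]]) auto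
  have K0: "summable_mat K0"
  proof (rule summable_mat_columns[OF R(1)])
    fix j assume "j \<in> R"
    show "(\<lambda>i. norm (K0 i j)) summable_on UNIV"
      using summable_on_add[OF x1[of j] bool_sum[of j]]
    proof (rule summable_on_comparison_test)
      show "norm (K0 i j) \<le> norm (x j i) + norm (of_bool (i = j) :: complex)" for i
        using norm_triangle_ineq4[of "x j i" "of_bool (i = j)"] \<open>j \<in> R\<close> by (simp only: K0_def if_True)
    qed auto
  qed (simp add: K0_def)
  have K1: "summable_mat K1"
    using M by (rule summable_mat_comparison) (auto simp: K1_def)
  have Kz: "summable_mat (K z)" for z
    unfolding K_eq by (intro summable_mat_add summable_mat_cmult K0 K1)
  have hol: "(\<lambda>z. fdet (K z)) holomorphic_on UNIV"
    unfolding K_eq using K0 K1 by (rule fdet_affine_holomorphic)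
  have factor: "fdet (\<lambda>i j. - z * M i j) = (1 - z * lam) ^ d * fdet (K z)" for z
  proof -
    let ?F = "finite_subsets_at_top (UNIV :: int set)"
    define A where "A = id_plus (\<lambda>i j. - z * M i j)"
    \<comment> \<open>By \<open>xR\<close> the matrix \<open>id_plus Y\<close> has the columns x j
      for j in R and unit columns elsewhere; Y has entries only in rows outside R and columns in
      R.\<close>
    define Y where "Y i j = (if j \<in> R \<and> i \<notin> R then x j i else 0)" for i j
    \<comment> \<open>On a finite section the eigenvalue equation holds up to this truncation error,
      which tends to 0 as S grows.\<close>
    define e where "e S i j = lam * x j i - (\<Sum>k\<in>S. M i k * x j k)" for S :: "int set" and i j
    define L where "L S i j = (if j \<in> R then (1 - z * lam) * x j i + z * e S i j - of_bool (i = j) else - z * M i j)"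
      for S :: "int set" and i j
    define Linf where "Linf i j = (if j \<in> R then (1 - z * lam) * x j i - of_bool (i = j) else - z * M i j)" for i j
    have limA: "((\<lambda>S. sdet S A) \<longlongrightarrow> fdet (\<lambda>i j. - z * M i j)) ?F"
      unfolding A_def by (intro fdet_limit_finite_subsets summable_mat_cmult M)
    have sup: "\<forall>\<^sub>F S in ?F. finite S \<and> R \<subseteq> S"
      unfolding eventually_finite_subsets_at_top using R(1) by blast
    have detY: "sdet S (id_plus Y) = 1" if "finite S" for S
      using that by (rule sdet_id_plus_offdiagonal[where R = R]) (simp add: Y_def split: if_splits)
    have AL: "sdet S A = sdet S (id_plus (L S))" if S: "finite S" "R \<subseteq> S" for S
    proof -
      have "sdet S A = sdet S (\<lambda>i j. \<Sum>k\<in>S. A i k * id_plus Y k j)"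
        using sdet_mult[OF S(1), of A "id_plus Y"] detY[OF S(1)] by simp
      also have "\<dots> = sdet S (id_plus (L S))"
      proof (rule sdet_cong)
        fix i j assume ij: "i \<in> S" "j \<in> S"
        show "(\<Sum>k\<in>S. A i k * id_plus Y k j) = id_plus (L S) i j"
        proof (cases "j \<in> R")
          case True
          have "id_plus Y k j = x j k" for k
            using True xR[of k j] by (auto simp: id_plus_def Y_def)
          then have "(\<Sum>k\<in>S. A i k * id_plus Y k j) = (\<Sum>k\<in>S. of_bool (i = k) * x j k) - z * (\<Sum>k\<in>S. M i k * x j k)"
            by (simp add: A_def id_plus_def distrib_right sum.distrib sum_distrib_left sum_negf mult.assoc left_diff_distrib sum_subtractf)
          also have "(\<Sum>k\<in>S. of_bool (i = k) * x j k) = x j i"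
            using S ij by (simp add: of_bool_def if_distrib[of "\<lambda>x. x * _"] cong: if_cong)
          finally show ?thesis using True by (simp add: id_plus_def L_def e_def algebra_simps)
        next
          case False
          then have "(\<Sum>k\<in>S. A i k * id_plus Y k j) = (\<Sum>k\<in>S. A i k * of_bool (k = j))"
            by (simp add: id_plus_def Y_def)
          also have "\<dots> = A i j"
            using S ij by (simp add: of_bool_def if_distrib[of "\<lambda>x. _ * x"] cong: if_cong)
          finally show ?thesis using False by (simp add: A_def id_plus_def L_def)
        qed
      qed
      finally show ?thesis .
    qed
    define \<beta> where "\<beta> i j = norm (1 - z * lam) * norm (x j i)
        + norm z * (norm lam * norm (x j i) + row_sum M i * C j) + of_bool (i = j)" for i j
    have \<beta>nn: "0 \<le> \<beta> i j" for i j
      unfolding \<beta>_def using order.trans[OF norm_ge_zero C[of j i]] row_sum_nonneg[of M i]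
      by (intro add_nonneg_nonneg mult_nonneg_nonneg) auto
    \<comment> \<open>A majorant of all L S that does not depend on S: the truncated sums in e are
      bounded by a row sum of M times the bound C j for x j.\<close>
    define Kb where "Kb i j = (if j \<in> R then complex_of_real (\<beta> i j) else 0) + (if j \<in> R then 0 else z * M i j)" for i j
    have Kb: "summable_mat Kb"
      unfolding Kb_def
    proof (rule summable_mat_add)
      show "summable_mat (\<lambda>i j. if j \<in> R then complex_of_real (\<beta> i j) else 0)"
      proof (rule summable_mat_columns[OF R(1)])
        fix j assume j: "j \<in> R"
        have "(\<lambda>i. of_bool (i = j) :: real) summable_on UNIV"
          by (rule has_sum_imp_summable[OF has_sum_finite_neutralI[of "{j}"]]) auto
        then have "(\<lambda>i. \<beta> i j) summable_on UNIV"
          unfolding \<beta>_def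
          by (intro summable_on_add summable_on_cmult_right summable_on_cmult_left x1 summable_row_sum M)
        then show "(\<lambda>i. norm (if j \<in> R then complex_of_real (\<beta> i j) else 0)) summable_on UNIV"
          using j \<beta>nn by simp
      qed simp
      show "summable_mat (\<lambda>i j. if j \<in> R then 0 else z * M i j)"
        using summable_mat_cmult[OF M, of z] by (rule summable_mat_comparison) auto
    qed
    have e_le: "norm (e S i j) \<le> norm lam * norm (x j i) + row_sum M i * C j" if "finite S" for S i j
    proof -
      have "norm (\<Sum>k\<in>S. M i k * x j k) \<le> (\<Sum>k\<in>S. norm (M i k) * C j)"
        by (intro sum_norm_le) (simp add: norm_mult C mult_left_mono)
      also have "\<dots> = (\<Sum>k\<in>S. norm (M i k)) * C j" by (simp add: sum_distrib_right)
      also have "\<dots> \<le> row_sum M i * C j"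
        using sum_le_row_sum[OF M that, of i] order.trans[OF norm_ge_zero C[of j i]] by (intro mult_right_mono) auto
      finally show ?thesis unfolding e_def
        using norm_triangle_ineq4[of "lam * x j i" "\<Sum>k\<in>S. M i k * x j k"] by (simp add: norm_mult)
    qed
    have L_le: "norm (L S i j) \<le> norm (Kb i j)" if "finite S" for S i j
    proof (cases "j \<in> R")
      case True
      have "norm (L S i j) \<le> norm ((1 - z * lam) * x j i) + norm (z * e S i j) + norm (of_bool (i = j) :: complex)"
        using True norm_triangle_ineq4[of "(1 - z * lam) * x j i + z * e S i j" "of_bool (i = j)"]
          norm_triangle_ineq[of "(1 - z * lam) * x j i" "z * e S i j"]
        unfolding L_def by (simp only: if_True)
      also have "\<dots> \<le> \<beta> i j"
        unfolding \<beta>_def using e_le[OF that, of i j] by (intro add_mono) (auto simp: norm_mult mult_left_mono)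
      also have "\<dots> = norm (Kb i j)" using True \<beta>nn by (simp add: Kb_def)
      finally show ?thesis .
    qed (simp add: L_def Kb_def)
    have e_lim: "((\<lambda>S. e S i j) \<longlongrightarrow> 0) ?F" for i j
    proof -
      have "((\<lambda>S. \<Sum>k\<in>S. M i k * x j k) \<longlongrightarrow> lam * x j i) ?F"
        using x_ev[of j] by (simp add: is_eigvec_def has_sum_def)
      from tendsto_diff[OF tendsto_const[of "lam * x j i"] this] show ?thesis by (simp add: e_def)
    qed
    \<comment> \<open>The net formally runs over arbitrary sets, so infinite ones are sent to the
      empty set; eventually nothing changes.\<close>
    let ?S' = "\<lambda>S :: int set. if finite S then S else {}"
    have "((\<lambda>S. sdet (?S' S) (id_plus (L (?S' S)))) \<longlongrightarrow> fdet Linf) ?F"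
    proof (rule sdet_id_plus_tendsto_fdet[OF Kb])
      show "norm (L (?S' S) i j) \<le> norm (Kb i j)" for S i j by (rule L_le) auto
      show "\<forall>\<^sub>F S in ?F. i \<in> ?S' S" for i
        unfolding eventually_finite_subsets_at_top by (intro exI[of _ "{i}"]) auto
      fix i j
      have "((\<lambda>S. L S i j) \<longlongrightarrow> Linf i j) ?F"
      proof (cases "j \<in> R")
        case True
        have "((\<lambda>S. (1 - z * lam) * x j i + z * e S i j - of_bool (i = j)) \<longlongrightarrow>
            (1 - z * lam) * x j i + z * 0 - of_bool (i = j)) ?F"
          by (intro tendsto_intros e_lim)
        then show ?thesis using True by (simp add: L_def Linf_def)
      qed (simp add: L_def Linf_def)
      then show "((\<lambda>S. L (?S' S) i j) \<longlongrightarrow> Linf i j) ?F"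
        by (rule Lim_transform_eventually) (auto intro: eventually_finite_subsets_at_top_weakI)
    qed auto
    moreover have "\<forall>\<^sub>F S in ?F. sdet (?S' S) (id_plus (L (?S' S))) = sdet S A"
      using sup by eventually_elim (simp add: AL)
    ultimately have "((\<lambda>S. sdet S A) \<longlongrightarrow> fdet Linf) ?F" by (rule Lim_transform_eventually)
    then have 1: "fdet (\<lambda>i j. - z * M i j) = fdet Linf"
      using limA tendsto_unique[OF finite_subsets_at_top_neq_bot] by blast
    have "summable_mat Linf"
    proof (rule summable_mat_comparison[OF Kb])
      fix i j
      show "norm (Linf i j) \<le> norm (Kb i j)"
      proof (rule tendsto_upperbound[where F = ?F])
        show "((\<lambda>S. norm (L S i j)) \<longlongrightarrow> norm (Linf i j)) ?F"
        proof (cases "j \<in> R")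
          case True
          have "((\<lambda>S. (1 - z * lam) * x j i + z * e S i j - of_bool (i = j)) \<longlongrightarrow>
              (1 - z * lam) * x j i + z * 0 - of_bool (i = j)) ?F"
            by (intro tendsto_intros e_lim)
          from tendsto_norm[OF this] show ?thesis using True by (simp add: L_def Linf_def)
        qed (simp add: L_def Linf_def)
        show "\<forall>\<^sub>F S in ?F. norm (L S i j) \<le> norm (Kb i j)"
          using sup by eventually_elim (simp add: L_le)
      qed simp
    qed
    then have limL: "((\<lambda>S. sdet S (id_plus Linf)) \<longlongrightarrow> fdet Linf) ?F" by (rule fdet_limit_finite_subsets)
    have "((\<lambda>S. (1 - z * lam) ^ d * sdet S (id_plus (K z))) \<longlongrightarrow> (1 - z * lam) ^ d * fdet (K z)) ?F"
      by (intro tendsto_intros fdet_limit_finite_subsets Kz)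
    moreover have "\<forall>\<^sub>F S in ?F. (1 - z * lam) ^ d * sdet S (id_plus (K z)) = sdet S (id_plus Linf)"
      using sup
    proof eventually_elim
      case (elim S)
      let ?v = "\<lambda>j. if j \<in> R then 1 - z * lam else 1"
      have "sdet S (id_plus Linf) = sdet S (\<lambda>i j. 1 * ?v j * id_plus (K z) i j)"
        by (intro sdet_cong) (auto simp: id_plus_def Linf_def K_def)
      also have "\<dots> = (\<Prod>i\<in>S. 1 * ?v i) * sdet S (id_plus (K z))" using elim by (intro sdet_scale) auto
      also have "(\<Prod>i\<in>S. 1 * ?v i) = (1 - z * lam) ^ d"
        using elim R by (simp add: prod.If_cases Int_absorb1)
      finally show ?case by simp
    qed
    ultimately have "((\<lambda>S. sdet S (id_plus Linf)) \<longlongrightarrow> (1 - z * lam) ^ d * fdet (K z)) ?F"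
      by (rule Lim_transform_eventually)
    then show ?thesis
      using limL 1 tendsto_unique[OF finite_subsets_at_top_neq_bot] by metis
  qed
  have "fdet (K (1 / lam)) \<noteq> 0"
  proof
    assume "fdet (K (1 / lam)) = 0"
    then obtain y where y: "\<And>i. norm (y i) \<le> 1" "\<exists>i. y i \<noteq> 0"
      and ker: "\<And>i. ((\<lambda>m. K (1 / lam) i m * y m) has_sum (- y i)) UNIV"
      using fdet_zero_imp_kernel[OF Kz] by blast
    \<comment> \<open>The entries of y outside R. Splitting the kernel equation at R gives (M - lam)
      y' = u, where u collects the eigenvectors weighted by the entries of y in R.\<close>
    define y' where "y' i = (if i \<in> R then 0 else y i)" for i
    have y': "norm (y' i) \<le> 1" for i using y(1) by (simp add: y'_def)
    define u where "u n = (\<Sum>j\<in>R. lam * y j * x j n)" for n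
    have u_ev: "is_eigvec M lam u"
      unfolding u_def using R(1) x_ev by (intro is_eigvec_sum)
    have My: "((\<lambda>m. M n m * y' m) has_sum (lam * y' n + u n)) UNIV" for n
    proof -
      have 1: "((\<lambda>m. K (1 / lam) n m * y m) has_sum (\<Sum>j\<in>R. (x j n - of_bool (n = j)) * y j)) R"
        using R(1) by (intro has_sum_finiteI) (auto simp: K_def intro!: sum.cong)
      have "((\<lambda>m. K (1 / lam) n m * y m) has_sum (- y n - (\<Sum>j\<in>R. (x j n - of_bool (n = j)) * y j))) (UNIV - R)"
        by (rule has_sum_Diff[OF ker 1]) auto
      moreover have "- y n - (\<Sum>j\<in>R. (x j n - of_bool (n = j)) * y j) = - y' n - u n / lam"
      proof -
        have "(\<Sum>j\<in>R. of_bool (n = j) * y j) = (if n \<in> R then y n else 0)"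
          using R(1) by (simp add: of_bool_def if_distrib[of "\<lambda>x. x * _"] cong: if_cong)
        moreover have "u n / lam = (\<Sum>j\<in>R. x j n * y j)"
          using lam(1) by (simp add: u_def sum_divide_distrib mult.commute)
        ultimately show ?thesis by (simp add: left_diff_distrib sum_subtractf y'_def)
      qed
      ultimately have "((\<lambda>m. K (1 / lam) n m * y m) has_sum (- y' n - u n / lam)) (UNIV - R)" by simp
      then have "((\<lambda>m. - lam * (K (1 / lam) n m * y m)) has_sum (- lam * (- y' n - u n / lam))) (UNIV - R)"
        by (rule has_sum_cmult_right)
      also have "?this \<longleftrightarrow> ((\<lambda>m. M n m * y' m) has_sum (- lam * (- y' n - u n / lam))) UNIV"
        using lam(1) by (intro has_sum_cong_neutral) (auto simp: K_def y'_def)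
      also have "- lam * (- y' n - u n / lam) = lam * y' n + u n" using lam(1) by (simp add: field_simps)
      finally show ?thesis .
    qed
    have u0: "u n = 0" for n
    proof (rule hermitian_range_orthogonal[OF M herm lam u_ev y'])
      show "u n = (\<Sum>\<^sub>\<infinity>m. M n m * y' m) - lam * y' n" for n
        using infsumI[OF My[of n]] by simp
    qed
    have yR: "y j = 0" if "j \<in> R" for j
    proof -
      have "u j = (\<Sum>i\<in>R. lam * y i * of_bool (i = j))"
        unfolding u_def using that xR by (intro sum.cong) auto
      also have "\<dots> = lam * y j" using R(1) that by (simp add: of_bool_def if_distrib[of "\<lambda>x. _ * x"] cong: if_cong)
      finally show ?thesis using u0[of j] lam(1) by simp
    qed
    have yy: "y' = y" using yR by (auto simp: y'_def)
    have My0: "((\<lambda>m. M n m * y m) has_sum (lam * y n)) UNIV" for n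
      using My[of n] u0 yy by simp
    have y_ev: "is_eigvec M lam y"
      unfolding is_eigvec_def
      using My0 abs_summable_imp_square_summable[OF bounded_eigenvector_abs_summable[OF M lam(1) y(1) My0] y(1)] by blast
    \<comment> \<open>Evaluation at the dual points recovers the coefficients of the w i, since y
      vanishes on R.\<close>
    have "indep_eigvecs M lam (Suc d)"
      unfolding indep_eigvecs_def
    proof (intro exI[of _ "\<lambda>i. if i < d then w i else y"] conjI allI impI)
      show "is_eigvec M lam (if i < d then w i else y)" for i using w_ev y_ev by simp
      fix b i assume "\<forall>m. (\<Sum>i<Suc d. b i * (if i < d then w i else y) m) = 0" and i: "i < Suc d"
      then have b: "(\<Sum>i<d. b i * w i m) + b d * y m = 0" for m by simp
      have bj: "b j = 0" if "j < d" for j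
      proof -
        have "(\<Sum>i<d. b i * w i (r j)) = (\<Sum>i<d. b i * of_bool (i = j))"
          using that wr by (intro sum.cong) auto
        also have "\<dots> = b j" using that by (simp add: of_bool_def if_distrib[of "\<lambda>x. _ * x"] cong: if_cong)
        finally show ?thesis using b[of "r j"] yR[of "r j"] that by (simp add: R_def)
      qed
      then have "b d * y m = 0" for m using b[of m] by simp
      then have "b d = 0" using y(2) by auto
      then show "b i = 0" using bj i by (cases "i = d") auto
    qed
    then show False using em unfolding eig_mult_def by (metis Suc_n_not_le_n)
  qed
  with hol factor show ?thesis by blast
qed

section \<open>Sums of products of hyperbolic secants\<close>

definition sech_at :: "real \<Rightarrow> real \<Rightarrow> int \<Rightarrow> real" where
  "sech_at w k n = 1 / cosh (pi * (w * of_int n + k))"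

definition tanh_at :: "real \<Rightarrow> real \<Rightarrow> int \<Rightarrow> real" where
  "tanh_at w k n = tanh (pi * (w * of_int n + k))"

definition sech_sum :: "real \<Rightarrow> real \<Rightarrow> real" where
  "sech_sum w k = (\<Sum>\<^sub>\<infinity>n. sech_at w k n)"

lemma sech_at_pos: "sech_at w k n > 0"
  by (simp add: sech_at_def)

lemma sech_at_shift: "sech_at w k (n + j) = sech_at w (k + w * of_int j) n"
  by (simp add: sech_at_def algebra_simps)

lemma tanh_at_shift: "tanh_at w k (n + j) = tanh_at w (k + w * of_int j) n"
  by (simp add: tanh_at_def algebra_simps)

section \<open>Partial fractions in sech and tanh\<close>

lemma sech_mult_sech:
  fixes x y :: real
  assumes "x \<noteq> y"
  shows "1 / cosh x * (1 / cosh y) = (tanh x - tanh y) / sinh (x - y)"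
proof -
  have "sinh (x - y) \<noteq> 0" using assms by simp
  then show ?thesis
    by (simp add: tanh_def field_simps sinh_diff)
qed

lemma tanh_mult_sech:
  fixes x y :: real
  assumes "x \<noteq> y"
  shows "tanh x * (1 / cosh y) = 1 / sinh (y - x) * (1 / cosh x) - cosh (y - x) / sinh (y - x) * (1 / cosh y)"
proof -
  have s: "sinh (y - x) \<noteq> 0" using assms by simp
  have "cosh y - cosh (y - x) * cosh x = sinh x * sinh (y - x)"
    using cosh_add[of x "y - x"] by (simp add: algebra_simps)
  moreover have "1 / s * (1 / a) - c / s * (1 / b) = (b - c * a) / (s * a * b)"
    if "s \<noteq> 0" "a \<noteq> 0" "b \<noteq> 0" for s a b c :: real
    using that by (simp add: field_simps)
  ultimately have "1 / sinh (y - x) * (1 / cosh x) - cosh (y - x) / sinh (y - x) * (1 / cosh y)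
      = sinh x * sinh (y - x) / (sinh (y - x) * cosh x * cosh y)" using s by simp
  also have "\<dots> = tanh x * (1 / cosh y)" using s by (simp add: tanh_def)
  finally show ?thesis by simp
qed

text \<open>Each further factor switches between the two shapes: sech combinations become tanh
  combinations by \<open>sech_mult_sech\<close>, and conversely by \<open>tanh_mult_sech\<close>.
  The vanishing coefficient sum makes a tanh combination summable over translates although tanh
  itself is not.\<close>

lemma prod_sech_partial_fractions:
  assumes "finite S" "S \<noteq> {}" and w: "w > 0"
  shows "if odd (card S)
    then \<exists>c. \<forall>k. (\<Prod>n\<in>S. sech_at w k n) = (\<Sum>n\<in>S. c n * sech_at w k n)
    else \<exists>c. (\<Sum>n\<in>S. c n) = 0 \<and> (\<forall>k. (\<Prod>n\<in>S. sech_at w k n) = (\<Sum>n\<in>S. c n * tanh_at w k n))"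
  using assms(1,2)
proof (induction S rule: finite_ne_induct)
  case (singleton x)
  show ?case by (auto intro!: exI[of _ "\<lambda>_. 1"])
next
  case (insert l S)
  have ne: "pi * (w * of_int n + k) \<noteq> pi * (w * of_int l + k)" if "n \<in> S" for n k
    using that insert w by auto
  \<comment> \<open>The difference of two arguments is free of k, which is why the coefficients do
    not depend on k.\<close>
  define d where "d n = pi * w * of_int (l - n)" for n
  have d: "pi * (w * of_int l + k) - pi * (w * of_int n + k) = d n" for n k
    by (simp add: d_def algebra_simps)
  have prod: "(\<Prod>n\<in>insert l S. sech_at w k n) = (\<Prod>n\<in>S. sech_at w k n) * sech_at w k l" for k
    using insert by (simp add: mult.commute)
  show ?case
  proof (cases "odd (card S)")
    case True
    then obtain c where c: "\<And>k. (\<Prod>n\<in>S. sech_at w k n) = (\<Sum>n\<in>S. c n * sech_at w k n)"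
      using insert by auto
    define c' where "c' n = (if n = l then (\<Sum>m\<in>S. c m / sinh (d m)) else - (c n / sinh (d n)))" for n
    have c'S: "(\<Sum>n\<in>S. c' n * f n) = (\<Sum>n\<in>S. - (c n / sinh (d n)) * f n)" for f
      using insert by (intro sum.cong) (auto simp: c'_def)
    have "(\<Sum>n\<in>insert l S. c' n) = 0"
      using insert c'S[of "\<lambda>_. 1"] by (simp add: c'_def sum_negf)
    moreover have "(\<Prod>n\<in>insert l S. sech_at w k n) = (\<Sum>n\<in>insert l S. c' n * tanh_at w k n)" for k
    proof -
      have "(\<Prod>n\<in>insert l S. sech_at w k n) = (\<Sum>n\<in>S. c n * (sech_at w k l * sech_at w k n))"
        unfolding prod c by (simp add: sum_distrib_left mult_ac)
      also have "\<dots> = (\<Sum>n\<in>S. c n * ((tanh_at w k l - tanh_at w k n) / sinh (d n)))"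
        using sech_mult_sech[OF ne[symmetric]] by (intro sum.cong) (auto simp: sech_at_def tanh_at_def d)
      also have "\<dots> = (\<Sum>n\<in>S. c n / sinh (d n)) * tanh_at w k l + (\<Sum>n\<in>S. - (c n / sinh (d n)) * tanh_at w k n)"
        unfolding sum_distrib_right sum.distrib[symmetric]
        by (intro sum.cong) (auto simp: diff_divide_distrib right_diff_distrib)
      also have "\<dots> = (\<Sum>n\<in>insert l S. c' n * tanh_at w k n)"
        using insert c'S[of "tanh_at w k"] by (simp add: c'_def)
      finally show ?thesis .
    qed
    ultimately have "\<exists>c. (\<Sum>n\<in>insert l S. c n) = 0 \<and>
      (\<forall>k. (\<Prod>n\<in>insert l S. sech_at w k n) = (\<Sum>n\<in>insert l S. c n * tanh_at w k n))" by blast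
    then show ?thesis using True insert by simp
  next
    case False
    then obtain c where c: "\<And>k. (\<Prod>n\<in>S. sech_at w k n) = (\<Sum>n\<in>S. c n * tanh_at w k n)"
      using insert by auto
    define c' where "c' n = (if n = l then - (\<Sum>m\<in>S. c m * (cosh (d m) / sinh (d m))) else c n / sinh (d n))" for n
    have c'S: "(\<Sum>n\<in>S. c' n * f n) = (\<Sum>n\<in>S. c n / sinh (d n) * f n)" for f
      using insert by (intro sum.cong) (auto simp: c'_def)
    have "(\<Prod>n\<in>insert l S. sech_at w k n) = (\<Sum>n\<in>insert l S. c' n * sech_at w k n)" for k
    proof -
      have "(\<Prod>n\<in>insert l S. sech_at w k n) = (\<Sum>n\<in>S. c n * (tanh_at w k n * sech_at w k l))"
        unfolding prod c by (simp add: sum_distrib_left mult_ac)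
      also have "\<dots> = (\<Sum>n\<in>S. c n * (1 / sinh (d n) * sech_at w k n - cosh (d n) / sinh (d n) * sech_at w k l))"
        using tanh_mult_sech[OF ne] by (intro sum.cong) (auto simp: sech_at_def tanh_at_def d)
      also have "\<dots> = (\<Sum>n\<in>S. c n / sinh (d n) * sech_at w k n) - (\<Sum>n\<in>S. c n * (cosh (d n) / sinh (d n))) * sech_at w k l"
        unfolding sum_distrib_right sum_subtractf[symmetric]
        by (intro sum.cong) (auto simp: right_diff_distrib)
      also have "\<dots> = (\<Sum>n\<in>insert l S. c' n * sech_at w k n)"
        using insert c'S[of "sech_at w k"] by (simp add: c'_def)
      finally show ?thesis .
    qed
    then have "\<exists>c. \<forall>k. (\<Prod>n\<in>insert l S. sech_at w k n) = (\<Sum>n\<in>insert l S. c n * sech_at w k n)" by blast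
    then show ?thesis using False insert by simp
  qed
qed

section \<open>Summation of sech and of tanh differences over the integers\<close>

lemma exp_abs_int_summable:
  assumes "c > (0::real)"
  shows "(\<lambda>n::int. exp (- c * \<bar>of_int n\<bar>)) summable_on UNIV"
proof -
  let ?f = "\<lambda>n::int. exp (- c * \<bar>of_int n\<bar>)"
  have geo: "(\<lambda>n::nat. exp (- c) ^ n) summable_on UNIV"
    using assms by (subst summable_on_UNIV_nonneg_real_iff) (auto intro!: summable_geometric)
  have "?f \<circ> int = (\<lambda>n. exp (- c) ^ n)" "?f \<circ> (\<lambda>n. - int n) = (\<lambda>n. exp (- c) ^ n)"
    by (auto simp: fun_eq_iff mult.commute simp flip: exp_of_nat_mult)
  then have "?f summable_on range int" "?f summable_on range (\<lambda>n. - int n)"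
    using geo by (auto simp: summable_on_reindex inj_on_def)
  then have "?f summable_on (range int \<union> range (\<lambda>n. - int n))" by (rule summable_on_union)
  moreover have "range int \<union> range (\<lambda>n. - int n) = UNIV"
  proof -
    have "n \<in> range int \<union> range (\<lambda>n. - int n)" for n
      by (cases n rule: int_cases2) auto
    then show ?thesis by blast
  qed
  ultimately show ?thesis by simp
qed

lemma sech_le_exp: "1 / cosh x \<le> 2 * exp (- \<bar>x\<bar>)" for x :: real
proof -
  have "exp \<bar>x\<bar> \<le> 2 * cosh x"
    by (cases "x \<ge> 0") (auto simp: cosh_def)
  then show ?thesis by (simp add: exp_minus field_simps)
qed

lemma sech_at_le:
  assumes "w > 0"
  shows "sech_at w k n \<le> 2 * exp (pi * \<bar>k\<bar>) * exp (- (pi * w) * \<bar>of_int n\<bar>)"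
proof -
  have "\<bar>w * of_int n\<bar> - \<bar>k\<bar> \<le> \<bar>w * of_int n + k\<bar>" by linarith
  then have "pi * (w * \<bar>of_int n\<bar> - \<bar>k\<bar>) \<le> pi * \<bar>w * of_int n + k\<bar>"
    using assms by (intro mult_left_mono) (auto simp: abs_mult)
  moreover have "\<bar>pi * (w * of_int n + k)\<bar> = pi * \<bar>w * of_int n + k\<bar>" by (simp add: abs_mult)
  ultimately have "exp (- \<bar>pi * (w * of_int n + k)\<bar>) \<le> exp (pi * \<bar>k\<bar> + - (pi * w) * \<bar>of_int n\<bar>)"
    by (simp add: right_diff_distrib)
  then show ?thesis
    using sech_le_exp[of "pi * (w * of_int n + k)"] unfolding sech_at_def exp_add by linarith
qed

lemma sech_at_summable:
  assumes "w > 0"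
  shows "sech_at w k summable_on UNIV"
proof -
  have "(\<lambda>n. 2 * exp (pi * \<bar>k\<bar>) * exp (- (pi * w) * \<bar>of_int n\<bar>)) summable_on UNIV"
    using assms by (intro summable_on_cmult_right exp_abs_int_summable) auto
  then show ?thesis
    by (rule summable_on_comparison_test) (use sech_at_le[OF assms] in \<open>auto intro: less_imp_le[OF sech_at_pos]\<close>)
qed

lemma sech_sum_pos: "w > 0 \<Longrightarrow> sech_sum w k > 0"
proof -
  assume w: "w > 0"
  have "sech_at w k 0 \<le> sech_sum w k"
    unfolding sech_sum_def using finite_sum_le_infsum[OF sech_at_summable[OF w], of "{0}" k] sech_at_pos[of w k]
    by (simp add: less_imp_le)
  then show ?thesis using sech_at_pos[of w k 0] by linarith
qed

lemma has_sum_int_shift: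
  "(f has_sum s) UNIV \<longleftrightarrow> ((\<lambda>j::int. f (n + j)) has_sum s) UNIV"
  by (rule has_sum_reindex_bij_witness[of _ "\<lambda>j. n + j" "\<lambda>j. j - n"]) auto

lemma has_sum_sech_at_shift:
  assumes "w > 0"
  shows "((\<lambda>j. sech_at w k (n + j)) has_sum sech_sum w k) UNIV"
  using has_sum_infsum[OF sech_at_summable[OF assms, of k]]
  by (subst has_sum_int_shift[symmetric]) (simp add: sech_sum_def)

text \<open>\<open>sech_mult_sech\<close> read backwards at arguments pi w apart. It shows that the
  steps of tanh are nonnegative and decay like sech.\<close>

lemma tanh_at_step:
  assumes w: "w > 0"
  shows "tanh_at w k (1 + j) - tanh_at w k j = sinh (pi * w) * (sech_at w k (1 + j) * sech_at w k j)"
proof -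
  have s: "sinh (pi * w) > 0" using w by simp
  have "pi * (w * of_int (1 + j) + k) - pi * (w * of_int j + k) = pi * w" by (simp add: algebra_simps)
  then have "sech_at w k (1 + j) * sech_at w k j = (tanh_at w k (1 + j) - tanh_at w k j) / sinh (pi * w)"
    using sech_mult_sech[of "pi * (w * of_int (1 + j) + k)" "pi * (w * of_int j + k)"] w
    unfolding sech_at_def tanh_at_def by auto
  then show ?thesis using s w by simp
qed

lemma has_sum_tanh_at_step:
  assumes w: "w > 0"
  shows "((\<lambda>j. tanh_at w k (1 + j) - tanh_at w k j) has_sum 2) UNIV"
proof -
  note eq = tanh_at_step[OF w]
  have "(\<lambda>j. sinh (pi * w) * sech_at w k j) summable_on UNIV"
    by (intro summable_on_cmult_right sech_at_summable w)
  then have "(\<lambda>j. tanh_at w k (1 + j) - tanh_at w k j) summable_on UNIV"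
  proof (rule summable_on_comparison_test)
    fix j
    have "sech_at w k (1 + j) \<le> 1" by (simp add: sech_at_def cosh_real_ge_1)
    then have "sech_at w k (1 + j) * sech_at w k j \<le> 1 * sech_at w k j"
      using sech_at_pos[of w k j] by (intro mult_right_mono) auto
    then show "tanh_at w k (1 + j) - tanh_at w k j \<le> sinh (pi * w) * sech_at w k j"
      unfolding eq using w by (intro mult_left_mono) auto
    show "0 \<le> tanh_at w k (1 + j) - tanh_at w k j"
      unfolding eq using w sech_at_pos[of w k] by (simp add: less_imp_le)
  qed
  then obtain s where s: "((\<lambda>j. tanh_at w k (1 + j) - tanh_at w k j) has_sum s) UNIV"
    by (auto simp: summable_on_def)
  \<comment> \<open>An unordered sum may be evaluated along any exhausting sequence of finite sets;
    on symmetric intervals the steps telescope to the difference of the limits 1 and -1.\<close>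
  have "filterlim (\<lambda>N. {- int N..<int N}) (finite_subsets_at_top UNIV) sequentially"
    unfolding filterlim_finite_subsets_at_top
  proof (intro allI impI)
    fix X :: "int set" assume X: "finite X \<and> X \<subseteq> UNIV"
    show "\<forall>\<^sub>F N in sequentially. finite {- int N..<int N} \<and> X \<subseteq> {- int N..<int N} \<and> {- int N..<int N} \<subseteq> UNIV"
      using eventually_gt_at_top[of "\<Sum>x\<in>X. nat \<bar>x\<bar>"]
    proof eventually_elim
      case (elim N)
      have "nat \<bar>x\<bar> \<le> (\<Sum>x\<in>X. nat \<bar>x\<bar>)" if "x \<in> X" for x
        using X that by (intro member_le_sum) auto
      with elim have "nat \<bar>x\<bar> < N" if "x \<in> X" for x using that by (meson le_less_trans)
      then show ?case by force
    qed
  qed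
  from filterlim_compose[OF s[unfolded has_sum_def] this]
  have "(\<lambda>N. \<Sum>j\<in>{- int N..<int N}. tanh_at w k (1 + j) - tanh_at w k j) \<longlonglongrightarrow> s" .
  moreover have "(\<Sum>j\<in>{- int N..<int N}. tanh_at w k (1 + j) - tanh_at w k j) = tanh_at w k (int N) - tanh_at w k (- int N)" for N
  proof (induction N)
    case (Suc N)
    have "{- int (Suc N)..<int (Suc N)} = insert (- 1 - int N) (insert (int N) {- int N..<int N})" by auto
    then show ?case using Suc by (simp add: algebra_simps)
  qed simp
  moreover have "(\<lambda>N. tanh_at w k (int N) - tanh_at w k (- int N)) \<longlonglongrightarrow> 1 - (-1)"
  proof (rule tendsto_diff)
    have 1: "filterlim (\<lambda>N. pi * (w * real N + c)) at_top sequentially" for c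
      using w by real_asymp
    show "(\<lambda>N. tanh_at w k (int N)) \<longlonglongrightarrow> 1"
      using filterlim_compose[OF tanh_real_at_top 1[of k]] by (simp add: tanh_at_def)
    have "(\<lambda>N. - tanh (pi * (w * real N + (- k)))) \<longlonglongrightarrow> -1"
      using filterlim_compose[OF tanh_real_at_top 1[of "- k"]] by (intro tendsto_minus)
    also have "(\<lambda>N. - tanh (pi * (w * real N + (- k)))) = (\<lambda>N. tanh_at w k (- int N))"
      by (auto simp: fun_eq_iff tanh_at_def algebra_simps simp flip: tanh_minus)
    finally show "(\<lambda>N. tanh_at w k (- int N)) \<longlonglongrightarrow> -1" .
  qed
  ultimately have "s = 2" using LIMSEQ_unique by fastforce
  then show ?thesis using s by simp
qed

lemma has_sum_tanh_at_diff:
  assumes w: "w > 0"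
  shows "((\<lambda>j. tanh_at w k (n + j) - tanh_at w k j) has_sum (2 * of_int n)) UNIV"
proof (induction n rule: int_induct[where k = 0])
  case base
  show ?case by simp
next
  case (step1 n)
  have "((\<lambda>j. tanh_at w k (1 + (n + j)) - tanh_at w k (n + j)) has_sum 2) UNIV"
    using has_sum_tanh_at_step[OF w, of k] by (subst (asm) has_sum_int_shift[of _ _ n])
  from has_sum_add[OF this step1(2)] show ?case by (simp add: algebra_simps)
next
  case (step2 n)
  have "((\<lambda>j. tanh_at w k (1 + (n - 1 + j)) - tanh_at w k (n - 1 + j)) has_sum 2) UNIV"
    using has_sum_tanh_at_step[OF w, of k] by (subst (asm) has_sum_int_shift[of _ _ "n - 1"])
  from has_sum_add[OF step2(2) has_sum_uminusI[OF this]] show ?case by (simp add: algebra_simps)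
qed

section \<open>Sums over the translates of a finite set\<close>

lemma translates_even:
  assumes "finite S" "S \<noteq> {}" "even (card S)" and w: "w > 0"
  shows "\<exists>a. \<forall>k. ((\<lambda>j. \<Prod>n\<in>S. sech_at w k (n + j)) has_sum a) UNIV"
proof -
  obtain c where c0: "(\<Sum>n\<in>S. c n) = 0"
    and c: "\<And>k. (\<Prod>n\<in>S. sech_at w k n) = (\<Sum>n\<in>S. c n * tanh_at w k n)"
    using prod_sech_partial_fractions[OF assms(1,2) w] assms(3) by auto
  have "((\<lambda>j. \<Prod>n\<in>S. sech_at w k (n + j)) has_sum (\<Sum>n\<in>S. c n * (2 * of_int n))) UNIV" for k
  proof -
    \<comment> \<open>Since the coefficients add up to 0, one may subtract the same tanh in every
      term. Each difference then sums to 2 n over all j, whatever k is.\<close>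
    have "(\<Prod>n\<in>S. sech_at w k (n + j)) = (\<Sum>n\<in>S. c n * (tanh_at w k (n + j) - tanh_at w k j))" for j
    proof -
      have "(\<Prod>n\<in>S. sech_at w k (n + j)) = (\<Sum>n\<in>S. c n * tanh_at w k (n + j))"
        unfolding sech_at_shift tanh_at_shift by (rule c)
      also have "\<dots> = (\<Sum>n\<in>S. c n * tanh_at w k (n + j)) - (\<Sum>n\<in>S. c n) * tanh_at w k j"
        using c0 by simp
      finally show ?thesis by (simp add: sum_distrib_right right_diff_distrib sum_subtractf)
    qed
    then show ?thesis
      using has_sum_sum[OF assms(1), of "\<lambda>n j. c n * (tanh_at w k (n + j) - tanh_at w k j)" UNIV "\<lambda>n. c n * (2 * of_int n)"]
      by (simp add: has_sum_cmult_right has_sum_tanh_at_diff[OF w])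
  qed
  then show ?thesis by blast
qed

lemma translates_odd:
  assumes "finite S" "odd (card S)" and w: "w > 0"
  shows "\<exists>b. \<forall>k. ((\<lambda>j. \<Prod>n\<in>S. sech_at w k (n + j)) has_sum (b * sech_sum w k)) UNIV"
proof -
  have "S \<noteq> {}" using assms(2) by auto
  then obtain c where c: "\<And>k. (\<Prod>n\<in>S. sech_at w k n) = (\<Sum>n\<in>S. c n * sech_at w k n)"
    using prod_sech_partial_fractions[OF assms(1) _ w] assms(2) by auto
  have "((\<lambda>j. \<Prod>n\<in>S. sech_at w k (n + j)) has_sum (\<Sum>n\<in>S. c n * sech_sum w k)) UNIV" for k
  proof -
    have "(\<Prod>n\<in>S. sech_at w k (n + j)) = (\<Sum>n\<in>S. c n * sech_at w k (n + j))" for j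
      unfolding sech_at_shift by (rule c)
    then show ?thesis
      using has_sum_sum[OF assms(1), of "\<lambda>n j. c n * sech_at w k (n + j)" UNIV "\<lambda>n. c n * sech_sum w k"]
      by (simp add: has_sum_cmult_right has_sum_sech_at_shift[OF w])
  qed
  then show ?thesis by (auto simp: sum_distrib_right[symmetric])
qed

text \<open>Translation acts freely on the nonempty finite sets of integers, and the sets with
  minimum 0 represent the orbits. The invariant coefficient comes out of each orbit sum; the empty
  set is its own orbit.\<close>

lemma sum_over_translates:
  fixes c :: "int set \<Rightarrow> complex"
  assumes inv: "\<And>S j. finite S \<Longrightarrow> c ((+) j ` S) = c S"
    and sum: "(\<lambda>S. c S * (\<Prod>n\<in>S. of_real (sech_at w k n))) summable_on {S. finite S}"
    and g: "\<And>S. finite S \<Longrightarrow> S \<noteq> {} \<Longrightarrow> c S \<noteq> 0 \<Longrightarrow>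
        ((\<lambda>j. \<Prod>n\<in>S. sech_at w k (n + j)) has_sum g S) UNIV"
  shows "(\<Sum>\<^sub>\<infinity>S\<in>{S. finite S}. c S * (\<Prod>n\<in>S. of_real (sech_at w k n))) =
    c {} + (\<Sum>\<^sub>\<infinity>S\<in>{S. finite S \<and> S \<noteq> {} \<and> Min S = 0}. c S * of_real (g S))"
proof -
  let ?f = "\<lambda>S. c S * (\<Prod>n\<in>S. complex_of_real (sech_at w k n))"
  let ?N = "{S :: int set. finite S \<and> S \<noteq> {}}"
  let ?Z = "{S :: int set. finite S \<and> S \<noteq> {} \<and> Min S = 0}"
  have split: "{S :: int set. finite S} = insert {} ?N" by auto
  have sN: "?f summable_on ?N"
    using sum by (rule summable_on_subset_banach) auto
  have Min_shift: "Min ((+) j ` S) = j + Min S" if "finite S" "S \<noteq> {}" for S and j :: int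
    using that by (intro hom_Min_commute[symmetric]) (auto simp: min_def)
  have "(?f has_sum infsum ?f ?N) ?N \<longleftrightarrow>
      ((\<lambda>(S, j). ?f ((+) j ` S)) has_sum infsum ?f ?N) (?Z \<times> UNIV)"
  proof (rule has_sum_reindex_bij_witness[of _ "\<lambda>(S, j). (+) j ` S" "\<lambda>S. ((+) (- Min S) ` S, Min S)"])
    fix S assume S: "S \<in> ?N"
    show "(case ((+) (- Min S) ` S, Min S) of (S, j) \<Rightarrow> (+) j ` S) = S"
      by (simp add: image_image)
    show "((+) (- Min S) ` S, Min S) \<in> ?Z \<times> UNIV"
    proof (intro SigmaI CollectI conjI)
      show "Min ((+) (- Min S) ` S) = 0" using S Min_shift[of S "- Min S"] by (metis (lifting) left_minus mem_Collect_eq)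
    qed (use S in auto)
    show "(case ((+) (- Min S) ` S, Min S) of (S, j) \<Rightarrow> ?f ((+) j ` S)) = ?f S"
      by (simp add: image_image)
  next
    fix b assume "b \<in> ?Z \<times> (UNIV :: int set)"
    then obtain S j where b: "b = (S, j)" "finite S" "S \<noteq> {}" "Min S = 0" by auto
    show "(case b of (S, j) \<Rightarrow> (+) j ` S) \<in> ?N" using b by auto
    show "((+) (- Min (case b of (S, j) \<Rightarrow> (+) j ` S)) ` (case b of (S, j) \<Rightarrow> (+) j ` S), Min (case b of (S, j) \<Rightarrow> (+) j ` S)) = b"
      using b Min_shift[of S j] by (simp add: image_image)
  qed simp
  then have "((\<lambda>(S, j). ?f ((+) j ` S)) has_sum infsum ?f ?N) (?Z \<times> UNIV)" using sN by simp
  then have "((\<lambda>S. c S * of_real (g S)) has_sum infsum ?f ?N) ?Z"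
  proof (rule has_sum_SigmaD)
    fix S assume S: "S \<in> ?Z"
    have f: "?f ((+) j ` S) = c S * of_real (\<Prod>n\<in>S. sech_at w k (n + j))" for j
      using S by (subst inv) (auto simp: prod.reindex add.commute)
    have "((\<lambda>j. c S * of_real (\<Prod>n\<in>S. sech_at w k (n + j))) has_sum c S * of_real (g S)) UNIV"
    proof (cases "c S = 0")
      case False
      then show ?thesis using S g[of S] by (intro has_sum_cmult_right has_sum_of_real) auto
    qed simp
    then show "((\<lambda>j. case (S, j) of (S, j) \<Rightarrow> ?f ((+) j ` S)) has_sum c S * of_real (g S)) UNIV"
      by (simp only: f prod.case)
  qed
  then have "infsum ?f ?N = (\<Sum>\<^sub>\<infinity>S\<in>?Z. c S * of_real (g S))" by (simp add: infsumI)
  moreover have "infsum ?f {S. finite S} = ?f {} + infsum ?f ?N"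
    unfolding split using sN by (intro infsum_insert) auto
  ultimately show ?thesis by simp
qed

text \<open>c' changes the sign of the odd sets, so the sum of the two series is twice the even
  part, which is constant in k, and the difference is twice the odd part, which is proportional to
  \<open>sech_sum w\<close>. For coefficients homogeneous of degree card S in z, passing to c' means
  replacing z by - z.\<close>

lemma translate_invariant_sum_split:
  fixes c :: "int set \<Rightarrow> complex" and w :: real
  defines "c' \<equiv> \<lambda>S. (-1) ^ card S * c S"
  defines "\<Phi> \<equiv> \<lambda>c k. \<Sum>\<^sub>\<infinity>S\<in>{S. finite S}. c S * (\<Prod>n\<in>S. of_real (sech_at w k n))"
  assumes w: "w > 0" and inv: "\<And>S j. finite S \<Longrightarrow> c ((+) j ` S) = c S"
    and sum: "\<And>k. (\<lambda>S. c S * (\<Prod>n\<in>S. of_real (sech_at w k n))) summable_on {S. finite S}"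
  shows "\<Phi> c k + \<Phi> c' k = \<Phi> c l + \<Phi> c' l"
    and "(\<Phi> c k - \<Phi> c' k) * of_real (sech_sum w l) = (\<Phi> c l - \<Phi> c' l) * of_real (sech_sum w k)"
proof -
  define e where "e S = (if even (card S) then c S else 0)" for S :: "int set"
  define o' where "o' S = (if odd (card S) then c S else 0)" for S :: "int set"
  let ?p = "\<lambda>k S. \<Prod>n\<in>S. complex_of_real (sech_at w k n)"
  have abs: "(\<lambda>S. norm (c S * ?p k S)) summable_on {S. finite S}" for k
    using sum[of k] by (simp add: summable_on_iff_abs_summable_on_complex)
  have se: "(\<lambda>S. e S * ?p k S) summable_on {S. finite S}" for k
    by (rule abs_summable_summable, rule summable_on_comparison_test[OF abs[of k]]) (auto simp: e_def)
  have so: "(\<lambda>S. o' S * ?p k S) summable_on {S. finite S}" for k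
    by (rule abs_summable_summable, rule summable_on_comparison_test[OF abs[of k]]) (auto simp: o'_def)
  have c_eq: "c = (\<lambda>S. e S + o' S)" "c' = (\<lambda>S. e S - o' S)"
    by (auto simp: fun_eq_iff e_def o'_def c'_def)
  have 1: "\<Phi> c k = \<Phi> e k + \<Phi> o' k" for k
    using infsum_add[OF se so, of k k] unfolding \<Phi>_def c_eq(1) by (simp add: distrib_right)
  have 2: "\<Phi> c' k = \<Phi> e k - \<Phi> o' k" for k
    using infsumI[OF has_sum_add[OF has_sum_infsum[OF se[of k]] has_sum_uminusI[OF has_sum_infsum[OF so[of k]]]]]
    unfolding \<Phi>_def c_eq(2) by (simp add: left_diff_distrib)
  have card: "card ((+) j ` S) = card S" for j and S :: "int set" by (simp add: card_image)
  obtain a where a: "\<And>S k. finite S \<Longrightarrow> S \<noteq> {} \<Longrightarrow> even (card S) \<Longrightarrow>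
      ((\<lambda>j. \<Prod>n\<in>S. sech_at w k (n + j)) has_sum a S) UNIV"
    using translates_even[OF _ _ _ w] by metis
  obtain b where b: "\<And>S k. finite S \<Longrightarrow> odd (card S) \<Longrightarrow>
      ((\<lambda>j. \<Prod>n\<in>S. sech_at w k (n + j)) has_sum (b S * sech_sum w k)) UNIV"
    using translates_odd[OF _ _ w] by metis
  have "\<Phi> e k = e {} + (\<Sum>\<^sub>\<infinity>S\<in>{S. finite S \<and> S \<noteq> {} \<and> Min S = 0}. e S * of_real (a S))" for k
    unfolding \<Phi>_def using se
    by (intro sum_over_translates) (auto simp: e_def inv card intro: a split: if_splits)
  then have e: "\<Phi> e k = \<Phi> e l" by simp
  have o1: "\<Phi> o' k = (\<Sum>\<^sub>\<infinity>S\<in>{S. finite S \<and> S \<noteq> {} \<and> Min S = 0}. o' S * of_real (b S * sech_sum w k))" for k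
  proof -
    have "\<Phi> o' k = o' {} + (\<Sum>\<^sub>\<infinity>S\<in>{S. finite S \<and> S \<noteq> {} \<and> Min S = 0}. o' S * of_real (b S * sech_sum w k))"
      unfolding \<Phi>_def using so
      by (intro sum_over_translates) (auto simp: o'_def inv card intro: b split: if_splits)
    then show ?thesis by (simp add: o'_def)
  qed
  have o2: "\<Phi> o' k = (\<Sum>\<^sub>\<infinity>S\<in>{S. finite S \<and> S \<noteq> {} \<and> Min S = 0}. o' S * of_real (b S)) * of_real (sech_sum w k)" for k
    unfolding o1 by (subst infsum_cmult_left'[symmetric]) (simp add: mult.assoc)
  show "\<Phi> c k + \<Phi> c' k = \<Phi> c l + \<Phi> c' l" using 1 2 e by simp
  have "\<Phi> o' k * of_real (sech_sum w l) = \<Phi> o' l * of_real (sech_sum w k)"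
    unfolding o2 by simp
  then show "(\<Phi> c k - \<Phi> c' k) * of_real (sech_sum w l) = (\<Phi> c l - \<Phi> c' l) * of_real (sech_sum w k)"
    unfolding 1 2 by (simp add: algebra_simps)
qed

section \<open>Quantitative bounds near a point of the half lattice\<close>

lemma sinh_ge_self: "x \<ge> 0 \<Longrightarrow> x \<le> sinh x" for x :: real
proof -
  assume x: "x \<ge> 0"
  have "sinh 0 - 0 \<le> sinh x - x"
  proof (rule DERIV_nonneg_imp_nondecreasing[OF x])
    fix t :: real
    have "((\<lambda>t. sinh t - t) has_real_derivative cosh t - 1) (at t)"
      by (auto intro!: derivative_eq_intros)
    then show "\<exists>y. ((\<lambda>t. sinh t - t) has_real_derivative y) (at t) \<and> 0 \<le> y"
      using cosh_real_ge_1[of t] by (intro exI[of _ "cosh t - 1"]) auto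
  qed
  then show ?thesis by simp
qed

lemma cosh_ge_quadratic: "1 + x\<^sup>2 / 2 \<le> cosh x" for x :: real
proof -
  have "(\<bar>x\<bar> / 2)\<^sup>2 \<le> (sinh (\<bar>x\<bar> / 2))\<^sup>2"
    by (intro power_mono sinh_ge_self) auto
  then have "1 + x\<^sup>2 / 2 \<le> cosh (2 * (\<bar>x\<bar> / 2))"
    by (subst cosh_double) (simp add: cosh_square_eq power_divide)
  then show ?thesis by (simp add: abs_if split: if_splits)
qed

lemma cosh_real_abs: "cosh \<bar>x\<bar> = cosh x" for x :: real
  by (cases "x \<ge> 0") auto

text \<open>A mean value estimate: the slope of cosh is at least sinh \<alpha> to the right of
  \<alpha>.\<close>

lemma cosh_diff_ge:
  fixes a b \<alpha> :: real
  assumes "\<alpha> \<ge> 0" "a \<ge> \<alpha>" "b \<ge> \<alpha>"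
  shows "sinh \<alpha> * \<bar>a - b\<bar> \<le> \<bar>cosh a - cosh b\<bar>"
proof -
  have *: "sinh \<alpha> * (a - b) \<le> cosh a - cosh b" if "a \<ge> b" "b \<ge> \<alpha>" for a b
  proof -
    have "sinh \<alpha> * (a - b) \<le> sinh b * (a - b)" using that by (intro mult_right_mono) auto
    also have "\<dots> \<le> sinh b * sinh (a - b)"
      using that assms by (intro mult_left_mono sinh_ge_self) auto
    also have "\<dots> \<le> cosh b * cosh (a - b) - cosh b + sinh b * sinh (a - b)"
      using cosh_real_ge_1[of "a - b"] cosh_real_pos[of b] mult_left_mono[of 1 "cosh (a - b)" "cosh b"] by simp
    also have "\<dots> = cosh a - cosh b" using cosh_add[of b "a - b"] by simp
    finally show ?thesis .
  qed
  show ?thesis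
  proof (cases "a \<ge> b")
    case True
    then show ?thesis using *[of b a] assms by simp
  next
    case False
    then show ?thesis using *[of a b] assms by (simp add: abs_minus_commute)
  qed
qed

lemma cosh_le_shift: "cosh x \<le> exp \<bar>y\<bar> * cosh (x + y)" for x y :: real
proof -
  have "exp x \<le> exp (\<bar>y\<bar> + (x + y))" "exp (- x) \<le> exp (\<bar>y\<bar> + - (x + y))" by auto
  then have "exp x \<le> exp \<bar>y\<bar> * exp (x + y)" "exp (- x) \<le> exp \<bar>y\<bar> * exp (- (x + y))"
    by (simp_all only: exp_add)
  then have "exp x + exp (- x) \<le> exp \<bar>y\<bar> * (exp (x + y) + exp (- (x + y)))"
    unfolding distrib_left by linarith
  then show ?thesis by (simp add: cosh_def)
qed

lemma sech_sum_local_bound: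
  assumes w: "w > 0"
  shows "sech_sum w k \<le> exp (pi * \<bar>k - k0\<bar>) * sech_sum w k0"
proof -
  have "sech_sum w k \<le> (\<Sum>\<^sub>\<infinity>n. exp (pi * \<bar>k - k0\<bar>) * sech_at w k0 n)"
    unfolding sech_sum_def
  proof (intro infsum_mono sech_at_summable summable_on_cmult_right w)
    fix n
    have "pi * (w * of_int n + k) = pi * (w * of_int n + k0) + pi * (k - k0)" by (simp add: algebra_simps)
    then have "cosh (pi * (w * of_int n + k0)) \<le> exp (pi * \<bar>k - k0\<bar>) * cosh (pi * (w * of_int n + k))"
      using cosh_le_shift[of "pi * (w * of_int n + k0)" "pi * (k - k0)"] by (simp add: abs_mult)
    then show "sech_at w k n \<le> exp (pi * \<bar>k - k0\<bar>) * sech_at w k0 n"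
      by (simp add: sech_at_def pos_divide_le_eq mult.commute pos_le_divide_eq)
  qed
  then show ?thesis unfolding sech_sum_def using sech_at_summable[OF w] by (simp add: infsum_cmult_right')
qed

text \<open>The Fredholm determinant of the Carleman operator, the case of a constant symbol, is the product
  below. At \<open>z = 1 / sech_at w k0 n\<close> it vanishes to second order at \<open>k0\<close>.\<close>

lemma sech_product_lower_bound:
  assumes w: "w > 0" and k0: "k0 = w / 2 * of_int j"
  shows "\<exists>z a. a > 0 \<and> (\<exists>n. z * sech_at w k0 n = 1) \<and>
    (\<forall>k S. \<bar>k - k0\<bar> \<le> w / 4 \<longrightarrow> finite S \<longrightarrow> {- (j div 2), - (j div 2) - 1} \<subseteq> S \<longrightarrow>
       a * (k - k0)\<^sup>2 \<le> \<bar>\<Prod>n\<in>S. 1 - z * sech_at w k n\<bar>)"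
proof -
  \<comment> \<open>The index whose argument at k0 is u0, namely 0 for even j and w / 2 for odd
    j.\<close>
  define n0 where "n0 = - (j div 2)"
  define u0 where "u0 = w * of_int n0 + k0"
  define z where "z = cosh (pi * u0)"
  \<comment> \<open>The factors that vanish at k0. For odd j the arguments w / 2 and - w / 2 give
    the same value of cosh, so two factors vanish together.\<close>
  define X where "X = (if even j then {n0} else {n0, n0 - 1})"
  have j: "j = 2 * (j div 2) + j mod 2" by simp
  have u0: "u0 = (if even j then 0 else w / 2)"
  proof -
    have "of_int j = (2 * of_int (j div 2) + of_int (j mod 2) :: real)"
      by (subst j) (simp only: of_int_add of_int_mult of_int_numeral)
    moreover have "of_int (j mod 2) = (if even j then 0 else 1 :: real)" by (auto simp: odd_iff_mod_2_eq_one)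
    ultimately show ?thesis by (auto simp: u0_def n0_def k0 algebra_simps)
  qed
  have u0nn: "0 \<le> u0" using u0 w by auto
  \<comment> \<open>At k0 the arguments outside X have modulus at least u0 + w. Moving k by at most
    w / 4 leaves u0 + 3 w / 4, so those factors stay above \<theta>.\<close>
  define \<theta> where "\<theta> = 1 - z / cosh (pi * (u0 + 3 * w / 4))"
  have \<theta>: "0 < \<theta>"
  proof -
    have "z < cosh (pi * (u0 + 3 * w / 4))"
      unfolding z_def using w u0nn by (intro cosh_real_strict_mono) auto
    then show ?thesis by (simp add: \<theta>_def)
  qed
  have zpos: "0 < z" by (simp add: z_def)
  have z1: "z * sech_at w k0 n0 = 1" by (simp add: z_def sech_at_def u0_def)
  have far: "z * sech_at w k n \<le> 1 - \<theta>" if h: "\<bar>k - k0\<bar> \<le> w / 4" and n: "n \<notin> X" for k n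
  proof -
    have eq: "w * of_int n + k = w * of_int (n - n0) + u0 + (k - k0)"
      by (simp add: u0_def algebra_simps)
    have "u0 + w \<le> \<bar>w * of_int (n - n0) + u0\<bar>"
    proof (cases "n > n0")
      case True
      then have "w * 1 \<le> w * of_int (n - n0)" using w by (intro mult_left_mono) auto
      then show ?thesis by linarith
    next
      case False
      then have "n - n0 \<le> (if even j then -1 else -2)" using n by (auto simp: X_def)
      then have "real_of_int (n - n0) \<le> of_int (if even j then -1 else -2)"
        by (simp only: of_int_le_iff)
      then have "of_int (n - n0) \<le> (if even j then -1 else -2 :: real)"
        by (simp split: if_splits)
      then have "w * of_int (n - n0) \<le> w * (if even j then -1 else -2)" using w by (intro mult_left_mono) auto
      moreover have "w * (if even j then -1 else -2) = - (2 * u0) - w" using u0 by (simp split: if_splits)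
      ultimately show ?thesis by linarith
    qed
    then have "u0 + 3 * w / 4 \<le> \<bar>w * of_int n + k\<bar>" unfolding eq using h by linarith
    then have "pi * (u0 + 3 * w / 4) \<le> \<bar>pi * (w * of_int n + k)\<bar>" by (simp add: abs_mult)
    moreover have "0 \<le> pi * (u0 + 3 * w / 4)" using w u0nn by simp
    ultimately have "cosh (pi * (u0 + 3 * w / 4)) \<le> cosh \<bar>pi * (w * of_int n + k)\<bar>"
      by (simp only: cosh_real_nonneg_le_iff abs_ge_zero)
    then have "cosh (pi * (u0 + 3 * w / 4)) \<le> cosh (pi * (w * of_int n + k))" by (simp only: cosh_real_abs)
    then show ?thesis using zpos by (simp add: \<theta>_def sech_at_def divide_left_mono)
  qed
  \<comment> \<open>For 0 <= x <= 1 - \<theta> one has 1 - x >= exp (- x / \<theta>), and C bounds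
    the sum of these exponents uniformly for k within w / 4 of k0.\<close>
  define C where "C = z * (exp (pi * (w / 4)) * sech_sum w k0) / \<theta>"
  have rest: "exp (- C) \<le> (\<Prod>n\<in>S. 1 - z * sech_at w k n)"
    if h: "\<bar>k - k0\<bar> \<le> w / 4" and S: "finite S" "S \<inter> X = {}" for k S
  proof -
    have "(\<Sum>n\<in>S. sech_at w k n) \<le> sech_sum w k"
      unfolding sech_sum_def using S by (intro finite_sum_le_infsum sech_at_summable w) (auto intro: less_imp_le[OF sech_at_pos])
    also have "\<dots> \<le> exp (pi * \<bar>k - k0\<bar>) * sech_sum w k0" by (rule sech_sum_local_bound[OF w])
    also have "\<dots> \<le> exp (pi * (w / 4)) * sech_sum w k0"
      using h sech_sum_pos[OF w, of k0] by (intro mult_right_mono) (auto intro: mult_left_mono)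
    finally have "z * (\<Sum>n\<in>S. sech_at w k n) / \<theta> \<le> C"
      unfolding C_def using zpos \<theta> by (intro divide_right_mono mult_left_mono) auto
    then have "exp (- C) \<le> exp (\<Sum>n\<in>S. - (z * sech_at w k n / \<theta>))"
      by (simp add: sum_negf sum_distrib_left sum_divide_distrib)
    also have "\<dots> = (\<Prod>n\<in>S. exp (- (z * sech_at w k n / \<theta>)))" using S by (simp add: exp_sum)
    also have "\<dots> \<le> (\<Prod>n\<in>S. 1 - z * sech_at w k n)"
    proof (intro prod_mono conjI)
      fix n assume n: "n \<in> S"
      define x where "x = z * sech_at w k n"
      have x: "0 \<le> x" "x \<le> 1 - \<theta>" using far[OF h, of n] n S zpos less_imp_le[OF sech_at_pos[of w k n]] by (auto simp: x_def)
      have "1 / (1 - x) \<le> 1 + x / \<theta>"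
      proof -
        have "1 / (1 - x) = 1 + x / (1 - x)" using x \<theta> by (simp add: field_simps)
        also have "x / (1 - x) \<le> x / \<theta>" using x \<theta> by (intro divide_left_mono) auto
        finally show ?thesis by simp
      qed
      also have "\<dots> \<le> exp (x / \<theta>)" by (rule exp_ge_add_one_self)
      finally show "exp (- (z * sech_at w k n / \<theta>)) \<le> 1 - z * sech_at w k n"
        unfolding x_def[symmetric] using x \<theta> by (simp add: exp_minus field_simps)
    qed auto
    finally show ?thesis .
  qed
  have factor_eq: "1 - z * sech_at w k n = (cosh (pi * (w * of_int n + k)) - cosh (pi * u0)) / cosh (pi * (w * of_int n + k))" for k n
    by (simp add: z_def sech_at_def field_simps)
  define D where "D = cosh (pi * (u0 + w / 4))"
  have Dpos: "D > 0" by (simp add: D_def)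
  \<comment> \<open>For even j one factor vanishes quadratically because cosh has its minimum there.
    For odd j each of two factors vanishes linearly, with slope at least that of cosh at pi w / 4. D
    bounds the denominators from above.\<close>
  define a where "a = (if even j then pi\<^sup>2 / 2 / D else (sinh (pi * (w / 4)) * pi / D)\<^sup>2)"
  have apos: "a > 0" using w Dpos by (auto simp: a_def)
  have near: "a * (k - k0)\<^sup>2 \<le> \<bar>\<Prod>n\<in>X. 1 - z * sech_at w k n\<bar>" if h: "\<bar>k - k0\<bar> \<le> w / 4" for k
  proof (cases "even j")
    case True
    have X: "X = {n0}" and u: "u0 = 0" "w * of_int n0 + k = k - k0" using True u0 by (auto simp: X_def u0_def)
    have "cosh (pi * (k - k0)) = cosh \<bar>pi * (k - k0)\<bar>" by (simp only: cosh_real_abs)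
    also have "\<dots> \<le> D" unfolding D_def using h u w by (subst cosh_real_nonneg_le_iff) (auto simp: abs_mult)
    finally have cD: "cosh (pi * (k - k0)) \<le> D" .
    have "a * (k - k0)\<^sup>2 = (pi * (k - k0))\<^sup>2 / 2 / D" using True by (simp add: a_def power_mult_distrib)
    also have "\<dots> \<le> (cosh (pi * (k - k0)) - 1) / D"
      using cosh_ge_quadratic[of "pi * (k - k0)"] Dpos by (intro divide_right_mono) auto
    also have "\<dots> \<le> (cosh (pi * (k - k0)) - 1) / cosh (pi * (k - k0))"
      using cD cosh_real_ge_1[of "pi * (k - k0)"] Dpos by (intro divide_left_mono) auto
    finally have "a * (k - k0)\<^sup>2 \<le> (cosh (pi * (k - k0)) - 1) / cosh (pi * (k - k0))" .
    moreover have "1 - z * sech_at w k n0 = (cosh (pi * (k - k0)) - 1) / cosh (pi * (k - k0))"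
      unfolding factor_eq u(2) u(1) by simp
    ultimately have "a * (k - k0)\<^sup>2 \<le> 1 - z * sech_at w k n0" by simp
    then show ?thesis using abs_ge_self[of "1 - z * sech_at w k n0"] by (simp add: X)
  next
    case False
    have X: "X = {n0, n0 - 1}" and u: "u0 = w / 2" using False u0 by (auto simp: X_def)
    have f: "sinh (pi * (w / 4)) * pi / D * \<bar>k - k0\<bar> \<le> \<bar>1 - z * sech_at w k n\<bar>"
      if v: "\<bar>w * of_int n + k\<bar> = v" and vu: "\<bar>v - u0\<bar> = \<bar>k - k0\<bar>" for n v
    proof -
      have v1: "w / 4 \<le> v" "v \<le> u0 + w / 4" using vu h u w by linarith+
      have "\<bar>pi * (w * of_int n + k)\<bar> = pi * v" using v by (simp add: abs_mult)
      then have c: "cosh (pi * (w * of_int n + k)) = cosh (pi * v)" by (metis cosh_real_abs)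
      have "sinh (pi * (w / 4)) * \<bar>pi * v - pi * u0\<bar> \<le> \<bar>cosh (pi * v) - cosh (pi * u0)\<bar>"
        using v1 u w by (intro cosh_diff_ge) auto
      moreover have "\<bar>pi * v - pi * u0\<bar> = pi * \<bar>k - k0\<bar>"
        unfolding vu[symmetric] right_diff_distrib[symmetric] by (simp add: abs_mult)
      ultimately have "sinh (pi * (w / 4)) * pi * \<bar>k - k0\<bar> / D \<le> \<bar>cosh (pi * v) - cosh (pi * u0)\<bar> / D"
        using Dpos by (intro divide_right_mono) (auto simp: mult.assoc)
      also have "\<dots> \<le> \<bar>cosh (pi * v) - cosh (pi * u0)\<bar> / cosh (pi * v)"
      proof (intro divide_left_mono)
        show "cosh (pi * v) \<le> D" unfolding D_def using v1 w u by (subst cosh_real_nonneg_le_iff) auto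
      qed (use Dpos in auto)
      finally show ?thesis unfolding factor_eq c by (simp add: abs_divide)
    qed
    have "sinh (pi * (w / 4)) * pi / D * \<bar>k - k0\<bar> \<le> \<bar>1 - z * sech_at w k n0\<bar>"
    proof (rule f)
      have "w * of_int n0 + k = u0 + (k - k0)" by (simp add: u0_def)
      then show "\<bar>w * of_int n0 + k\<bar> = u0 + (k - k0)" using h u w by linarith
    qed simp
    moreover have "sinh (pi * (w / 4)) * pi / D * \<bar>k - k0\<bar> \<le> \<bar>1 - z * sech_at w k (n0 - 1)\<bar>"
    proof (rule f)
      have "w * of_int (n0 - 1) + k = - (u0 - (k - k0))" using u by (simp add: u0_def algebra_simps)
      then show "\<bar>w * of_int (n0 - 1) + k\<bar> = u0 - (k - k0)" using h u w by linarith
    qed simp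
    ultimately have "(sinh (pi * (w / 4)) * pi / D * \<bar>k - k0\<bar>) * (sinh (pi * (w / 4)) * pi / D * \<bar>k - k0\<bar>) \<le>
        \<bar>1 - z * sech_at w k n0\<bar> * \<bar>1 - z * sech_at w k (n0 - 1)\<bar>"
      using Dpos w by (intro mult_mono) auto
    then show ?thesis using False
      by (simp add: X a_def abs_mult power2_eq_square power_mult_distrib mult_ac)
  qed
  have "a * exp (- C) * (k - k0)\<^sup>2 \<le> \<bar>\<Prod>n\<in>S. 1 - z * sech_at w k n\<bar>"
    if h: "\<bar>k - k0\<bar> \<le> w / 4" and S: "finite S" "{n0, n0 - 1} \<subseteq> S" for k S
  proof -
    have XS: "X \<subseteq> S" using S by (auto simp: X_def)
    have "a * exp (- C) * (k - k0)\<^sup>2 = (a * (k - k0)\<^sup>2) * exp (- C)" by simp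
    also have "\<dots> \<le> \<bar>\<Prod>n\<in>X. 1 - z * sech_at w k n\<bar> * \<bar>\<Prod>n\<in>S - X. 1 - z * sech_at w k n\<bar>"
    proof (intro mult_mono near[OF h])
      have "exp (- C) \<le> (\<Prod>n\<in>S - X. 1 - z * sech_at w k n)" using S by (intro rest[OF h]) auto
      then show "exp (- C) \<le> \<bar>\<Prod>n\<in>S - X. 1 - z * sech_at w k n\<bar>" by linarith
    qed auto
    also have "\<dots> = \<bar>\<Prod>n\<in>S. 1 - z * sech_at w k n\<bar>"
      using prod.subset_diff[OF XS S(1), of "\<lambda>n. 1 - z * sech_at w k n"] by (simp add: abs_mult mult.commute)
    finally show ?thesis .
  qed
  moreover have "a * exp (- C) > 0" using apos by simp
  ultimately show ?thesis using z1 unfolding n0_def by blast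
qed

text \<open>With z chosen so that the product of the factors \<open>1 - z * sech_at w k n\<close>
  vanishes at k0, its affine dependence on \<open>sech_sum w k\<close> leaves a constant B times the
  increment of \<open>sech_sum w\<close>. A lower bound for the product is then one for the
  increment.\<close>

lemma sech_sum_quadratic_lower_bound:
  assumes w: "w > 0" and k0: "k0 = w / 2 * of_int j"
  shows "\<exists>a>0. \<exists>\<epsilon>>0. \<forall>k. \<bar>k - k0\<bar> < \<epsilon> \<longrightarrow> a * (k - k0)\<^sup>2 \<le> \<bar>sech_sum w k - sech_sum w k0\<bar>"
proof -
  obtain z a n where a: "a > 0" and n: "z * sech_at w k0 n = 1"
    and le: "\<And>k S. \<bar>k - k0\<bar> \<le> w / 4 \<Longrightarrow> finite S \<Longrightarrow> {- (j div 2), - (j div 2) - 1} \<subseteq> S \<Longrightarrow>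
       a * (k - k0)\<^sup>2 \<le> \<bar>\<Prod>n\<in>S. 1 - z * sech_at w k n\<bar>"
    using sech_product_lower_bound[OF assms] by blast
  \<comment> \<open>With these coefficients the sum over all finite sets is the expansion of the
    product of the factors \<open>1 - z * sech_at w k n\<close>.\<close>
  define c :: "int set \<Rightarrow> complex" where "c S = of_real (- z) ^ card S" for S
  let ?c' = "\<lambda>S. (-1) ^ card S * c S"
  let ?F = "finite_subsets_at_top (UNIV :: int set)"
  define \<Phi> where "\<Phi> c k = (\<Sum>\<^sub>\<infinity>S\<in>{S. finite S}. c S * (\<Prod>n\<in>S. complex_of_real (sech_at w k n)))"
    for c :: "int set \<Rightarrow> complex" and k
  have eq: "c S * (\<Prod>n\<in>S. of_real (sech_at w k n)) = (\<Prod>n\<in>S. complex_of_real (- z * sech_at w k n))" for S k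
    by (simp only: c_def of_real_mult prod.distrib prod_constant)
  have sum: "(\<lambda>S. c S * (\<Prod>n\<in>S. of_real (sech_at w k n))) summable_on {S. finite S}" for k
  proof -
    have "(\<lambda>n. \<bar>z\<bar> * sech_at w k n) summable_on UNIV" by (intro summable_on_cmult_right sech_at_summable w)
    then have "(\<lambda>S. \<Prod>n\<in>S. \<bar>z\<bar> * sech_at w k n) summable_on {S. finite S}"
      by (rule summable_prod_finite_sets) (simp add: less_imp_le[OF sech_at_pos])
    then have "(\<lambda>S. norm (c S * (\<Prod>n\<in>S. of_real (sech_at w k n)))) summable_on {S. finite S}"
      unfolding eq by (rule summable_on_comparison_test)
        (auto simp: norm_mult prod_norm[symmetric] abs_mult less_imp_le[OF sech_at_pos] intro!: prod_mono prod_nonneg)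
    then show ?thesis by (rule abs_summable_summable)
  qed
  have inv: "c ((+) j ` S) = c S" if "finite S" for j S by (simp add: c_def card_image)
  note split = translate_invariant_sum_split[OF w, of c, OF inv sum, folded \<Phi>_def]
  define B where "B = (\<Phi> c k0 - \<Phi> ?c' k0) / of_real (sech_sum w k0) / 2"
  have B2: "2 * B = (\<Phi> c k0 - \<Phi> ?c' k0) / of_real (sech_sum w k0)"
  proof -
    have "2 * (x / 2) = x" for x :: complex by simp
    then show ?thesis unfolding B_def .
  qed
  have Fnz: "sech_sum w k \<noteq> 0" for k using sech_sum_pos[OF w, of k] by simp
  have diff: "\<Phi> c k - \<Phi> c k0 = B * of_real (sech_sum w k - sech_sum w k0)" for k
  proof -
    have "\<Phi> c k - \<Phi> ?c' k = (\<Phi> c k0 - \<Phi> ?c' k0) * of_real (sech_sum w k) / of_real (sech_sum w k0)"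
      using split(2)[of k k0] Fnz[of k0] by (simp only: eq_divide_eq of_real_eq_0_iff) simp
    then have "\<Phi> c k - \<Phi> ?c' k = 2 * B * of_real (sech_sum w k)" unfolding B2 by simp
    moreover have "\<Phi> c k0 - \<Phi> ?c' k0 = 2 * B * of_real (sech_sum w k0)"
      unfolding B2 using Fnz[of k0] by simp
    moreover have "\<Phi> c k + \<Phi> ?c' k = \<Phi> c k0 + \<Phi> ?c' k0" by (rule split(1))
    ultimately have "2 * (\<Phi> c k - \<Phi> c k0) = 2 * (B * of_real (sech_sum w k - sech_sum w k0))"
      by (simp add: algebra_simps)
    then show ?thesis by (rule mult_left_cancel[THEN iffD1, rotated]) simp
  qed
  have lim: "((\<lambda>S. complex_of_real (\<Prod>n\<in>S. 1 - z * sech_at w k n)) \<longlongrightarrow> \<Phi> c k) ?F" for k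
    using has_sum_prod_tendsto[OF has_sum_infsum[OF sum[of k, unfolded eq]]]
    unfolding \<Phi>_def eq by (simp add: of_real_prod)
  have zero: "\<Phi> c k0 = 0"
  proof -
    have "\<forall>\<^sub>F S in ?F. complex_of_real (\<Prod>n\<in>S. 1 - z * sech_at w k0 n) = 0"
      unfolding eventually_finite_subsets_at_top of_real_eq_0_iff
      using n by (intro exI[of _ "{n}"]) (auto intro!: prod_zero bexI[of _ n])
    then have "((\<lambda>S. complex_of_real (\<Prod>n\<in>S. 1 - z * sech_at w k0 n)) \<longlongrightarrow> 0) ?F"
      by (rule tendsto_eventually)
    then show ?thesis using lim[of k0] tendsto_unique[OF finite_subsets_at_top_neq_bot] by blast
  qed
  have bound: "a * (k - k0)\<^sup>2 \<le> norm (B) * \<bar>sech_sum w k - sech_sum w k0\<bar>" if "\<bar>k - k0\<bar> \<le> w / 4" for k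
  proof -
    have "a * (k - k0)\<^sup>2 \<le> norm (\<Phi> c k)"
    proof (rule tendsto_lowerbound[OF tendsto_norm[OF lim]])
      show "\<forall>\<^sub>F S in ?F. a * (k - k0)\<^sup>2 \<le> norm (complex_of_real (\<Prod>n\<in>S. 1 - z * sech_at w k n))"
        unfolding eventually_finite_subsets_at_top norm_of_real
        using le[OF that] by (intro exI[of _ "{- (j div 2), - (j div 2) - 1}"]) auto
    qed simp
    also have "\<Phi> c k = B * of_real (sech_sum w k - sech_sum w k0)" using diff[of k] zero by simp
    finally show ?thesis by (simp add: norm_mult del: of_real_diff)
  qed
  \<comment> \<open>At distance w / 4 from k0 the product is still bounded away from 0, so B cannot
    vanish.\<close>
  have "B \<noteq> 0"
  proof
    assume "B = 0"
    then have "a * (w / 4)\<^sup>2 \<le> 0" using bound[of "k0 + w / 4"] w by simp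
    then show False using a w by (simp add: mult_le_0_iff)
  qed
  then have "(a / norm B) * (k - k0)\<^sup>2 \<le> \<bar>sech_sum w k - sech_sum w k0\<bar>" if "\<bar>k - k0\<bar> < w / 4" for k
    using bound[of k] that by (simp add: field_simps)
  then show ?thesis using a w \<open>B \<noteq> 0\<close>
    by (intro exI[of _ "a / norm B"] conjI exI[of _ "w / 4"]) auto
qed

section \<open>The fibre operators\<close>

lemma Gamma_half_mult_Gamma_half:
  "Gamma (1/2 - \<i> * of_real x) * Gamma (1/2 + \<i> * of_real x) = of_real (pi / cosh (pi * x))"
proof -
  have "cos (\<i> * (complex_of_real pi * of_real x)) = of_real (cosh (pi * x))"
    unfolding cosh_conv_cos[symmetric] by (simp add: cosh_field_def exp_of_real[symmetric])
  then have "sin (complex_of_real pi * (1/2 - \<i> * of_real x)) = of_real (cosh (pi * x))"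
    by (simp add: right_diff_distrib sin_diff mult.left_commute)
  then show ?thesis
    using Gamma_reflection_complex[of "1/2 - \<i> * of_real x"] by (simp add: algebra_simps)
qed

lemma norm_Gamma_half:
  "(norm (Gamma (1/2 - \<i> * of_real x)))\<^sup>2 = pi / cosh (pi * x)"
  "(norm (Gamma (1/2 + \<i> * of_real x)))\<^sup>2 = pi / cosh (pi * x)"
proof -
  have c: "cnj (Gamma (1/2 - \<i> * of_real x)) = Gamma (1/2 + \<i> * of_real x)" by (simp add: cnj_Gamma)
  have "complex_of_real ((norm (Gamma (1/2 - \<i> * of_real x)))\<^sup>2) = of_real (pi / cosh (pi * x))"
    unfolding complex_norm_square c by (rule Gamma_half_mult_Gamma_half)
  then show "(norm (Gamma (1/2 - \<i> * of_real x)))\<^sup>2 = pi / cosh (pi * x)"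
    by (simp only: of_real_eq_iff)
  then show "(norm (Gamma (1/2 + \<i> * of_real x)))\<^sup>2 = pi / cosh (pi * x)"
    unfolding c[symmetric] complex_mod_cnj .
qed

lemma norm_Gamma_one:
  assumes "y \<noteq> 0"
  shows "(norm (Gamma (1 - \<i> * of_real y)))\<^sup>2 = pi * y / sinh (pi * y)"
proof -
  have iy: "\<i> * complex_of_real y \<notin> \<int>\<^sub>\<le>\<^sub>0"
    using assms by (auto elim!: nonpos_Ints_cases simp: complex_eq_iff)
  have "complex_of_real ((norm (Gamma (1 - \<i> * of_real y)))\<^sup>2) =
      Gamma (1 - \<i> * of_real y) * Gamma (\<i> * of_real y + 1)"
    unfolding complex_norm_square by (simp add: cnj_Gamma add.commute)
  also have "\<dots> = \<i> * of_real y * (Gamma (\<i> * of_real y) * Gamma (1 - \<i> * of_real y))"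
    using Gamma_plus1[OF iy] by simp
  also have "\<dots> = \<i> * of_real y * (of_real pi / sin (\<i> * of_real (pi * y)))"
    by (subst Gamma_reflection_complex) (simp add: mult_ac)
  also have "sin (\<i> * complex_of_real (pi * y)) = \<i> * of_real (sinh (pi * y))"
    unfolding sin_i_times by (simp add: sinh_field_def exp_minus exp_of_real[symmetric])
  also have "\<i> * of_real y * (of_real pi / (\<i> * of_real (sinh (pi * y)))) = complex_of_real (pi * y / sinh (pi * y))"
    by simp
  finally show ?thesis by (simp only: of_real_eq_iff)
qed

definition Hk_convolution :: "real \<Rightarrow> (real \<Rightarrow> real) \<Rightarrow> int \<Rightarrow> int \<Rightarrow> complex" where
  "Hk_convolution T p n m = fourier_coeff T p (n - m) / Gamma (1 - \<i> * of_real (2 * pi / T * of_int (n - m)))"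

text \<open>The two arguments of Beta add up to 1 - i w (n - m), so the denominator is free of k and
  depends on n - m only.\<close>

lemma Hk_factorization:
  "Hk T p k n m = Gamma (1/2 - \<i> * of_real (2 * pi / T * of_int n + k))
     * Gamma (1/2 + \<i> * of_real (2 * pi / T * of_int m + k)) * Hk_convolution T p n m"
proof -
  have 1: "1/2 - \<i> * of_real w * of_int n - \<i> * of_real k = 1/2 - \<i> * of_real (w * of_int n + k)"
    "1/2 + \<i> * of_real w * of_int m + \<i> * of_real k = 1/2 + \<i> * of_real (w * of_int m + k)"
    "1/2 - \<i> * of_real (w * of_int n + k) + (1/2 + \<i> * of_real (w * of_int m + k))
      = 1 - \<i> * of_real (w * of_int (n - m))" for w
    by (simp_all add: algebra_simps)
  show ?thesis unfolding Hk_def Beta_def 1 Hk_convolution_def by simp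
qed

lemma sdet_Hk:
  assumes "finite S"
  shows "sdet S (Hk T p k) = (\<Prod>n\<in>S. of_real (pi * sech_at (2 * pi / T) k n)) * sdet S (Hk_convolution T p)"
  unfolding Hk_factorization[abs_def]
  by (subst sdet_scale[OF assms]) (simp add: Gamma_half_mult_Gamma_half sech_at_def del: of_real_add of_real_mult)

lemma sdet_Hk_convolution_shift:
  assumes "finite S"
  shows "sdet ((+) j ` S) (Hk_convolution T p) = sdet S (Hk_convolution T p)"
proof -
  have "Hk_convolution T p (j + a) (j + b) = Hk_convolution T p a b" for a b
    by (simp add: Hk_convolution_def)
  then show ?thesis by (subst sdet_reindex[OF _ assms]) simp_all
qed

section \<open>Hermitian symmetry and reflection in k0\<close>

lemma fourier_coeff_uminus: "fourier_coeff T p (- l) = cnj (fourier_coeff T p l)"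
  unfolding fourier_coeff_def
  by (simp add: Henstock_Kurzweil_Integration.integral_cnj exp_cnj)

lemma Hk_hermitian: "Hk T p k m n = cnj (Hk T p k n m)"
proof -
  have "cnj (Hk T p k n m) = Beta (1/2 + \<i> * of_real (2*pi/T) * of_int n + \<i> * of_real k)
          (1/2 - \<i> * of_real (2*pi/T) * of_int m - \<i> * of_real k) * fourier_coeff T p (m - n)"
    using fourier_coeff_uminus[of T p "n - m"] unfolding Hk_def Beta_def by (simp add: cnj_Gamma)
  then show ?thesis unfolding Hk_def by (simp add: Beta_commute)
qed

text \<open>Since 2 k0 is j lattice steps, the index change from n to - n - j turns the argument at
  2 k0 - k into minus the argument at k. The symmetry of Beta then transposes the matrix, and
  Hermitian symmetry rewrites this as conjugation.\<close>

lemma Hk_reflection: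
  assumes "2 * k0 = 2 * pi / T * of_int j"
  shows "Hk T p (2 * k0 - k) n m = cnj (Hk T p k (- n - j) (- m - j))"
proof -
  have k0: "complex_of_real k0 * 2 = of_real (2 * pi / T) * of_int j"
    using arg_cong[OF assms, of complex_of_real] by (simp add: mult.commute)
  have 1: "1/2 - \<i> * of_real (2*pi/T) * of_int n - \<i> * of_real (2 * k0 - k) =
      1/2 + \<i> * of_real (2*pi/T) * of_int (- n - j) + \<i> * of_real k"
    "1/2 + \<i> * of_real (2*pi/T) * of_int m + \<i> * of_real (2 * k0 - k) =
      1/2 - \<i> * of_real (2*pi/T) * of_int (- m - j) - \<i> * of_real k"
    by (simp_all add: algebra_simps k0 del: of_real_divide)
  have "Hk T p (2 * k0 - k) n m = Hk T p k (- m - j) (- n - j)"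
    unfolding Hk_def 1 by (simp add: Beta_commute)
  then show ?thesis by (subst (asm) Hk_hermitian)
qed

lemma Hk_reflected_eigenvector:
  assumes k0: "2 * k0 = 2 * pi / T * of_int j" and x: "is_eigvec (Hk T p (2 * k0 - k)) (of_real \<mu>) x"
  shows "is_eigvec (Hk T p k) (of_real \<mu>) (\<lambda>n. cnj (x (- n - j)))"
  unfolding is_eigvec_def
proof (intro conjI allI)
  have "(\<lambda>n. (norm (x n))\<^sup>2) summable_on UNIV" using x by (simp add: is_eigvec_def)
  also have "?this \<longleftrightarrow> (\<lambda>n. (norm (cnj (x (- n - j))))\<^sup>2) summable_on UNIV"
    by (rule summable_on_reindex_bij_witness[of _ "\<lambda>n. - n - j" "\<lambda>n. - n - j"]) auto
  finally show "(\<lambda>n. (norm (cnj (x (- n - j))))\<^sup>2) summable_on UNIV" .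
  fix n
  have "((\<lambda>m. Hk T p (2 * k0 - k) (- n - j) m * x m) has_sum (of_real \<mu> * x (- n - j))) UNIV"
    using x by (simp add: is_eigvec_def)
  then have "((\<lambda>m. cnj (Hk T p (2 * k0 - k) (- n - j) m * x m)) has_sum cnj (of_real \<mu> * x (- n - j))) UNIV"
    by (simp only: has_sum_cnj_iff)
  also have "?this \<longleftrightarrow> ((\<lambda>m. Hk T p k n m * cnj (x (- m - j))) has_sum (of_real \<mu> * cnj (x (- n - j)))) UNIV"
    by (rule has_sum_reindex_bij_witness[of _ "\<lambda>n. - n - j" "\<lambda>n. - n - j"]) (auto simp: Hk_reflection[OF k0])
  finally show "((\<lambda>m. Hk T p k n m * cnj (x (- m - j))) has_sum (of_real \<mu> * cnj (x (- n - j)))) UNIV" .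
qed

section \<open>Absolute summability of the entries\<close>

lemma norm_Hk_offdiagonal:
  fixes T k :: real and n m :: int
  defines "w \<equiv> 2 * pi / T"
  assumes w: "w > 0" and l: "n \<noteq> m"
  shows "norm (Hk T p k n m) = pi * norm (fourier_coeff T p (n - m))
     * sqrt ((tanh_at w k n - tanh_at w k m) / (pi * w * of_int (n - m)))"
proof -
  define y where "y = w * of_int (n - m)"
  define X where "X = pi * (w * of_int n + k)"
  define Y where "Y = pi * (w * of_int m + k)"
  define f where "f = fourier_coeff T p (n - m)"
  have y0: "y \<noteq> 0" using w l by (simp add: y_def)
  have XY: "X - Y = pi * y" by (simp add: X_def Y_def y_def algebra_simps)
  have ne: "X \<noteq> Y" using XY y0 by auto
  \<comment> \<open>The factor 1 / |Gamma (1 - i y)|^2 grows like sinh (pi y) / (pi y). Two secants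
    absorb this growth and leave a difference quotient of tanh, which can be telescoped.\<close>
  have t: "tanh X - tanh Y = sinh (pi * y) / (cosh X * cosh Y)"
    using sech_mult_sech[OF ne] y0 unfolding XY by (simp add: field_simps)
  have "(norm (Hk T p k n m))\<^sup>2 = (norm (Gamma (1/2 - \<i> * of_real (w * of_int n + k))))\<^sup>2
      * (norm (Gamma (1/2 + \<i> * of_real (w * of_int m + k))))\<^sup>2 * ((norm f)\<^sup>2 / (norm (Gamma (1 - \<i> * of_real y)))\<^sup>2)"
    unfolding Hk_factorization Hk_convolution_def w_def[symmetric] y_def[symmetric] f_def[symmetric]
    by (simp only: norm_mult norm_divide power_mult_distrib power_divide)
  also have "\<dots> = pi / cosh X * (pi / cosh Y) * ((norm f)\<^sup>2 / (pi * y / sinh (pi * y)))"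
    unfolding norm_Gamma_half norm_Gamma_one[OF y0] X_def Y_def ..
  also have "\<dots> = (pi * norm f)\<^sup>2 * ((tanh X - tanh Y) / (pi * y))"
    unfolding t by (simp add: field_simps power2_eq_square)
  finally have sq: "(norm (Hk T p k n m))\<^sup>2 = (pi * norm f)\<^sup>2 * ((tanh X - tanh Y) / (pi * y))" .
  have "norm (Hk T p k n m) = sqrt ((norm (Hk T p k n m))\<^sup>2)" by simp
  also have "\<dots> = pi * norm f * sqrt ((tanh X - tanh Y) / (pi * y))"
    unfolding sq real_sqrt_mult by simp
  finally show ?thesis by (simp add: f_def X_def Y_def y_def tanh_at_def mult.assoc)
qed

lemma norm_Hk_diagonal:
  shows "norm (Hk T p k n n) = pi * norm (fourier_coeff T p 0) * sech_at (2 * pi / T) k n"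
proof -
  have "Hk T p k n n = of_real (pi * sech_at (2 * pi / T) k n) * fourier_coeff T p 0"
    unfolding Hk_factorization Hk_convolution_def Gamma_half_mult_Gamma_half sech_at_def by simp
  then show ?thesis by (simp add: norm_mult less_imp_le[OF sech_at_pos] del: of_real_mult)
qed

lemma sqrt_sum_le_sum_sqrt:
  assumes "\<And>i. f i \<ge> 0"
  shows "sqrt (\<Sum>i<(n::nat). f i) \<le> (\<Sum>i<n. sqrt (f i))"
proof (induction n)
  case (Suc n)
  have "sqrt (\<Sum>i<Suc n. f i) \<le> sqrt (\<Sum>i<n. f i) + sqrt (f n)"
    using assms by (simp add: sqrt_add_le_add_sqrt sum_nonneg)
  with Suc show ?case by simp
qed simp

text \<open>The root of a step is, up to a constant, the geometric mean of two neighbouring secants,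
  hence at most their arithmetic mean.\<close>

lemma summable_sqrt_tanh_at_step:
  assumes w: "w > 0"
  shows "(\<lambda>j. sqrt (tanh_at w k (1 + j) - tanh_at w k j)) summable_on UNIV"
proof -
  have "(\<lambda>j. sqrt (sinh (pi * w)) * ((sech_at w k (1 + j) + sech_at w k j) / 2)) summable_on UNIV"
    using has_sum_imp_summable[OF has_sum_sech_at_shift[OF w, of k 1]] sech_at_summable[OF w, of k]
      summable_on_cmult_right[OF summable_on_add, of "\<lambda>j. sech_at w k (1 + j)" UNIV "sech_at w k" "sqrt (sinh (pi * w)) / 2"]
    by simp
  then show ?thesis
  proof (rule summable_on_comparison_test)
    fix j
    have s: "sinh (pi * w) > 0" using w by simp
    note eq = tanh_at_step[OF w]
    show "sqrt (tanh_at w k (1 + j) - tanh_at w k j) \<le> sqrt (sinh (pi * w)) * ((sech_at w k (1 + j) + sech_at w k j) / 2)"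
      unfolding eq real_sqrt_mult[of "sinh (pi * w)"]
      using s by (intro mult_left_mono arith_geo_mean_sqrt less_imp_le[OF sech_at_pos]) auto
    show "0 \<le> sqrt (tanh_at w k (1 + j) - tanh_at w k j)"
      unfolding eq using s sech_at_pos[of w k] by (simp add: less_imp_le)
  qed
qed

text \<open>On the l-th diagonal the difference of tanh is split into |l| unit steps, and the root
  of their sum is at most the sum of their roots. Summing over m gives |l| C / sqrt (pi w |l|), of
  order sqrt |l|, which the weight in \<open>smooth_periodic_symbol\<close> compensates.\<close>

lemma summable_Hk:
  assumes symb: "smooth_periodic_symbol T p"
  shows "summable_mat (Hk T p k)"
proof -
  define w where "w = 2 * pi / T"
  have w: "w > 0" using symb by (simp add: w_def smooth_periodic_symbol_def)
  let ?f = "\<lambda>l. norm (fourier_coeff T p l)"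
  define \<tau> where "\<tau> j = sqrt (tanh_at w k (1 + j) - tanh_at w k j)" for j
  define C where "C = (\<Sum>\<^sub>\<infinity>j. \<tau> j)"
  have step: "0 \<le> tanh_at w k (1 + j) - tanh_at w k j" for j
    using w by (simp add: tanh_at_def algebra_simps)
  have \<tau>: "(\<tau> has_sum C) UNIV"
    unfolding C_def \<tau>_def by (intro has_sum_infsum summable_sqrt_tanh_at_step w)
  have \<tau>nn: "0 \<le> \<tau> j" for j using step by (simp add: \<tau>_def)
  have Cnn: "0 \<le> C" using \<tau> \<tau>nn by (rule has_sum_nonneg)
  \<comment> \<open>A majorant of the entry in column m on the diagonal l. Starting at
    \<open>min 0 l\<close> makes the |l| steps run upwards from the smaller of m and m + l for
    either sign of l.\<close>
  define G where "G l m = (if l = 0 then pi * ?f 0 * sech_at w k m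
     else pi * ?f l * ((\<Sum>i<nat \<bar>l\<bar>. \<tau> ((min 0 l + int i) + m)) / sqrt (pi * w * \<bar>of_int l\<bar>)))" for l m
  define g where "g l = (if l = 0 then pi * ?f 0 * sech_sum w k else pi * ?f l * (of_nat (nat \<bar>l\<bar>) * C / sqrt (pi * w * \<bar>of_int l\<bar>)))" for l
  have Gsum: "(G l has_sum g l) UNIV" for l
  proof (cases "l = 0")
    case True
    then show ?thesis unfolding G_def g_def sech_sum_def
      using has_sum_cmult_right[OF has_sum_infsum[OF sech_at_summable[OF w, of k]], of "pi * ?f 0"] by simp
  next
    case False
    have "((\<lambda>m. \<Sum>i<nat \<bar>l\<bar>. \<tau> ((min 0 l + int i) + m)) has_sum (\<Sum>i<nat \<bar>l\<bar>. C)) UNIV"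
      using \<tau> by (intro has_sum_sum) (auto simp: has_sum_int_shift[symmetric])
    then show ?thesis unfolding G_def g_def using False
      by (auto intro!: has_sum_cmult_right has_sum_divide_const)
  qed
  have Gbound: "g l
      \<le> (pi * sech_sum w k + pi * C / sqrt (pi * w)) * (?f l * (1 + (of_int l)\<^sup>2) powr (1/4))" for l
  proof (cases "l = 0")
    case True
    then show ?thesis using Cnn w by (simp add: g_def distrib_right divide_nonneg_nonneg mult_nonneg_nonneg)
  next
    case False
    have "real (nat \<bar>l\<bar>) = \<bar>of_int l\<bar>" by simp
    moreover have "\<bar>of_int l\<bar> / sqrt \<bar>of_int l\<bar> = sqrt \<bar>real_of_int l\<bar>" by (rule real_div_sqrt) simp
    ultimately have "real (nat \<bar>l\<bar>) * C / sqrt (pi * w * \<bar>of_int l\<bar>) = C / sqrt (pi * w) * sqrt \<bar>of_int l\<bar>"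
      by (metis (no_types, opaque_lifting) mult.commute real_sqrt_mult times_divide_times_eq)
    moreover have "sqrt \<bar>real_of_int l\<bar> \<le> (1 + (of_int l)\<^sup>2) powr (1/4)"
    proof -
      have "sqrt \<bar>real_of_int l\<bar> = ((of_int l)\<^sup>2) powr (1/4)"
      proof -
        have "sqrt \<bar>real_of_int l\<bar> = \<bar>of_int l\<bar> powr (1/2)" by (simp add: powr_half_sqrt)
        also have "\<dots> = (\<bar>of_int l\<bar> powr 2) powr (1/4)" by (simp only: powr_powr) simp
        also have "\<bar>real_of_int l\<bar> powr 2 = (of_int l)\<^sup>2" using False by (simp add: powr_realpow[of _ 2, simplified])
        finally show ?thesis .
      qed
      also have "\<dots> \<le> (1 + (of_int l)\<^sup>2) powr (1/4)" by (intro powr_mono2) auto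
      finally show ?thesis .
    qed
    moreover have "0 \<le> C / sqrt (pi * w)" using Cnn w by simp
    ultimately have "real (nat \<bar>l\<bar>) * C / sqrt (pi * w * \<bar>of_int l\<bar>) \<le> C / sqrt (pi * w) * (1 + (of_int l)\<^sup>2) powr (1/4)"
      by (metis mult_left_mono)
    then have "pi * ?f l * (real (nat \<bar>l\<bar>) * C / sqrt (pi * w * \<bar>of_int l\<bar>)) \<le> pi * ?f l * (C / sqrt (pi * w) * (1 + (of_int l)\<^sup>2) powr (1/4))"
      by (intro mult_left_mono) auto
    also have "\<dots> \<le> pi * ?f l * (C / sqrt (pi * w) * (1 + (of_int l)\<^sup>2) powr (1/4)) + pi * sech_sum w k * (?f l * (1 + (of_int l)\<^sup>2) powr (1/4))"
      using less_imp_le[OF sech_sum_pos[OF w, of k]] by simp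
    finally show ?thesis using False by (simp add: g_def algebra_simps)
  qed
  have Gnn: "0 \<le> G l m" for l m
    unfolding G_def using \<tau>nn w less_imp_le[OF sech_at_pos[of w k m]]
    by (auto intro!: mult_nonneg_nonneg divide_nonneg_nonneg sum_nonneg)
  have "(\<lambda>p. G (fst p) (snd p)) summable_on (SIGMA l:UNIV. UNIV)"
  proof (rule summable_on_SigmaI)
    show "((\<lambda>m. G (fst (l, m)) (snd (l, m))) has_sum g l) UNIV" for l
      using Gsum by simp
    have "(\<lambda>l. (pi * sech_sum w k + pi * C / sqrt (pi * w)) * (?f l * (1 + (of_int l)\<^sup>2) powr (1/4))) summable_on UNIV"
      using symb by (intro summable_on_cmult_right) (auto simp: smooth_periodic_symbol_def)
    then show "g summable_on UNIV"
    proof (rule summable_on_comparison_test)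
      show "0 \<le> g l" for l
        using Gsum Gnn by (rule has_sum_nonneg)
    qed (rule Gbound)
  qed (use Gnn in auto)
  then have Gs: "(\<lambda>p. G (fst p) (snd p)) summable_on UNIV" by simp
  have le: "norm (Hk T p k (m + l) m) \<le> G l m" for l m
  proof (cases "l = 0")
    case True
    then show ?thesis by (simp add: G_def norm_Hk_diagonal w_def)
  next
    case False
    have tele: "tanh_at w k (a + int n) - tanh_at w k a = (\<Sum>i<n. tanh_at w k (1 + (a + int i)) - tanh_at w k (a + int i))" for a n
      by (induction n) (simp_all add: algebra_simps)
    have eq: "(tanh_at w k (m + l) - tanh_at w k m) / (pi * w * of_int l)
      = (\<Sum>i<nat \<bar>l\<bar>. tanh_at w k (1 + (min 0 l + m + int i)) - tanh_at w k (min 0 l + m + int i)) / (pi * w * \<bar>of_int l\<bar>)"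
      using tele[of "min 0 l + m" "nat \<bar>l\<bar>"] by (cases "l > 0") (auto simp: min_def add.commute divide_minus_left[symmetric] simp del: divide_minus_left)
    have "norm (Hk T p k (m + l) m) = pi * ?f l * sqrt ((tanh_at w k (m + l) - tanh_at w k m) / (pi * w * of_int l))"
      using norm_Hk_offdiagonal[of T "m + l" m p k] False w by (simp add: w_def)
    also have "\<dots> = pi * ?f l * (sqrt (\<Sum>i<nat \<bar>l\<bar>. tanh_at w k (1 + (min 0 l + m + int i)) - tanh_at w k (min 0 l + m + int i)) / sqrt (pi * w * \<bar>of_int l\<bar>))"
      unfolding eq real_sqrt_divide ..
    also have "\<dots> \<le> pi * ?f l * ((\<Sum>i<nat \<bar>l\<bar>. \<tau> (min 0 l + m + int i)) / sqrt (pi * w * \<bar>of_int l\<bar>))"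
      unfolding \<tau>_def using w
      by (intro mult_left_mono divide_right_mono sqrt_sum_le_sum_sqrt step) auto
    also have "\<dots> = G l m" using False by (simp add: G_def algebra_simps)
    finally show ?thesis .
  qed
  have "(\<lambda>q. norm (Hk T p k (snd q + fst q) (snd q))) summable_on UNIV"
    using Gs by (rule summable_on_comparison_test) (auto intro: le)
  also have "?this \<longleftrightarrow> (\<lambda>(n, m). norm (Hk T p k n m)) summable_on UNIV"
    by (rule summable_on_reindex_bij_witness[of _ "\<lambda>(n, m). (n - m, m)" "\<lambda>(l, m). (m + l, m)"]) auto
  finally show ?thesis by (simp add: summable_mat_def)
qed

section \<open>Real analytic functions\<close>

text \<open>The continuous cofactor h of the quadratic term turns bounds on f near x0 into bounds on
  its second derivative at x0.\<close>

lemma real_analytic_expansion: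
  assumes "real_analytic f"
  shows "\<exists>r>0. \<exists>h. isCont h x0 \<and> h x0 = deriv (deriv f) x0 / 2 \<and> (f has_real_derivative deriv f x0) (at x0) \<and>
     (\<forall>x. \<bar>x - x0\<bar> < r \<longrightarrow> f x = f x0 + deriv f x0 * (x - x0) + (x - x0)\<^sup>2 * h x)"
proof -
  obtain r a where r: "r > 0" and a: "\<And>x. \<bar>x - x0\<bar> < r \<Longrightarrow> (\<lambda>n. a n * (x - x0) ^ n) sums f x"
    using assms unfolding real_analytic_def by blast
  define S where "S c y = (\<Sum>n. c n * (y :: real) ^ n)" for c :: "nat \<Rightarrow> real" and y
  have sm: "summable (\<lambda>n. a n * y ^ n)" if "norm y < r" for y
    using a[of "x0 + y"] that by (auto simp: sums_iff)
  have fS: "f x = S a (x - x0)" if "\<bar>x - x0\<bar> < r" for x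
    using a[OF that] by (simp add: S_def sums_iff)
  have sm1: "summable (\<lambda>n. diffs a n * y ^ n)" if "norm y < r" for y
    by (rule termdiff_converges[OF that sm])
  have d1: "(S a has_real_derivative S (diffs a) y) (at y)" if "norm y < r" for y
    unfolding S_def using sm that by (rule termdiffs_strong')
  have d2: "(S (diffs a) has_real_derivative S (diffs (diffs a)) y) (at y)" if "norm y < r" for y
    unfolding S_def using sm1 that by (rule termdiffs_strong')
  have shift: "((\<lambda>x. S c (x - x0)) has_real_derivative D) (at x)" if "(S c has_real_derivative D) (at (x - x0))" for c D x
  proof -
    have "((\<lambda>x. x - x0) has_real_derivative 1) (at x)" by (auto intro!: derivative_eq_intros)
    with that show ?thesis using DERIV_chain2[of "S c" D "\<lambda>x. x - x0" x 1 UNIV] by simp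
  qed
  have nb: "\<forall>\<^sub>F y in nhds x. \<bar>y - x0\<bar> < r" if "\<bar>x - x0\<bar> < r" for x
    using that by (intro eventually_nhds_in_open[of "{y. \<bar>y - x0\<bar> < r}", simplified]) (auto intro!: open_Collect_less continuous_intros)
  have fd: "(f has_real_derivative S (diffs a) (x - x0)) (at x)" if x: "\<bar>x - x0\<bar> < r" for x
  proof -
    have "((\<lambda>x. S a (x - x0)) has_real_derivative S (diffs a) (x - x0)) (at x)"
      using x by (intro shift d1) auto
    moreover have "\<forall>\<^sub>F y in nhds x. S a (y - x0) = f y"
      using nb[OF x] by eventually_elim (simp add: fS)
    ultimately show ?thesis by (subst (asm) DERIV_cong_ev) auto
  qed
  have fd': "deriv f x = S (diffs a) (x - x0)" if "\<bar>x - x0\<bar> < r" for x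
    using fd[OF that] by (rule DERIV_imp_deriv)
  have "(deriv f has_real_derivative S (diffs (diffs a)) 0) (at x0)"
  proof -
    have "((\<lambda>x. S (diffs a) (x - x0)) has_real_derivative S (diffs (diffs a)) 0) (at x0)"
      using d2[of 0] r by (intro shift) auto
    moreover have "\<forall>\<^sub>F y in nhds x0. S (diffs a) (y - x0) = deriv f y"
    proof -
      have "\<bar>x0 - x0\<bar> < r" using r by simp
      from nb[OF this] show ?thesis by eventually_elim (simp add: fd')
    qed
    ultimately show ?thesis by (subst (asm) DERIV_cong_ev) auto
  qed
  then have dd: "deriv (deriv f) x0 = S (diffs (diffs a)) 0" by (rule DERIV_imp_deriv)
  have S0: "S c 0 = c 0" for c unfolding S_def by simp
  have a0: "f x0 = a 0" "deriv f x0 = a 1" "deriv (deriv f) x0 = 2 * a 2"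
    using fS[of x0] fd'[of x0] dd r by (simp_all add: S0 diffs_def numeral_2_eq_2)
  define h where "h x = S (\<lambda>n. a (n + 2)) (x - x0)" for x
  have exp: "f x = f x0 + deriv f x0 * (x - x0) + (x - x0)\<^sup>2 * h x" if x: "\<bar>x - x0\<bar> < r" for x
  proof -
    have "(\<lambda>n. a (n + 2) * (x - x0) ^ (n + 2)) sums (f x - (\<Sum>n<2. a n * (x - x0) ^ n))"
      by (rule sums_split_initial_segment[OF a[OF x]])
    then have "(\<lambda>n. (x - x0)\<^sup>2 * (a (n + 2) * (x - x0) ^ n)) sums (f x - f x0 - deriv f x0 * (x - x0))"
      by (simp add: a0 numeral_2_eq_2 power_add mult_ac diff_diff_add)
    moreover have "summable (\<lambda>n. a (n + 2) * (x - x0) ^ n)"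
    proof (cases "x = x0")
      case False
      from sums_summable[OF calculation] show ?thesis
        using False by (subst (asm) summable_cmult_iff) auto
    qed simp
    then have "(\<lambda>n. (x - x0)\<^sup>2 * (a (n + 2) * (x - x0) ^ n)) sums ((x - x0)\<^sup>2 * h x)"
      unfolding h_def S_def by (intro sums_mult summable_sums)
    ultimately show ?thesis using sums_unique2 by fastforce
  qed
  have c1: "isCont h x0"
  proof -
    have "summable (\<lambda>n. a n * (r / 2) ^ n)" using sm[of "r / 2"] r by simp
    then have "summable (\<lambda>n. a (n + 2) * (r / 2) ^ (n + 2))"
      by (rule summable_ignore_initial_segment)
    then have "summable (\<lambda>n. (r / 2)\<^sup>2 * (a (n + 2) * (r / 2) ^ n))"
      by (simp add: power_add mult_ac power2_eq_square)
    then have "summable (\<lambda>n. a (n + 2) * (r / 2) ^ n)" using r by (subst (asm) summable_cmult_iff) auto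
    then have "isCont (S (\<lambda>n. a (n + 2))) 0"
      unfolding S_def using r by (intro isCont_powser) auto
    then have "isCont (\<lambda>x. S (\<lambda>n. a (n + 2)) (x - x0)) x0"
      by (intro isCont_o2[of x0 "\<lambda>x. x - x0" "S (\<lambda>n. a (n + 2))"]) simp_all
    then show ?thesis by (simp only: h_def[abs_def])
  qed
  have c2: "h x0 = deriv (deriv f) x0 / 2" by (simp add: h_def S0 a0 numeral_2_eq_2)
  have c3: "(f has_real_derivative deriv f x0) (at x0)" using fd[of x0] fd'[of x0] r by simp
  show ?thesis
    by (intro exI[of _ r] conjI exI[of _ h] allI impI) (rule r c1 c2 c3 exp, assumption?)+
qed

lemma real_analytic_has_derivative:
  "real_analytic f \<Longrightarrow> (f has_real_derivative deriv f x) (at x)"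
  using real_analytic_expansion[of f x] by blast

lemma real_analytic_isCont: "real_analytic f \<Longrightarrow> isCont f x"
  using real_analytic_has_derivative DERIV_isCont by blast

lemma real_analytic_diff:
  assumes "real_analytic f" "real_analytic g"
  shows "real_analytic (\<lambda>x. f x - g x)"
  unfolding real_analytic_def
proof
  fix x0
  obtain r a where r: "r > 0" and a: "\<And>x. \<bar>x - x0\<bar> < r \<Longrightarrow> (\<lambda>n. a n * (x - x0) ^ n) sums f x"
    using assms(1) unfolding real_analytic_def by blast
  obtain s b where s: "s > 0" and b: "\<And>x. \<bar>x - x0\<bar> < s \<Longrightarrow> (\<lambda>n. b n * (x - x0) ^ n) sums g x"
    using assms(2) unfolding real_analytic_def by blast
  have "(\<lambda>n. (a n - b n) * (x - x0) ^ n) sums (f x - g x)" if "\<bar>x - x0\<bar> < min r s" for x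
    using sums_diff[OF a b, of x x] that by (simp add: left_diff_distrib)
  then show "\<exists>r>0. \<exists>a. \<forall>x. \<bar>x - x0\<bar> < r \<longrightarrow> (\<lambda>n. a n * (x - x0) ^ n) sums (f x - g x)"
    using r s by (intro exI[of _ "min r s"] conjI exI[of _ "\<lambda>n. a n - b n"]) auto
qed

lemma real_analytic_const: "real_analytic (\<lambda>_. c)"
  unfolding real_analytic_def
proof
  fix x0 :: real
  have "(\<lambda>n. (if n = 0 then c else 0) * (x - x0) ^ n) sums c" for x
    using sums_single[of 0 "\<lambda>_. c"] by (rule sums_cong[THEN iffD1, rotated]) auto
  then show "\<exists>r>0. \<exists>a. \<forall>x. \<bar>x - x0\<bar> < r \<longrightarrow> (\<lambda>n. a n * (x - x0) ^ n) sums c"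
    by (intro exI[of _ 1] conjI exI[of _ "\<lambda>n. if n = 0 then c else 0"]) auto
qed

lemma real_analytic_reflect:
  assumes "real_analytic f"
  shows "real_analytic (\<lambda>x. f (c - x))"
  unfolding real_analytic_def
proof
  fix x0
  obtain r a where r: "r > 0" and a: "\<And>x. \<bar>x - (c - x0)\<bar> < r \<Longrightarrow> (\<lambda>n. a n * (x - (c - x0)) ^ n) sums f x"
    using assms unfolding real_analytic_def by blast
  have "(\<lambda>n. (a n * (-1) ^ n) * (x - x0) ^ n) sums f (c - x)" if "\<bar>x - x0\<bar> < r" for x
  proof -
    have "(\<lambda>n. a n * ((c - x) - (c - x0)) ^ n) sums f (c - x)" using that by (intro a) auto
    moreover have "(\<lambda>n. a n * ((c - x) - (c - x0)) ^ n) = (\<lambda>n. a n * (-1) ^ n * (x - x0) ^ n)"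
    proof
      fix n
      show "a n * ((c - x) - (c - x0)) ^ n = a n * (-1) ^ n * (x - x0) ^ n"
        using power_mult_distrib[of "-1" "x - x0" n] by simp
    qed
    ultimately show ?thesis by (simp only:)
  qed
  then show "\<exists>r>0. \<exists>a. \<forall>x. \<bar>x - x0\<bar> < r \<longrightarrow> (\<lambda>n. a n * (x - x0) ^ n) sums f (c - x)"
    using r by (intro exI[of _ r] conjI exI[of _ "\<lambda>n. a n * (-1) ^ n"]) auto
qed

lemma real_analytic_zeros_isolated:
  assumes f: "real_analytic f" and x1: "f x1 \<noteq> 0"
  shows "\<exists>s>0. \<forall>x. 0 < \<bar>x - x0\<bar> \<and> \<bar>x - x0\<bar> < s \<longrightarrow> f x \<noteq> 0"
proof -
  \<comment> \<open>Each point is of one of two kinds: f vanishes identically near it, or has no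
    zero in a punctured neighbourhood. Both sets are open and they are disjoint, so by connectedness
    one of them is empty; x1 excludes that everything lies in U.\<close>
  define U where "U = {y. \<exists>s>0. \<forall>x. \<bar>x - y\<bar> < s \<longrightarrow> f x = 0}"
  define V where "V = {y. \<exists>s>0. \<forall>x. 0 < \<bar>x - y\<bar> \<and> \<bar>x - y\<bar> < s \<longrightarrow> f x \<noteq> 0}"
  have UV: "y \<in> U \<union> V" for y
  proof -
    obtain r a where r: "r > 0" and a: "\<And>x. \<bar>x - y\<bar> < r \<Longrightarrow> (\<lambda>n. a n * (x - y) ^ n) sums f x"
      using f unfolding real_analytic_def by blast
    show ?thesis
    proof (cases "f y = 0")
      case False
      have "\<forall>\<^sub>F x in at y. f x \<noteq> 0"
        using real_analytic_isCont[OF f, of y] False by (intro tendsto_imp_eventually_ne) (auto simp: isCont_def)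
      then show ?thesis unfolding V_def eventually_at dist_real_def by auto
    next
      case True
      show ?thesis
      proof (cases "\<exists>m>0. a m \<noteq> 0")
        case True
        then obtain m where m: "m > 0" "a m \<noteq> 0" by blast
        obtain s where s: "s > 0" "\<And>z. z \<in> cball y s - {y} \<Longrightarrow> f z \<noteq> 0"
          using powser_0_nonzero[of r y a f m] r a \<open>f y = 0\<close> m by auto
        then have "y \<in> V" unfolding V_def
          by (auto simp: dist_real_def abs_minus_commute intro!: exI[of _ s])
        then show ?thesis by simp
      next
        case False
        have "a 0 = f y" using a[of y] r by simp
        then have "a n = 0" for n using False True by (cases n) auto
        then have "f x = 0" if "\<bar>x - y\<bar> < r" for x using a[OF that] by (simp add: sums_iff)
        then show ?thesis using r unfolding U_def by blast
      qed
    qed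
  qed
  have disj: "U \<inter> V = {}"
  proof -
    have False if y: "y \<in> U" "y \<in> V" for y
    proof -
      obtain s where s: "s > 0" "\<And>x. \<bar>x - y\<bar> < s \<Longrightarrow> f x = 0" using y(1) unfolding U_def by blast
      obtain t where t: "t > 0" "\<And>x. 0 < \<bar>x - y\<bar> \<Longrightarrow> \<bar>x - y\<bar> < t \<Longrightarrow> f x \<noteq> 0" using y(2) unfolding V_def by blast
      define m where "m = min s t"
      have "0 < m" "m \<le> s" "m \<le> t" using s(1) t(1) by (auto simp: m_def)
      then show False using s(2)[of "y + m / 2"] t(2)[of "y + m / 2"] by auto
    qed
    then show ?thesis by blast
  qed
  have oU: "open U"
    unfolding open_dist
  proof
    fix y assume "y \<in> U"
    then obtain s where s: "s > 0" "\<And>x. \<bar>x - y\<bar> < s \<Longrightarrow> f x = 0" unfolding U_def by blast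
    have "z \<in> U" if z: "dist z y < s / 2" for z
    proof -
      have "f x = 0" if "\<bar>x - z\<bar> < s / 2" for x
        using that z unfolding dist_real_def by (intro s(2)) linarith
      then show ?thesis unfolding U_def using s(1) half_gt_zero by blast
    qed
    then show "\<exists>e>0. \<forall>z. dist z y < e \<longrightarrow> z \<in> U" using s(1) by (intro exI[of _ "s / 2"]) auto
  qed
  have oV: "open V"
    unfolding open_dist
  proof
    fix y assume "y \<in> V"
    then obtain s where s: "s > 0" "\<And>x. 0 < \<bar>x - y\<bar> \<Longrightarrow> \<bar>x - y\<bar> < s \<Longrightarrow> f x \<noteq> 0" unfolding V_def by blast
    have "z \<in> V" if z: "dist z y < s" for z
    proof (cases "z = y")
      case False
      then have "0 < min \<bar>z - y\<bar> (s - \<bar>z - y\<bar>)" using z by (auto simp: dist_real_def)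
      moreover have "f x \<noteq> 0" if "\<bar>x - z\<bar> < min \<bar>z - y\<bar> (s - \<bar>z - y\<bar>)" for x
        using that by (intro s(2)) auto
      ultimately show ?thesis unfolding V_def by blast
    qed (use \<open>y \<in> V\<close> in simp)
    then show "\<exists>e>0. \<forall>z. dist z y < e \<longrightarrow> z \<in> V" using s(1) by blast
  qed
  have "U = {} \<or> V = {}"
    using connected_UNIV[where 'a = real] oU oV disj UV unfolding connected_def by blast
  moreover have "x1 \<notin> U" using x1 unfolding U_def by force
  ultimately have "x0 \<in> V" using UV[of x0] UV[of x1] by auto
  then show ?thesis unfolding V_def by blast
qed

lemma real_analytic_countable_zeros:
  assumes f: "real_analytic f" and x1: "f x1 \<noteq> 0"
  shows "countable {x. f x = 0}"
proof -
  let ?Z = "{x. f x = 0}"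
  have "\<not> x islimpt ?Z" for x
  proof -
    obtain s where s: "s > 0" "\<And>y. 0 < \<bar>y - x\<bar> \<Longrightarrow> \<bar>y - x\<bar> < s \<Longrightarrow> f y \<noteq> 0"
      using real_analytic_zeros_isolated[OF assms, of x] by blast
    show ?thesis unfolding islimpt_approachable using s by (force simp: dist_real_def)
  qed
  then have "finite (cball 0 (real n) \<inter> ?Z)" for n
    by (intro finite_not_islimpt_in_compact) auto
  then have "countable (\<Union>n. cball 0 (real n) \<inter> ?Z)" by (intro countable_UN) (auto intro: countable_finite)
  moreover have "(\<Union>n. cball 0 (real n) \<inter> ?Z) = ?Z"
    using real_arch_simple by (auto simp: dist_real_def)
  ultimately show ?thesis by simp
qed

lemma nonflat_level_set_countable:
  assumes "real_analytic f" "\<not> flat f"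
  shows "countable {x. f x = c}"
proof -
  obtain x1 where "f x1 \<noteq> c" using assms(2) unfolding flat_def by blast
  then show ?thesis
    using real_analytic_countable_zeros[OF real_analytic_diff[OF assms(1) real_analytic_const[of c]], of x1] by simp
qed

section \<open>Dependence of the determinant on k\<close>

lemma fdet_Hk_affine:
  assumes symb: "smooth_periodic_symbol T p"
  shows "\<exists>A B. A holomorphic_on UNIV \<and> B holomorphic_on UNIV \<and>
    (\<forall>k z. fdet (\<lambda>i j. - z * Hk T p k i j) = A z + B z * of_real (sech_sum (2 * pi / T) k))"
proof -
  define w where "w = 2 * pi / T"
  have w: "w > 0" using symb by (simp add: w_def smooth_periodic_symbol_def)
  define D where "D k z = fdet (\<lambda>i j. - z * Hk T p k i j)" for k z
  \<comment> \<open>Everything in a minor except the secants. It is invariant under translation of S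
    because \<open>Hk_convolution\<close> depends on the index difference only.\<close>
  define c where "c z S = (- z * of_real pi) ^ card S * sdet S (Hk_convolution T p)" for z S
  have hol: "D k holomorphic_on UNIV" for k
  proof -
    have "summable_mat (\<lambda>i j. - Hk T p k i j)"
      using summable_mat_cmult[OF summable_Hk[OF symb], of "- 1" k] by simp
    moreover have "summable_mat (\<lambda>i j :: int. 0)" by (simp add: summable_mat_def case_prod_unfold)
    ultimately show ?thesis using fdet_affine_holomorphic[of "\<lambda>i j. 0" "\<lambda>i j. - Hk T p k i j"]
      unfolding D_def by simp
  qed
  have term_eq: "sdet S (\<lambda>i j. - z * Hk T p k i j) = c z S * (\<Prod>n\<in>S. of_real (sech_at w k n))" if "finite S" for S z k
  proof -
    have "sdet S (\<lambda>i j. - z * Hk T p k i j) = (\<Prod>i\<in>S. - z) * sdet S (Hk T p k)"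
      using sdet_scale[OF that, of "\<lambda>_. - z" "\<lambda>_. 1"] by simp
    also have "\<dots> = (- z) ^ card S * (of_real pi ^ card S * (\<Prod>n\<in>S. of_real (sech_at w k n)) * sdet S (Hk_convolution T p))"
      unfolding sdet_Hk[OF that] by (simp add: w_def prod.distrib)
    also have "\<dots> = c z S * (\<Prod>n\<in>S. of_real (sech_at w k n))"
      unfolding c_def power_mult_distrib by simp
    finally show ?thesis .
  qed
  have D_eq: "D k z = (\<Sum>\<^sub>\<infinity>S\<in>{S. finite S}. c z S * (\<Prod>n\<in>S. of_real (sech_at w k n)))" for k z
    unfolding D_def fdet_def by (rule infsum_cong) (use term_eq in blast)
  have sum: "(\<lambda>S. c z S * (\<Prod>n\<in>S. of_real (sech_at w k n))) summable_on {S. finite S}" for k z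
    using summable_sdet[OF summable_mat_cmult[OF summable_Hk[OF symb]], of "- z" k]
    by (rule summable_on_cong[THEN iffD1, rotated]) (use term_eq in blast)
  have inv: "c z ((+) j ` S) = c z S" if "finite S" for z j S
    using that by (simp add: c_def sdet_Hk_convolution_shift card_image)
  \<comment> \<open>Each minor is homogeneous of degree card S in z, so changing the sign of the odd
    sets replaces z by - z.\<close>
  have minus: "(\<lambda>S. (-1) ^ card S * c z S) = c (- z)" for z
  proof
    fix S :: "int set"
    have "(- (- z) * complex_of_real pi) ^ card S = (-1) ^ card S * (- z * complex_of_real pi) ^ card S"
      by (subst power_mult_distrib[symmetric]) simp
    then show "(-1) ^ card S * c z S = c (- z) S" by (simp only: c_def mult.assoc)
  qed
  have split: "D k z + D k (- z) = D l z + D l (- z)"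
    "(D k z - D k (- z)) * of_real (sech_sum w l) = (D l z - D l (- z)) * of_real (sech_sum w k)" for k l z
    unfolding D_eq minus[symmetric] by (rule translate_invariant_sum_split[OF w inv sum]; assumption)+
  define A where "A z = (D 0 z + D 0 (- z)) / 2" for z
  define B where "B z = (D 0 z - D 0 (- z)) / of_real (sech_sum w 0) / 2" for z
  have F0: "sech_sum w 0 \<noteq> 0" using sech_sum_pos[OF w, of 0] by simp
  have hm: "(\<lambda>z. D 0 (- z)) holomorphic_on UNIV"
    using holomorphic_on_compose_gen[of uminus UNIV "D 0" UNIV] hol[of 0] by (simp add: o_def holomorphic_intros)
  have "A holomorphic_on UNIV" "B holomorphic_on UNIV"
    unfolding A_def B_def using hol[of 0] hm F0 by (auto intro!: holomorphic_intros)
  moreover have "D k z = A z + B z * of_real (sech_sum w k)" for k z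
  proof -
    have e: "D k z + D k (- z) = 2 * A z" using split(1)[of k z 0] by (simp add: A_def)
    have "(D k z - D k (- z)) * of_real (sech_sum w 0) = (D 0 z - D 0 (- z)) * of_real (sech_sum w k)"
      using split(2)[of k z 0] .
    also have "\<dots> = 2 * B z * of_real (sech_sum w k) * of_real (sech_sum w 0)" using F0 by (simp add: B_def)
    finally have o: "D k z - D k (- z) = 2 * B z * of_real (sech_sum w k)" using F0 by simp
    have "2 * D k z = (D k z + D k (- z)) + (D k z - D k (- z))" by simp
    also have "\<dots> = 2 * (A z + B z * of_real (sech_sum w k))" unfolding e o by (simp add: algebra_simps)
    finally show ?thesis by (rule mult_left_cancel[THEN iffD1, rotated]) simp
  qed
  ultimately show ?thesis unfolding D_def w_def by blast
qed

section \<open>Division of entire functions by linear factors\<close>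

lemma entire_divide_power:
  fixes \<nu> :: complex
  assumes hol: "P holomorphic_on UNIV" "q holomorphic_on UNIV" "g holomorphic_on UNIV"
    and \<nu>: "\<nu> \<noteq> 0" "P (1 / \<nu>) \<noteq> 0" and eq: "\<And>z. P z * q z = (1 - z * \<nu>) ^ n * g z"
  shows "\<exists>q'. q' holomorphic_on UNIV \<and> (\<forall>z. q z = (1 - z * \<nu>) ^ n * q' z)"
proof -
  \<comment> \<open>Away from 1 / \<nu> the quotient is explicit. Near 1 / \<nu> the cofactor P is
    invertible, so the quotient agrees with g / P and the singularity is removed.\<close>
  define q' where "q' z = (if z = 1 / \<nu> then g z / P z else q z / (1 - z * \<nu>) ^ n)" for z
  have nz: "1 - z * \<nu> \<noteq> 0" if "z \<noteq> 1 / \<nu>" for z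
    using that \<nu>(1) by (auto simp: field_simps)
  let ?U = "{z. P z \<noteq> 0}" and ?V = "- {1 / \<nu>}"
  have q'U: "q' z = g z / P z" if "z \<in> ?U" for z
    using eq[of z] nz[of z] that by (auto simp: q'_def field_simps)
  have oU: "open ?U"
    using holomorphic_on_imp_continuous_on[OF hol(1)]
    by (intro open_Collect_neq continuous_intros) auto
  have "q' holomorphic_on ?U \<union> ?V"
  proof (rule holomorphic_on_Un)
    have "(\<lambda>z. g z / P z) holomorphic_on ?U"
      using hol by (intro holomorphic_intros) (auto intro: holomorphic_on_subset)
    then show "q' holomorphic_on ?U" by (rule holomorphic_transform) (simp add: q'U)
    have "(\<lambda>z. q z / (1 - z * \<nu>) ^ n) holomorphic_on ?V"
      using hol nz by (intro holomorphic_intros) (auto intro: holomorphic_on_subset)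
    then show "q' holomorphic_on ?V" by (rule holomorphic_transform) (simp add: q'_def)
  qed (use oU in auto)
  moreover have "?U \<union> ?V = UNIV" using \<nu>(2) by auto
  moreover have "q z = (1 - z * \<nu>) ^ n * q' z" for z
  proof (cases "z = 1 / \<nu>")
    case True
    then have "P z \<noteq> 0" using \<nu>(2) by simp
    then show ?thesis using eq[of z] True by (simp add: q'_def field_simps)
  next
    case False
    then show ?thesis using nz by (simp add: q'_def)
  qed
  ultimately show ?thesis by auto
qed

lemma entire_divide_powers:
  assumes hol: "P holomorphic_on UNIV" "\<phi> holomorphic_on UNIV" and W: "finite W"
    and div: "\<And>\<mu>. \<mu> \<in> W \<Longrightarrow> \<mu> \<noteq> 0 \<and> P (1 / \<mu>) \<noteq> 0 \<and>
      (\<exists>g. g holomorphic_on UNIV \<and> (\<forall>z. P z * \<phi> z = (1 - z * \<mu>) ^ n \<mu> * g z))"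
  shows "\<exists>q. q holomorphic_on UNIV \<and> (\<forall>z. \<phi> z = (\<Prod>\<mu>\<in>W. (1 - z * \<mu>) ^ n \<mu>) * (q z :: complex))"
  using W div
proof (induction W rule: finite_induct)
  case empty
  then show ?case using hol(2) by auto
next
  case (insert \<nu> W)
  then obtain q where q: "q holomorphic_on UNIV" "\<And>z. \<phi> z = (\<Prod>\<mu>\<in>W. (1 - z * \<mu>) ^ n \<mu>) * q z" by auto
  obtain g where g: "g holomorphic_on UNIV" "\<And>z. P z * \<phi> z = (1 - z * \<nu>) ^ n \<nu> * g z" and \<nu>: "\<nu> \<noteq> 0" "P (1 / \<nu>) \<noteq> 0"
    using insert.prems[of \<nu>] by auto
  have "\<exists>q'. q' holomorphic_on UNIV \<and> (\<forall>z. q z = (1 - z * \<nu>) ^ n \<nu> * q' z)"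
  proof (rule entire_divide_power)
    \<comment> \<open>The factors already extracted join the cofactor P; they do not vanish at 1 /
      \<nu> because \<nu> is not in W.\<close>
    show "(\<lambda>z. P z * (\<Prod>\<mu>\<in>W. (1 - z * \<mu>) ^ n \<mu>)) holomorphic_on UNIV"
      using hol(1) by (intro holomorphic_intros)
    have "1 - 1 / \<nu> * \<mu> \<noteq> 0" if "\<mu> \<in> W" for \<mu> using that insert.hyps(2) \<nu>(1) by auto
    then show "P (1 / \<nu>) * (\<Prod>\<mu>\<in>W. (1 - 1 / \<nu> * \<mu>) ^ n \<mu>) \<noteq> 0"
      using \<nu>(2) insert.hyps(1) by auto
    show "P z * (\<Prod>\<mu>\<in>W. (1 - z * \<mu>) ^ n \<mu>) * q z = (1 - z * \<nu>) ^ n \<nu> * g z" for z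
      using g(2)[of z] q(2)[of z] by (simp add: mult.assoc)
  qed (use q g \<nu> in auto)
  then obtain q' where "q' holomorphic_on UNIV" "\<And>z. q z = (1 - z * \<nu>) ^ n \<nu> * q' z" by auto
  then show ?case using q(2) insert.hyps by (intro exI[of _ q']) (simp add: mult_ac)
qed

lemma entire_cancel_power:
  fixes f g :: "complex \<Rightarrow> complex"
  assumes "f holomorphic_on UNIV" "g holomorphic_on UNIV" "lam \<noteq> 0"
    and eq: "\<And>z. (1 - z * lam) ^ n * f z = (1 - z * lam) ^ n * g z"
  shows "f z = g z"
proof (cases "z = 1 / lam")
  case True
  have "isCont f z" "isCont g z"
    using assms(1,2) holomorphic_on_imp_continuous_on continuous_on_eq_continuous_at[OF open_UNIV] by blast+
  then have lim: "f \<midarrow>z\<rightarrow> f z" "g \<midarrow>z\<rightarrow> g z" by (auto simp: isCont_def)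
  have "f y = g y" if "y \<noteq> z" for y
    using eq[of y] that True assms(3) by (auto simp: field_simps)
  then have "\<forall>\<^sub>F y in at z. f y = g y" by (auto simp: eventually_at_filter)
  with lim(1) have "g \<midarrow>z\<rightarrow> f z" by (rule Lim_transform_eventually)
  then show ?thesis using lim(2) LIM_unique by blast
next
  case False
  then show ?thesis using eq[of z] assms(3) by (auto simp: field_simps)
qed

section \<open>Band functions at k0\<close>

lemma eventually_at_real_iff:
  "(\<forall>\<^sub>F k in at (k0::real). P k) \<longleftrightarrow> (\<exists>e>0. \<forall>k. k \<noteq> k0 \<and> \<bar>k - k0\<bar> < e \<longrightarrow> P k)"
  unfolding eventually_at dist_real_def by simp

lemma band_functions_multiplicity:
  assumes "band_functions T p I E" "\<mu> \<noteq> 0"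
  shows "finite {i\<in>I. E i k = \<mu>}" "eig_mult (Hk T p k) (of_real \<mu>) (card {i\<in>I. E i k = \<mu>})"
proof -
  have "of_real \<mu> \<noteq> (0 :: complex)" using assms(2) by simp
  then have "finite {i\<in>I. complex_of_real (E i k) = of_real \<mu>} \<and>
      eig_mult (Hk T p k) (of_real \<mu>) (card {i\<in>I. complex_of_real (E i k) = of_real \<mu>})"
    using assms(1) unfolding band_functions_def by blast
  then show "finite {i\<in>I. E i k = \<mu>}" "eig_mult (Hk T p k) (of_real \<mu>) (card {i\<in>I. E i k = \<mu>})" by simp_all
qed

text \<open>The determinant is \<open>A z + B z * sech_sum w k\<close>. After division by the factor of the flat bands it
  vanishes at \<open>z = 1 / lam\<close> exactly to the order of \<open>sech_sum w k - sech_sum w k0\<close>, whereas it contains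
  the factor \<open>1 - z * E i k\<close> for every \<open>i \<in> J\<close>.\<close>

lemma band_product_lower_bound:
  assumes symb: "smooth_periodic_symbol T p" and bands: "band_functions T p I E"
    and k0: "k0 = (2*pi/T) / 2 * of_int j" and lam: "lam \<noteq> 0"
    and J: "finite J" "J \<noteq> {}" "\<And>i. i \<in> J \<Longrightarrow> i \<in> I \<and> \<not> flat (E i) \<and> E i k0 = lam"
  shows "\<exists>a>0. \<forall>\<^sub>F k in at k0. a * (k - k0)\<^sup>2 \<le> (\<Prod>i\<in>J. \<bar>E i k - lam\<bar>)"
proof -
  define w where "w = 2 * pi / T"
  have w: "w > 0" using symb by (simp add: w_def smooth_periodic_symbol_def)
  define F where "F = sech_sum w"
  define D where "D k z = fdet (\<lambda>i j. - z * Hk T p k i j)" for k z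
  define idx where "idx k \<mu> = {i\<in>I. E i k = \<mu>}" for k \<mu>
  have ana: "real_analytic (E i)" and nz: "E i k \<noteq> 0" if "i \<in> I" for i k
    using bands that unfolding band_functions_def by blast+
  have idx_fin: "finite (idx k \<mu>)" and idx_mult: "eig_mult (Hk T p k) (of_real \<mu>) (card (idx k \<mu>))"
    if "\<mu> \<noteq> 0" for k \<mu>
    unfolding idx_def by (rule band_functions_multiplicity[OF bands that])+
  have order: "\<exists>g. g holomorphic_on UNIV \<and> g (1 / of_real \<mu>) \<noteq> 0 \<and>
      (\<forall>z. D k z = (1 - z * of_real \<mu>) ^ card (idx k \<mu>) * g z)" if "\<mu> \<noteq> 0" for k \<mu>
    unfolding D_def
    by (rule fdet_eigenvalue_order[OF summable_Hk[OF symb] Hk_hermitian _ _ idx_mult[OF that]]) (use that in auto)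
  obtain A B where AB: "A holomorphic_on UNIV" "B holomorphic_on UNIV" "\<And>k z. D k z = A z + B z * of_real (F k)"
    using fdet_Hk_affine[OF symb] unfolding D_def F_def w_def by blast
  \<comment> \<open>The flat bands at height lam. They contribute m to the multiplicity of lam for
    every k, so the factor of order m divides all the determinants.\<close>
  define Fl where "Fl = {i\<in>I. flat (E i) \<and> E i k0 = lam}"
  define m where "m = card Fl"
  have flat_eq: "E i k = E i k0" if "flat (E i)" for i k using that unfolding flat_def by metis
  have Fl_idx: "Fl \<subseteq> idx k lam" for k using flat_eq by (auto simp: Fl_def idx_def)
  have m_le: "m \<le> card (idx k lam)" for k
    unfolding m_def by (intro card_mono idx_fin lam Fl_idx)
  let ?l = "complex_of_real lam"
  have l: "?l \<noteq> 0" using lam by simp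
  have "\<exists>h. h holomorphic_on UNIV \<and> (\<forall>z. D k z = (1 - z * ?l) ^ m * h z) \<and> (m < card (idx k lam) \<longrightarrow> h (1 / ?l) = 0) \<and>
      (m = card (idx k lam) \<longrightarrow> h (1 / ?l) \<noteq> 0)" for k
  proof -
    obtain g where g: "g holomorphic_on UNIV" "g (1 / ?l) \<noteq> 0" "\<And>z. D k z = (1 - z * ?l) ^ card (idx k lam) * g z"
      using order[OF lam] by blast
    let ?h = "\<lambda>z. (1 - z * ?l) ^ (card (idx k lam) - m) * g z"
    have "?h holomorphic_on UNIV" using g(1) by (intro holomorphic_intros)
    moreover have "D k z = (1 - z * ?l) ^ m * ?h z" for z
      unfolding g(3) using m_le[of k] by (simp add: mult.assoc[symmetric] power_add[symmetric])
    ultimately show ?thesis using g(2) l by (intro exI[of _ ?h]) auto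
  qed
  then obtain h where h: "\<And>k. h k holomorphic_on UNIV" "\<And>k z. D k z = (1 - z * ?l) ^ m * h k z"
    "\<And>k. m < card (idx k lam) \<Longrightarrow> h k (1 / ?l) = 0" "\<And>k. m = card (idx k lam) \<Longrightarrow> h k (1 / ?l) \<noteq> 0"
    by metis
  obtain c \<epsilon> where c: "c > 0" "\<epsilon> > 0" "\<And>k. \<bar>k - k0\<bar> < \<epsilon> \<Longrightarrow> c * (k - k0)\<^sup>2 \<le> \<bar>F k - F k0\<bar>"
    using sech_sum_quadratic_lower_bound[OF w] k0 unfolding F_def w_def by blast
  \<comment> \<open>Any point where F differs from F k0 would do: it separates the coefficient of F
    from the constant term.\<close>
  define k1 where "k1 = k0 + \<epsilon> / 2"
  have F1: "F k1 \<noteq> F k0"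
  proof
    assume "F k1 = F k0"
    then have "c * (\<epsilon> / 2)\<^sup>2 \<le> 0" using c(3)[of k1] c(2) by (simp add: k1_def)
    then show False using c by (simp add: mult_le_0_iff)
  qed
  \<comment> \<open>B divided by \<open>(1 - z * ?l) ^ m\<close>; written as a difference quotient
    of entire functions it is visibly entire.\<close>
  define b where "b z = (h k1 z - h k0 z) / of_real (F k1 - F k0)" for z
  have bhol: "b holomorphic_on UNIV"
    unfolding b_def using h(1) F1 by (intro holomorphic_intros) auto
  define \<phi> where "\<phi> k z = h k0 z + b z * of_real (F k - F k0)" for k z
  have \<phi>hol: "\<phi> k holomorphic_on UNIV" for k
    unfolding \<phi>_def using h(1) bhol by (intro holomorphic_intros)
  have D\<phi>: "D k z = (1 - z * ?l) ^ m * \<phi> k z" for k z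
  proof -
    have "(1 - z * ?l) ^ m * (h k1 z - h k0 z) = B z * of_real (F k1 - F k0)"
    proof -
      have "(1 - z * ?l) ^ m * h k z = A z + B z * of_real (F k)" for k using h(2) AB(3) by metis
      then show ?thesis by (simp add: right_diff_distrib)
    qed
    then have "(1 - z * ?l) ^ m * b z = B z" unfolding b_def using F1 by (simp add: field_simps)
    then have "(1 - z * ?l) ^ m * \<phi> k z = D k0 z + B z * of_real (F k - F k0)"
      unfolding \<phi>_def using h(2)[of k0 z] by (simp add: distrib_left mult.assoc[symmetric])
    then show ?thesis using AB(3)[of k z] AB(3)[of k0 z] by (simp add: algebra_simps)
  qed
  have \<phi>h: "\<phi> k z = h k z" for k z
    by (rule entire_cancel_power[OF \<phi>hol h(1) l, where n = m]) (metis D\<phi> h(2))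
  \<comment> \<open>The members of J are non-flat and reach lam at k0, so the multiplicity there
    exceeds m and the constant term h k0 vanishes at 1 / lam.\<close>
  have \<phi>0: "\<phi> k (1 / ?l) = b (1 / ?l) * of_real (F k - F k0)" for k
  proof -
    have "J \<subseteq> idx k0 lam" "J \<inter> Fl = {}" using J(3) by (auto simp: idx_def Fl_def)
    then have "Fl \<subset> idx k0 lam" using Fl_idx[of k0] J(2) by blast
    then have "m < card (idx k0 lam)" unfolding m_def by (intro psubset_card_mono idx_fin lam)
    then show ?thesis unfolding \<phi>_def using h(3) by simp
  qed
  have b0: "b (1 / ?l) \<noteq> 0"
  proof -
    \<comment> \<open>Countably many non-flat bands have countable level sets, so for some k only
      flat bands take the value lam. There the multiplicity is exactly m and nothing is left to
      vanish at 1 / lam.\<close>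
    have "countable (\<Union>i\<in>{i\<in>I. \<not> flat (E i)}. {k. E i k = lam})"
      by (intro countable_UN nonflat_level_set_countable) (auto intro: ana countableI_type)
    then have "(\<Union>i\<in>{i\<in>I. \<not> flat (E i)}. {k. E i k = lam}) \<noteq> UNIV"
      using uncountable_UNIV_real by metis
    then obtain k where k: "\<And>i. i \<in> I \<Longrightarrow> \<not> flat (E i) \<Longrightarrow> E i k \<noteq> lam" by blast
    have "idx k lam \<subseteq> Fl"
    proof
      fix i assume i: "i \<in> idx k lam"
      then have "flat (E i)" using k by (auto simp: idx_def)
      then show "i \<in> Fl" using i flat_eq[of i k] by (simp add: idx_def Fl_def)
    qed
    then have "idx k lam = Fl" using Fl_idx[of k] by blast
    then have "h k (1 / ?l) \<noteq> 0" by (intro h(4)) (simp add: m_def)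
    then show ?thesis using \<phi>0[of k] \<phi>h[of k] by auto
  qed
  \<comment> \<open>On the unit circle around 1 / lam one has |1 - z E| >= |E| - |1 - E / lam|. With
    |E| >= |lam| / 2 and |1 - E / lam| <= |lam| / 4 this is at least |lam| / 4.\<close>
  define \<eta> where "\<eta> = \<bar>lam\<bar> / 4"
  have \<eta>: "\<eta> > 0" using lam by (simp add: \<eta>_def)
  have "compact (sphere (1 / ?l) 1)" by simp
  then have "bounded (h k0 ` sphere (1 / ?l) 1)" "bounded (b ` sphere (1 / ?l) 1)"
    using h(1)[of k0] bhol
    by (auto intro!: compact_imp_bounded compact_continuous_image holomorphic_on_imp_continuous_on intro: holomorphic_on_subset)
  then obtain C1 C2 where C1: "\<And>z. z \<in> sphere (1 / ?l) 1 \<Longrightarrow> norm (h k0 z) \<le> C1"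
    and C2: "\<And>z. z \<in> sphere (1 / ?l) 1 \<Longrightarrow> norm (b z) \<le> C2"
    unfolding bounded_iff by (metis imageI)
  define C3 where "C3 = exp pi * F k0"
  have Fpos: "0 < F k" for k unfolding F_def by (rule sech_sum_pos[OF w])
  define C where "C = (C1 + C2 * (C3 + F k0)) / \<eta> ^ card J"
  have C2nn: "0 \<le> C2"
  proof -
    have "1 / ?l + 1 \<in> sphere (1 / ?l) 1" by (simp add: dist_norm)
    from order.trans[OF norm_ge_zero C2[OF this]] show ?thesis .
  qed
  have \<phi>bound: "norm (\<phi> k z) \<le> C1 + C2 * (C3 + F k0)" if k: "\<bar>k - k0\<bar> < 1" and z: "z \<in> sphere (1 / ?l) 1" for k z
  proof -
    have "F k \<le> exp (pi * \<bar>k - k0\<bar>) * F k0" unfolding F_def by (rule sech_sum_local_bound[OF w])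
    also have "\<dots> \<le> C3" unfolding C3_def using k Fpos[of k0] by (intro mult_right_mono) auto
    finally have "\<bar>F k - F k0\<bar> \<le> C3 + F k0" using Fpos[of k] Fpos[of k0] by linarith
    then have "norm (b z * of_real (F k - F k0)) \<le> C2 * (C3 + F k0)"
      unfolding norm_mult norm_of_real using C2[OF z] C2nn by (intro mult_mono) auto
    then show ?thesis unfolding \<phi>_def using C1[OF z] norm_triangle_mono by blast
  qed
  \<comment> \<open>The factors of the bands in J divide \<phi> k. The quotient is bounded on the
    circle independently of k, and the maximum principle carries the bound to the centre 1 /
    lam.\<close>
  have upper: "norm (\<phi> k (1 / ?l)) \<le> C * (\<Prod>i\<in>J. \<bar>E i k - lam\<bar> / \<bar>lam\<bar>)"
    if k: "\<bar>k - k0\<bar> < 1" and near: "\<And>i. i \<in> J \<Longrightarrow> E i k \<noteq> lam \<and> \<bar>lam\<bar> / 2 \<le> \<bar>E i k\<bar> \<and> \<bar>1 - E i k / lam\<bar> \<le> \<eta>" for k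
  proof -
    define W where "W = (\<lambda>i. complex_of_real (E i k)) ` J"
    \<comment> \<open>Bands in J may coincide at k, so equal values are grouped. Only members of J
      are counted, and this is at most the full multiplicity.\<close>
    define n where "n \<mu> = card {i\<in>J. complex_of_real (E i k) = \<mu>}" for \<mu>
    have "\<exists>q. q holomorphic_on UNIV \<and> (\<forall>z. \<phi> k z = (\<Prod>\<mu>\<in>W. (1 - z * \<mu>) ^ n \<mu>) * q z)"
    proof (rule entire_divide_powers)
      \<comment> \<open>The flat factor serves as the cofactor: it does not vanish at 1 / \<mu>
        because the bands in J differ from lam at this k.\<close>
      show "(\<lambda>z. (1 - z * ?l) ^ m) holomorphic_on UNIV" by (intro holomorphic_intros)
      fix \<mu> assume "\<mu> \<in> W"
      then obtain i where i: "i \<in> J" "\<mu> = of_real (E i k)" by (auto simp: W_def)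
      have Ei: "E i k \<noteq> 0" using nz J(3) i(1) by blast
      have "1 - 1 / \<mu> * ?l \<noteq> 0" using near[OF i(1)] Ei by (auto simp: i(2) field_simps)
      moreover obtain g where g: "g holomorphic_on UNIV" "\<And>z. D k z = (1 - z * \<mu>) ^ card (idx k (E i k)) * g z"
        using order[OF Ei, of k] unfolding i(2) by blast
      have n_le: "n \<mu> \<le> card (idx k (E i k))"
        unfolding n_def i(2) using J(3) by (intro card_mono idx_fin Ei) (auto simp: idx_def)
      have "(1 - z * ?l) ^ m * \<phi> k z = (1 - z * \<mu>) ^ n \<mu> * ((1 - z * \<mu>) ^ (card (idx k (E i k)) - n \<mu>) * g z)" for z
        unfolding D\<phi>[symmetric] g(2) using n_le by (simp add: mult.assoc[symmetric] power_add[symmetric])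
      moreover have "(\<lambda>z. (1 - z * \<mu>) ^ (card (idx k (E i k)) - n \<mu>) * g z) holomorphic_on UNIV"
        using g(1) by (intro holomorphic_intros)
      ultimately show "\<mu> \<noteq> 0 \<and> (1 - 1 / \<mu> * ?l) ^ m \<noteq> 0 \<and>
          (\<exists>g. g holomorphic_on UNIV \<and> (\<forall>z. (1 - z * ?l) ^ m * \<phi> k z = (1 - z * \<mu>) ^ n \<mu> * g z))"
        using Ei i(2) by auto
    qed (use \<phi>hol J(1) in \<open>auto simp: W_def\<close>)
    then obtain q where q: "q holomorphic_on UNIV" "\<And>z. \<phi> k z = (\<Prod>\<mu>\<in>W. (1 - z * \<mu>) ^ n \<mu>) * q z" by blast
    have regroup: "(\<Prod>\<mu>\<in>W. (1 - z * \<mu>) ^ n \<mu>) = (\<Prod>i\<in>J. 1 - z * of_real (E i k))" for z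
    proof -
      have "(\<Prod>i\<in>J. 1 - z * of_real (E i k)) = (\<Prod>\<mu>\<in>W. \<Prod>i\<in>{i\<in>J. complex_of_real (E i k) = \<mu>}. 1 - z * of_real (E i k))"
        unfolding W_def using J(1) by (rule prod.image_gen)
      also have "\<dots> = (\<Prod>\<mu>\<in>W. (1 - z * \<mu>) ^ n \<mu>)" by (intro prod.cong) (auto simp: n_def)
      finally show ?thesis by simp
    qed
    have q_le: "norm (q z) \<le> C" if z: "z \<in> sphere (1 / ?l) 1" for z
    proof -
      have "\<eta> \<le> norm (1 - z * of_real (E i k))" if i: "i \<in> J" for i
      proof -
        have "1 - z * of_real (E i k) = of_real (1 - E i k / lam) - (z - 1 / ?l) * of_real (E i k)"
          using lam by (simp add: field_simps)
        then have "norm ((z - 1 / ?l) * of_real (E i k)) - norm (complex_of_real (1 - E i k / lam)) \<le> norm (1 - z * of_real (E i k))"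
          by (metis norm_minus_commute norm_triangle_ineq2)
        moreover have "norm (z - 1 / ?l) = 1" using z by (simp add: dist_norm norm_minus_commute)
        ultimately have "\<bar>E i k\<bar> - \<bar>1 - E i k / lam\<bar> \<le> norm (1 - z * of_real (E i k))"
          by (simp only: norm_mult norm_of_real mult_1)
        then show ?thesis using near[OF i] by (simp add: \<eta>_def)
      qed
      then have "\<eta> ^ card J \<le> norm (\<Prod>i\<in>J. 1 - z * of_real (E i k))"
        using \<eta> prod_mono[of J "\<lambda>_. \<eta>" "\<lambda>i. norm (1 - z * of_real (E i k))"] by (simp add: prod_norm[symmetric])
      then have "\<eta> ^ card J * norm (q z) \<le> norm (\<phi> k z)"
        unfolding q(2) regroup norm_mult by (rule mult_right_mono) auto
      also have "\<dots> \<le> C1 + C2 * (C3 + F k0)" using k z by (rule \<phi>bound)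
      finally show ?thesis using \<eta> by (simp add: C_def field_simps)
    qed
    have "norm (q (1 / ?l)) \<le> C"
    proof (rule maximum_modulus_frontier[where f = q and S = "cball (1 / ?l) 1"])
      show "q holomorphic_on interior (cball (1 / ?l) 1)" using q(1) by (rule holomorphic_on_subset) auto
      show "continuous_on (closure (cball (1 / ?l) 1)) q"
        using holomorphic_on_imp_continuous_on[OF q(1)] by (rule continuous_on_subset) auto
    qed (use q_le in auto)
    then have "norm (\<phi> k (1 / ?l)) \<le> norm (\<Prod>i\<in>J. 1 - 1 / ?l * of_real (E i k)) * C"
      unfolding q(2) regroup norm_mult by (intro mult_left_mono) auto
    also have "norm (\<Prod>i\<in>J. 1 - 1 / ?l * of_real (E i k)) = (\<Prod>i\<in>J. \<bar>E i k - lam\<bar> / \<bar>lam\<bar>)"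
      unfolding prod_norm[symmetric]
    proof (intro prod.cong refl)
      fix i
      have "1 - 1 / ?l * of_real (E i k) = of_real ((lam - E i k) / lam)" using lam by (simp add: field_simps)
      then show "norm (1 - 1 / ?l * of_real (E i k)) = \<bar>E i k - lam\<bar> / \<bar>lam\<bar>"
        by (simp only: norm_of_real abs_divide abs_minus_commute)
    qed
    finally show ?thesis by (simp add: mult.commute)
  qed
  have ev: "\<forall>\<^sub>F k in at k0. \<forall>i\<in>J. E i k \<noteq> lam \<and> \<bar>lam\<bar> / 2 \<le> \<bar>E i k\<bar> \<and> \<bar>1 - E i k / lam\<bar> \<le> \<eta>"
  proof (rule eventually_ball_finite[OF J(1)], rule ballI)
    fix i assume i: "i \<in> J"
    have an: "real_analytic (E i)" using ana J(3) i by blast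
    obtain x1 where "E i x1 \<noteq> lam" using J(3)[OF i] unfolding flat_def by blast
    then have 1: "\<forall>\<^sub>F k in at k0. E i k \<noteq> lam"
      using real_analytic_zeros_isolated[OF real_analytic_diff[OF an real_analytic_const[of lam]], of x1 k0]
      unfolding eventually_at_real_iff by auto
    have lim: "(E i \<longlongrightarrow> lam) (at k0)"
      using real_analytic_isCont[OF an, of k0] J(3)[OF i] by (simp add: isCont_def)
    have 2: "\<forall>\<^sub>F k in at k0. \<bar>lam\<bar> / 2 < \<bar>E i k\<bar>"
      using tendsto_rabs[OF lim] lam by (intro order_tendstoD(1)) auto
    have "((\<lambda>k. \<bar>1 - E i k / lam\<bar>) \<longlongrightarrow> \<bar>1 - lam / lam\<bar>) (at k0)"
      using lam by (intro tendsto_intros lim)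
    then have 3: "\<forall>\<^sub>F k in at k0. \<bar>1 - E i k / lam\<bar> < \<eta>"
      using lam \<eta> by (intro order_tendstoD(2)) auto
    show "\<forall>\<^sub>F k in at k0. E i k \<noteq> lam \<and> \<bar>lam\<bar> / 2 \<le> \<bar>E i k\<bar> \<and> \<bar>1 - E i k / lam\<bar> \<le> \<eta>"
      using 1 2 3 by eventually_elim auto
  qed
  \<comment> \<open>Passing from C to |C| + 1 makes the divisor positive.\<close>
  define a where "a = norm (b (1 / ?l)) * c / ((\<bar>C\<bar> + 1) / \<bar>lam\<bar> ^ card J)"
  have pos: "0 < (\<bar>C\<bar> + 1) / \<bar>lam\<bar> ^ card J" using lam by (simp add: add_nonneg_pos)
  have "a > 0" unfolding a_def using b0 c(1) by (intro divide_pos_pos mult_pos_pos pos) simp_all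
  moreover have "\<forall>\<^sub>F k in at k0. \<bar>k - k0\<bar> < min \<epsilon> 1"
    unfolding eventually_at_real_iff using c(2) by (intro exI[of _ "min \<epsilon> 1"]) auto
  then have "\<forall>\<^sub>F k in at k0. a * (k - k0)\<^sup>2 \<le> (\<Prod>i\<in>J. \<bar>E i k - lam\<bar>)"
    using ev
  proof eventually_elim
    case (elim k)
    let ?P = "\<Prod>i\<in>J. \<bar>E i k - lam\<bar>"
    have "norm (b (1 / ?l)) * (c * (k - k0)\<^sup>2) \<le> norm (b (1 / ?l)) * \<bar>F k - F k0\<bar>"
      using c(3)[of k] elim(1) by (intro mult_left_mono) auto
    also have "\<dots> = norm (\<phi> k (1 / ?l))" unfolding \<phi>0 norm_mult norm_of_real ..
    also have "\<dots> \<le> C * (\<Prod>i\<in>J. \<bar>E i k - lam\<bar> / \<bar>lam\<bar>)" using elim by (intro upper) auto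
    also have "\<dots> = C * (?P / \<bar>lam\<bar> ^ card J)" by (simp add: prod_dividef)
    also have "\<dots> \<le> (\<bar>C\<bar> + 1) * (?P / \<bar>lam\<bar> ^ card J)"
      by (intro mult_right_mono divide_nonneg_nonneg prod_nonneg) auto
    finally have "norm (b (1 / ?l)) * c * (k - k0)\<^sup>2 \<le> ?P * ((\<bar>C\<bar> + 1) / \<bar>lam\<bar> ^ card J)" by (simp add: mult_ac)
    then have "norm (b (1 / ?l)) * c * (k - k0)\<^sup>2 / ((\<bar>C\<bar> + 1) / \<bar>lam\<bar> ^ card J) \<le> ?P"
      using pos by (subst pos_divide_le_eq) auto
    then show ?case by (simp add: a_def mult_ac)
  qed
  ultimately show ?thesis by blast
qed

text \<open>The reflected spectrum gives, for each k separately, some band l with the reflected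
  value. Countably many l serve uncountably many k, so one l works on an uncountable set and, by
  analyticity, everywhere.\<close>

lemma band_reflection:
  assumes bands: "band_functions T p I E" and k0: "k0 = (2*pi/T) / 2 * of_int j" and i: "i \<in> I"
  shows "\<exists>l\<in>I. \<forall>k. E l k = E i (2 * k0 - k)"
proof -
  have ana: "real_analytic (E i)" and nz: "E i k \<noteq> 0" if "i \<in> I" for i k
    using bands that unfolding band_functions_def by blast+
  have k0': "2 * k0 = 2 * pi / T * of_int j" using k0 by simp
  have mult: "eig_mult (Hk T p k) (of_real \<mu>) (card {i\<in>I. E i k = \<mu>})" and fin: "finite {i\<in>I. E i k = \<mu>}"
    if "\<mu> \<noteq> 0" for k \<mu>
    by (rule band_functions_multiplicity[OF bands that])+
  have "\<exists>l\<in>I. E l k = E i (2 * k0 - k)" for k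
  proof -
    define \<mu> where "\<mu> = E i (2 * k0 - k)"
    have \<mu>: "\<mu> \<noteq> 0" using nz[OF i] by (simp add: \<mu>_def)
    have "i \<in> {i\<in>I. E i (2 * k0 - k) = \<mu>}" using i by (simp add: \<mu>_def)
    then have "1 \<le> card {i\<in>I. E i (2 * k0 - k) = \<mu>}"
      using fin[OF \<mu>, of "2 * k0 - k"] by (metis One_nat_def Suc_leI card_gt_0_iff empty_iff)
    then have "indep_eigvecs (Hk T p (2 * k0 - k)) (of_real \<mu>) 1"
      using mult[OF \<mu>, of "2 * k0 - k"] unfolding eig_mult_def by blast
    then obtain v where v1: "\<forall>i<1::nat. is_eigvec (Hk T p (2 * k0 - k)) (of_real \<mu>) (v i)"
      and vi: "\<forall>c. (\<forall>m. (\<Sum>i<1. c i * v i m) = 0) \<longrightarrow> (\<forall>i<1. c i = 0)"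
      unfolding indep_eigvecs_def by blast
    have v: "is_eigvec (Hk T p (2 * k0 - k)) (of_real \<mu>) (v 0)" using v1 by simp
    have "\<exists>m. v 0 m \<noteq> 0" using vi[rule_format, of "\<lambda>_. 1" 0] by auto
    then obtain m where m: "v 0 m \<noteq> 0" by blast
    have "indep_eigvecs (Hk T p k) (of_real \<mu>) 1"
      unfolding indep_eigvecs_def
    proof (intro exI[of _ "\<lambda>_ n. cnj (v 0 (- n - j))"] conjI allI impI)
      show "is_eigvec (Hk T p k) (of_real \<mu>) (\<lambda>n. cnj (v 0 (- n - j)))"
        by (rule Hk_reflected_eigenvector[OF k0' v])
      fix c :: "nat \<Rightarrow> complex" and i :: nat
      assume c: "\<forall>m. (\<Sum>i<1. c i * cnj (v 0 (- m - j))) = 0" and i: "i < 1"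
      have "c 0 * cnj (v 0 (- (- m - j) - j)) = 0" using c[rule_format, of "- m - j"] by simp
      then show "c i = 0" using m i by simp
    qed
    then have "1 \<le> card {i\<in>I. E i k = \<mu>}" using mult[OF \<mu>, of k] unfolding eig_mult_def by blast
    then have "{i\<in>I. E i k = \<mu>} \<noteq> {}" by (metis card.empty not_one_le_zero)
    then show ?thesis unfolding \<mu>_def by blast
  qed
  \<comment> \<open>The choice of l so far depends on k; a cardinality argument now fixes
    it.\<close>
  then have "UNIV = (\<Union>l\<in>I. {k. E l k = E i (2 * k0 - k)})" by blast
  then have "uncountable (\<Union>l\<in>I. {k. E l k = E i (2 * k0 - k)})" using uncountable_UNIV_real by simp
  then obtain l where l: "l \<in> I" "uncountable {k. E l k = E i (2 * k0 - k)}"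
    using countable_UN[of I "\<lambda>l. {k. E l k = E i (2 * k0 - k)}"] countableI_type by blast
  have "E l k = E i (2 * k0 - k)" for k
  proof (rule ccontr)
    assume "E l k \<noteq> E i (2 * k0 - k)"
    then have "countable {k. E l k - E i (2 * k0 - k) = 0}"
      using real_analytic_countable_zeros[OF real_analytic_diff[OF ana[OF l(1)] real_analytic_reflect[OF ana[OF i], of "2 * k0"]], of k]
      by simp
    then show False using l(2) by simp
  qed
  then show ?thesis using l(1) by blast
qed

lemma deriv_reflect:
  fixes f g :: "real \<Rightarrow> real"
  assumes f: "(f has_real_derivative deriv f k0) (at k0)" and g: "\<And>k. g k = f (2 * k0 - k)"
  shows "deriv g k0 = - deriv f k0"
proof (rule DERIV_imp_deriv)
  have "((\<lambda>k. 2 * k0 - k) has_real_derivative - 1) (at k0)" by (auto intro!: derivative_eq_intros)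
  then have "((\<lambda>k. f (2 * k0 - k)) has_real_derivative deriv f k0 * - 1) (at k0)"
    using f by (intro DERIV_chain2[of f _ "\<lambda>k. 2 * k0 - k"]) simp_all
  moreover have "g = (\<lambda>k. f (2 * k0 - k))" using g by auto
  ultimately show "(g has_real_derivative - deriv f k0) (at k0)" by simp
qed

theorem theorem6p4:
  fixes T :: real and p :: "real \<Rightarrow> real" and I :: "nat set"
    and E :: "nat \<Rightarrow> real \<Rightarrow> real" and k0 :: real
  assumes symb: "smooth_periodic_symbol T p"
    and bands: "band_functions T p I E"
    and k0: "\<exists>j::int. k0 = (2*pi/T) / 2 * of_int j"
  shows
    "(\<forall>i\<in>{i\<in>I. \<not> flat (E i)}.
        (\<forall>j\<in>{j\<in>I. \<not> flat (E j)}. j \<noteq> i \<longrightarrow> E j k0 \<noteq> E i k0) \<longrightarrow>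
        (\<forall>k. E i k = E i (2*k0 - k)) \<and> deriv (E i) k0 = 0 \<and> deriv (deriv (E i)) k0 \<noteq> 0)
   \<and> (\<forall>i\<in>{i\<in>I. \<not> flat (E i)}. \<forall>j\<in>{j\<in>I. \<not> flat (E j)}.
        i \<noteq> j \<and> E i k0 = E j k0 \<longrightarrow>
        (\<forall>k. E j k = E i (2*k0 - k)) \<and> deriv (E i) k0 = - deriv (E j) k0 \<and> deriv (E i) k0 \<noteq> 0)"
proof -
  obtain N :: int where N: "k0 = (2*pi/T) / 2 * of_int N" using k0 by blast
  have ana: "real_analytic (E i)" and nz: "E i k \<noteq> 0" if "i \<in> I" for i k
    using bands that unfolding band_functions_def by blast+
  have der: "(E i has_real_derivative deriv (E i) k0) (at k0)" if "i \<in> I" for i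
    by (rule real_analytic_has_derivative[OF ana[OF that]])
  have refl: "\<exists>l\<in>I. \<not> flat (E l) \<and> (\<forall>k. E l k = E i (2 * k0 - k)) \<and> E l k0 = E i k0 \<and> deriv (E l) k0 = - deriv (E i) k0"
    if i: "i \<in> I" "\<not> flat (E i)" for i
  proof -
    obtain l where l: "l \<in> I" "\<And>k. E l k = E i (2 * k0 - k)" using band_reflection[OF bands N i(1)] by blast
    have "\<not> flat (E l)"
    proof
      assume "flat (E l)"
      then obtain c where "\<And>k. E l k = c" unfolding flat_def by blast
      then have "E i k = c" for k using l(2)[of "2 * k0 - k"] by simp
      then show False using i(2) unfolding flat_def by blast
    qed
    moreover have "E l k0 = E i k0" using l(2)[of k0] by simp
    moreover have "deriv (E l) k0 = - deriv (E i) k0" by (rule deriv_reflect[OF der[OF i(1)] l(2)])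
    ultimately show ?thesis using l by blast
  qed
  \<comment> \<open>In terms of difference quotients the product bound compares (k - k0)^2 with |k -
    k0| to the power card J, so the size of J decides what it yields.\<close>
  define G where "G i k = (E i k - E i k0) / (k - k0)" for i k
  have G: "(G i \<longlongrightarrow> deriv (E i) k0) (at k0)" if "i \<in> I" for i
    using der[OF that] unfolding G_def by (simp add: has_field_derivative_iff)
  have bound: "\<exists>a>0. \<forall>\<^sub>F k in at k0. a * \<bar>k - k0\<bar>\<^sup>2 \<le> \<bar>k - k0\<bar> ^ card J * (\<Prod>i\<in>J. \<bar>G i k\<bar>)"
    if J: "finite J" "i0 \<in> J" "\<And>i. i \<in> J \<Longrightarrow> i \<in> I \<and> \<not> flat (E i) \<and> E i k0 = E i0 k0" for J i0
  proof -
    obtain a where a: "a > 0" "\<forall>\<^sub>F k in at k0. a * (k - k0)\<^sup>2 \<le> (\<Prod>i\<in>J. \<bar>E i k - E i0 k0\<bar>)"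
      using band_product_lower_bound[OF symb bands N, of "E i0 k0" J] J nz[of i0 k0] by blast
    have "(\<Prod>i\<in>J. \<bar>E i k - E i0 k0\<bar>) = \<bar>k - k0\<bar> ^ card J * (\<Prod>i\<in>J. \<bar>G i k\<bar>)" if "k \<noteq> k0" for k
    proof -
      have "(\<Prod>i\<in>J. \<bar>E i k - E i0 k0\<bar>) = (\<Prod>i\<in>J. \<bar>k - k0\<bar> * \<bar>G i k\<bar>)"
        using that J(3) by (intro prod.cong) (auto simp: G_def abs_divide)
      then show ?thesis by (simp add: prod.distrib)
    qed
    then have "\<forall>\<^sub>F k in at k0. (\<Prod>i\<in>J. \<bar>E i k - E i0 k0\<bar>) = \<bar>k - k0\<bar> ^ card J * (\<Prod>i\<in>J. \<bar>G i k\<bar>)"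
      by (auto simp: eventually_at_filter)
    with a(2) have "\<forall>\<^sub>F k in at k0. a * \<bar>k - k0\<bar>\<^sup>2 \<le> \<bar>k - k0\<bar> ^ card J * (\<Prod>i\<in>J. \<bar>G i k\<bar>)"
      by eventually_elim simp
    with a(1) show ?thesis by blast
  qed
  have ne: "\<forall>\<^sub>F k in at k0. k \<noteq> k0" by (simp add: eventually_at_filter)
  have part1: "(\<forall>k. E i k = E i (2*k0 - k)) \<and> deriv (E i) k0 = 0 \<and> deriv (deriv (E i)) k0 \<noteq> 0"
    if i: "i \<in> I" "\<not> flat (E i)" and iso: "\<And>j. j \<in> I \<Longrightarrow> \<not> flat (E j) \<Longrightarrow> j \<noteq> i \<Longrightarrow> E j k0 \<noteq> E i k0" for i
  proof -
    obtain l where l: "l \<in> I" "\<not> flat (E l)" "\<And>k. E l k = E i (2 * k0 - k)" "E l k0 = E i k0" "deriv (E l) k0 = - deriv (E i) k0"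
      using refl[OF i] by blast
    have li: "l = i" using iso[of l] l by blast
    have d0: "deriv (E i) k0 = 0" using l(5) li by simp
    obtain r h where r: "r > 0" and hc: "isCont h k0" "h k0 = deriv (deriv (E i)) k0 / 2"
      and hx: "\<And>x. \<bar>x - k0\<bar> < r \<Longrightarrow> E i x = E i k0 + deriv (E i) k0 * (x - k0) + (x - k0)\<^sup>2 * h x"
      using real_analytic_expansion[OF ana[OF i(1)], of k0] by blast
    \<comment> \<open>A single band with slope 0 equals its value at k0 plus (k - k0)^2 h k, so the
      bound keeps |h| away from 0.\<close>
    obtain a where a: "a > 0" "\<forall>\<^sub>F k in at k0. a * \<bar>k - k0\<bar>\<^sup>2 \<le> \<bar>k - k0\<bar> ^ card {i} * (\<Prod>i\<in>{i}. \<bar>G i k\<bar>)"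
      using bound[of "{i}" i] i by auto
    have "\<forall>\<^sub>F k in at k0. \<bar>k - k0\<bar> < r" unfolding eventually_at_real_iff using r by blast
    then have "\<forall>\<^sub>F k in at k0. a \<le> \<bar>h k\<bar>"
      using a(2) ne
    proof eventually_elim
      case (elim k)
      have "\<bar>k - k0\<bar> * \<bar>G i k\<bar> = \<bar>E i k - E i k0\<bar>" using elim(3) by (simp add: G_def abs_divide)
      also have "\<dots> = \<bar>k - k0\<bar>\<^sup>2 * \<bar>h k\<bar>" using hx[OF elim(1)] d0 by (simp add: abs_mult)
      finally have "a * \<bar>k - k0\<bar>\<^sup>2 \<le> \<bar>h k\<bar> * \<bar>k - k0\<bar>\<^sup>2" using elim(2) by (simp add: mult.commute)
      then show ?case by (rule mult_right_le_imp_le) (use elim in simp)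
    qed
    moreover have "((\<lambda>k. \<bar>h k\<bar>) \<longlongrightarrow> \<bar>h k0\<bar>) (at k0)" using hc(1) by (intro tendsto_rabs) (simp add: isCont_def)
    ultimately have "a \<le> \<bar>h k0\<bar>" by (intro tendsto_lowerbound[where F = "at k0"]) auto
    then have "deriv (deriv (E i)) k0 \<noteq> 0" using a(1) hc(2) by auto
    then show ?thesis using d0 l(3) li by blast
  qed
  have part2: "(\<forall>k. E j k = E i (2*k0 - k)) \<and> deriv (E i) k0 = - deriv (E j) k0 \<and> deriv (E i) k0 \<noteq> 0"
    if i: "i \<in> I" "\<not> flat (E i)" and j: "j \<in> I" "\<not> flat (E j)" and ij: "i \<noteq> j" "E i k0 = E j k0" for i j
  proof -
    obtain l where l: "l \<in> I" "\<not> flat (E l)" "\<And>k. E l k = E i (2 * k0 - k)" "E l k0 = E i k0" "deriv (E l) k0 = - deriv (E i) k0"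
      using refl[OF i] by blast
    have d: "deriv (E i) k0 \<noteq> 0"
    proof -
      \<comment> \<open>For two bands the powers of |k - k0| cancel, and the product of the two
        slopes is bounded away from 0.\<close>
      obtain a where a: "a > 0" "\<forall>\<^sub>F k in at k0. a * \<bar>k - k0\<bar>\<^sup>2 \<le> \<bar>k - k0\<bar> ^ card {i, j} * (\<Prod>i\<in>{i, j}. \<bar>G i k\<bar>)"
        using bound[of "{i, j}" i] i j ij by auto
      have "\<forall>\<^sub>F k in at k0. a \<le> \<bar>G i k\<bar> * \<bar>G j k\<bar>"
        using a(2) ne
      proof eventually_elim
        case (elim k)
        have "card {i, j} = 2" "(\<Prod>i\<in>{i, j}. \<bar>G i k\<bar>) = \<bar>G i k\<bar> * \<bar>G j k\<bar>" using ij by simp_all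
        with elim(1) have "a * \<bar>k - k0\<bar>\<^sup>2 \<le> (\<bar>G i k\<bar> * \<bar>G j k\<bar>) * \<bar>k - k0\<bar>\<^sup>2" by (simp only: mult.commute)
        then show ?case by (rule mult_right_le_imp_le) (use elim in simp)
      qed
      moreover have "((\<lambda>k. \<bar>G i k\<bar> * \<bar>G j k\<bar>) \<longlongrightarrow> \<bar>deriv (E i) k0\<bar> * \<bar>deriv (E j) k0\<bar>) (at k0)"
        by (intro tendsto_intros G i j)
      ultimately have "a \<le> \<bar>deriv (E i) k0\<bar> * \<bar>deriv (E j) k0\<bar>"
        by (intro tendsto_lowerbound[where F = "at k0"]) auto
      then show ?thesis using a(1) by auto
    qed
    \<comment> \<open>A band equal to its own reflection would have a slope equal to its negative,
      hence 0.\<close>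
    have "l \<noteq> i" using l(5) d by auto
    have "l = j"
    proof (rule ccontr)
      assume "l \<noteq> j"
      have card3: "card {i, j, l} = 3" using ij \<open>l \<noteq> i\<close> \<open>l \<noteq> j\<close> by simp
      \<comment> \<open>With three bands a factor |k - k0| survives on the right and tends to 0,
        contradicting a > 0.\<close>
      obtain a where a: "a > 0" "\<forall>\<^sub>F k in at k0. a * \<bar>k - k0\<bar>\<^sup>2 \<le> \<bar>k - k0\<bar> ^ card {i, j, l} * (\<Prod>i\<in>{i, j, l}. \<bar>G i k\<bar>)"
      proof -
        have "ia \<in> I \<and> \<not> flat (E ia) \<and> E ia k0 = E i k0" if "ia \<in> {i, j, l}" for ia
          using that i j ij l(1,2,4) by auto
        from bound[OF _ _ this, of "{i, j, l}"] show ?thesis using that by auto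
      qed
      have "\<forall>\<^sub>F k in at k0. a \<le> \<bar>k - k0\<bar> * (\<Prod>i\<in>{i, j, l}. \<bar>G i k\<bar>)"
        using a(2) ne
      proof eventually_elim
        case (elim k)
        then have "a * \<bar>k - k0\<bar>\<^sup>2 \<le> (\<bar>k - k0\<bar> * (\<Prod>i\<in>{i, j, l}. \<bar>G i k\<bar>)) * \<bar>k - k0\<bar>\<^sup>2"
          unfolding card3 by (simp only: power3_eq_cube power2_eq_square mult_ac)
        then show ?case by (rule mult_right_le_imp_le) (use elim in simp)
      qed
      moreover have "((\<lambda>k. \<bar>k - k0\<bar> * (\<Prod>i\<in>{i, j, l}. \<bar>G i k\<bar>)) \<longlongrightarrow> \<bar>k0 - k0\<bar> * (\<Prod>i\<in>{i, j, l}. \<bar>deriv (E i) k0\<bar>)) (at k0)"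
        using i j l by (intro tendsto_intros G) auto
      ultimately have "a \<le> \<bar>k0 - k0\<bar> * (\<Prod>i\<in>{i, j, l}. \<bar>deriv (E i) k0\<bar>)"
        by (intro tendsto_lowerbound[where F = "at k0"]) auto
      then show False using a(1) by simp
    qed
    then show ?thesis using l(3,5) d by (metis minus_minus)
  qed
  show ?thesis using part1 part2 by blast
qed

end
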